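(* Fix an integer $k\ge2$. Let $b,\ell$ be two sufficiently large integers. There is a map $\psi_{b,\ell}:\{0,1\}^{b\cdot\ell}\to\mathbb{Z}^{\ell}$ and a set $V_{b,\ell}\subset\mathbb{Z}$ such that for every $x_1,\ldots,x_k\in\{0,1\}^{b\cdot\ell}$, $$\langle x_1,\ldots,x_k\rangle=0\iff\langle\psi_{b,\ell}(x_1),\ldots,\psi_{b,\ell}(x_k)\rangle\in V_{b,\ell},$$ and $0\le\psi_{b,\ell}(x)_i<\ell^{(3k)^{\log^{*}b}\cdot b}$ for all $x\in\{0,1\}^{b\ell}$ and $i\in[\ell]$. Moreover, $\psi_{b,\ell}(x)$ can be computed in $\mathrm{poly}(b\cdot\ell)$ time, and $V_{b,\ell}$ can be constructed in $O\bigl(\ell^{O((3k)^{\log^{*}b}\cdot b)}\cdot\mathrm{poly}(b,\ell)\bigr)$ time.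
   Context: For vectors $y_1,\ldots,y_k\in\mathbb{Z}^m$, $\langle y_1,\ldots,y_k\rangle=\sum_{s=1}^m\prod_{t=1}^k y_t[s]$. $\log^*$ denotes the iterated logarithm. *)

theory Defs
  imports Complex_Main "HOL-Library.Log_Nat"
begin

definition gip :: "nat \<Rightarrow> nat \<Rightarrow> (nat \<Rightarrow> int list) \<Rightarrow> int" where
  "gip k m y = (\<Sum>s<m. \<Prod>t<k. y t ! s)"

definition cube :: "nat \<Rightarrow> int list set" where
  "cube n = {x. length x = n \<and> set x \<subseteq> {0, 1}}"

(* Base 2. The minimum is attained for every real x, see log_star_rec. *)
definition log_star :: "real \<Rightarrow> nat" where
  "log_star x = (LEAST n. (log 2 ^^ n) x \<le> 1)"

lemma log_star_exists: "\<exists>n. (log 2 ^^ n) x \<le> 1"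
proof (induction "nat \<lceil>x\<rceil>" arbitrary: x rule: less_induct)
  case less
  show ?case
  proof (cases "x \<le> 2")
    case True
    show ?thesis
    proof (cases "x \<le> 1")
      case True
      then have "(log 2 ^^ 0) x \<le> 1" by simp
      then show ?thesis by blast
    next
      case False
      with True have "(log 2 ^^ 1) x \<le> 1" by simp
      then show ?thesis by blast
    qed
  next
    case False
    have "2 powr (x - 1) \<ge> x"
    proof -
      have ln2: "ln 2 \<ge> (1/2 :: real)"
        using ln_le_minus_one[of "1/2 :: real"] by (simp add: ln_div)
      have "x / 2 = 1 + (x - 2) / 2" by (simp add: diff_divide_distrib)
      also have "\<dots> \<le> 1 + (x - 2) * ln 2"
        using mult_left_mono[OF ln2, of "x - 2"] False by simp
      also have "\<dots> \<le> exp ((x - 2) * ln 2)" by (rule exp_ge_add_one_self)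
      also have "\<dots> = 2 powr (x - 2)" by (simp add: powr_def)
      also have "\<dots> = 2 powr (x - 1) / 2"
        using powr_diff[of 2 "x - 1" 1] by simp
      finally show ?thesis by simp
    qed
    then have le: "log 2 x \<le> x - 1"
      using False by (simp add: log_le_iff)
    then have "nat \<lceil>log 2 x\<rceil> < nat \<lceil>x\<rceil>"
      using False by linarith
    from less[OF this] obtain n where "(log 2 ^^ n) (log 2 x) \<le> 1" by blast
    then have "(log 2 ^^ Suc n) x \<le> 1"
      by (simp del: funpow.simps add: funpow_Suc_right)
    then show ?thesis by blast
  qed
qed

lemma log_star_rec: "log_star x = (if x \<le> 1 then 0 else Suc (log_star (log 2 x)))"
proof (cases "x \<le> 1")
  case True
  then show ?thesis by (simp add: log_star_def)
next
  case False
  obtain n where "(log 2 ^^ n) x \<le> 1" using log_star_exists by blast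
  from Least_Suc[of "\<lambda>n. (log 2 ^^ n) x \<le> 1", OF this] False
  show ?thesis by (simp del: funpow.simps add: log_star_def funpow_Suc_right)
qed

text \<open>
  The model of computation is the random access machine with logarithmic cost, over unbounded
  integers and with structured control flow. It simulates Turing machines, and is simulated by
  them, with polynomial overhead.
\<close>

type_synonym mem = "nat \<Rightarrow> int"

datatype aexp =
  Num int | Mem aexp | Add aexp aexp | Sub aexp aexp | Mul aexp aexp | Div aexp aexp | Mod aexp aexp

datatype com =
  Skip | Store aexp aexp | Seq com com | Cond aexp com com | While aexp com

(* A negative address is read as 0; division is the total floor division of the library. *)
primrec val :: "aexp \<Rightarrow> mem \<Rightarrow> int" where
  "val (Num n) s = n"
| "val (Mem e) s = s (nat (val e s))"
| "val (Add e f) s = val e s + val f s"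
| "val (Sub e f) s = val e s - val f s"
| "val (Mul e f) s = val e s * val f s"
| "val (Div e f) s = val e s div val f s"
| "val (Mod e f) s = val e s mod val f s"

definition size_cost :: "int \<Rightarrow> nat" where
  "size_cost v = 1 + floorlog 2 (nat \<bar>v\<bar>)"

(* Every node is charged the bit length of its value, so operands, addresses, fetched contents
   and results are all paid for. *)
primrec cost :: "aexp \<Rightarrow> mem \<Rightarrow> nat" where
  "cost (Num n) s = size_cost n"
| "cost (Mem e) s = cost e s + size_cost (val (Mem e) s)"
| "cost (Add e f) s = cost e s + cost f s + size_cost (val (Add e f) s)"
| "cost (Sub e f) s = cost e s + cost f s + size_cost (val (Sub e f) s)"
| "cost (Mul e f) s = cost e s + cost f s + size_cost (val (Mul e f) s)"
| "cost (Div e f) s = cost e s + cost f s + size_cost (val (Div e f) s)"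
| "cost (Mod e f) s = cost e s + cost f s + size_cost (val (Mod e f) s)"

(* exec c s t s': started in s, the program c halts in s' after time t.
   Guards succeed on positive values. *)
inductive exec :: "com \<Rightarrow> mem \<Rightarrow> nat \<Rightarrow> mem \<Rightarrow> bool" where
  Skip: "exec Skip s 1 s"
| Store: "exec (Store e f) s (1 + cost e s + cost f s) (s(nat (val e s) := val f s))"
| Seq: "exec c s t s' \<Longrightarrow> exec d s' u s'' \<Longrightarrow> exec (Seq c d) s (t + u) s''"
| CondT: "val e s > 0 \<Longrightarrow> exec c s t s' \<Longrightarrow> exec (Cond e c d) s (1 + cost e s + t) s'"
| CondF: "val e s \<le> 0 \<Longrightarrow> exec d s t s' \<Longrightarrow> exec (Cond e c d) s (1 + cost e s + t) s'"
| WhileF: "val e s \<le> 0 \<Longrightarrow> exec (While e c) s (1 + cost e s) s"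
| WhileT: "val e s > 0 \<Longrightarrow> exec c s t s' \<Longrightarrow> exec (While e c) s' u s'' \<Longrightarrow>
    exec (While e c) s (1 + cost e s + t + u) s''"

lemma exec_deterministic:
  "exec c s t s' \<Longrightarrow> exec c s u s'' \<Longrightarrow> u = t \<and> s'' = s'"
proof (induction arbitrary: u s'' rule: exec.induct)
  case (Skip s)
  then show ?case by (cases rule: exec.cases) auto
next
  case (Store e f s)
  then show ?case by (cases rule: exec.cases) auto
next
  case (Seq c s t s1 d v s2)
  from Seq.prems obtain t' s1' v' where *: "exec c s t' s1'" "exec d s1' v' s''" "u = t' + v'"
    by (cases rule: exec.cases) auto
  from Seq.IH(1)[OF *(1)] *(2) have "exec d s1 v' s''" "t' = t" by simp_all
  with Seq.IH(2) *(3) show ?case by simp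
next
  case (CondT e s c t s1 d)
  from CondT.prems show ?case
    by (cases rule: exec.cases) (use CondT.hyps in \<open>auto dest!: CondT.IH\<close>)
next
  case (CondF e s d t s1 c)
  from CondF.prems show ?case
    by (cases rule: exec.cases) (use CondF.hyps in \<open>auto dest!: CondF.IH\<close>)
next
  case (WhileF e s c)
  from WhileF.prems show ?case
    by (cases rule: exec.cases) (use WhileF.hyps in auto)
next
  case (WhileT e s c t s1 v s2)
  from WhileT.prems WhileT.hyps(1) obtain t' s1' v'
    where *: "exec c s t' s1'" "exec (While e c) s1' v' s''" "u = 1 + cost e s + t' + v'"
    by (cases rule: exec.cases) auto
  from WhileT.IH(1)[OF *(1)] *(2) have "exec (While e c) s1 v' s''" "t' = t" by simp_all
  with WhileT.IH(2) *(3) show ?case by simp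
qed

(* Lists are passed with their length in cell 0 and their entries in the cells from 1 on. *)
definition load :: "int list \<Rightarrow> mem" where
  "load xs = (\<lambda>a. if a = 0 then int (length xs) else if a \<le> length xs then xs ! (a - 1) else 0)"

definition unload :: "mem \<Rightarrow> int list" where
  "unload s = map (\<lambda>i. s (Suc i)) [0..<nat (s 0)]"

definition computes_within :: "com \<Rightarrow> int list \<Rightarrow> int list \<Rightarrow> nat \<Rightarrow> bool" where
  "computes_within c xs ys T \<longleftrightarrow> (\<exists>t s. t \<le> T \<and> exec c (load xs) t s \<and> unload s = ys)"

end

theory Submission
  imports Defs "HOL-Number_Theory.Cong" "HOL-Computational_Algebra.Primes"
begin

text \<open>
  Split \<open>x\<close> into \<open>\<ell>\<close> blocks of \<open>b\<close> bits and encode every block by one number, by iterated Chinese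
  remaindering. If numbers below \<open>M\<close> encode pieces of \<open>\<beta>\<close> bits, the products \<open>\<langle>y\<^sub>1,\<dots>,y\<^sub>k\<rangle>\<close> of the
  piece encodings stay below \<open>L = \<ell> M\<^sup>k\<close>, so they can be read off modulo pairwise coprime moduli
  \<open>q\<^sub>j \<ge> L\<close>, and about \<open>2\<^sup>\<beta>/\<beta>\<close> pieces are packed into one number modulo the product of the \<open>q\<^sub>j\<close>.
  Piece lengths thus grow like \<open>1, 2, 4, 16, \<dots>\<close>, which gives at most \<open>log\<^sup>* b\<close> levels. Membership in \<open>V\<close>
  means that all iterated residues down to the bits vanish.

  The modulus \<open>q\<^sub>j\<close> is the least power of the \<open>j\<close>-th prime that is at least \<open>L\<close>; then \<open>q\<^sub>j < L p\<^sub>j\<close>, and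
  by a weak Chebyshev bound \<open>p\<^sub>j = O(j\<^sup>2)\<close> the exponent of \<open>\<ell>\<close> per bit grows by at most \<open>2k\<close> per level.
  The slack between \<open>2k\<close> and \<open>3k\<close> pays for the rounding at the last level. No prime larger than \<open>O(b\<^sup>2)\<close> has to be found, which is what makes
  the encoding computable in polynomial time.
\<close>

text \<open>The piece length may grow exponentially because the fanout is at most
  \<open>2 ^ width\<close>: the primes then have O(\<open>width\<close>) bits, so the factor p_j in
  the modulus costs no more, up to a constant, than the piece it carries. Counted in exponents of
  \<ell>, pieces of \<beta> bits with exponent E per bit give L the exponent 1 + k E \<beta>, and
  the prime adds at most \<beta>. Both extra terms fit into a second k E \<beta>, hence the factor
  2k. Tower values divide each other, so only the last level, cut off at b, rounds up, and it wastes
  less than a factor 2. With d \<ge> 2 levels, 2 (2k)^d \<le> (3k)^d absorbs it. Polynomial time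
  rests on a second estimate: 2^d < 2b makes (2k)^d polynomial in b for fixed k, so all numbers
  handled have polynomially many bits. V is listed from a membership table over all values below the
  top \<open>gip_bound\<close>, which is where the power of \<ell> in its cost comes from.\<close>

section \<open>Pairwise coprime moduli\<close>

text \<open>
  Nair's argument: \<open>1 / (m (n choose m))\<close> is an entry of the Leibniz harmonic triangle, hence an integer
  combination of \<open>1, 1/2, \<dots>, 1/n\<close>.
\<close>
lemma mult_choose_dvd:
  assumes D: "\<And>d. 1 \<le> d \<Longrightarrow> d \<le> N \<Longrightarrow> d dvd (D::nat)"
  shows "1 \<le> m \<Longrightarrow> m \<le> n \<Longrightarrow> n \<le> N \<Longrightarrow> real D / (real m * real (n choose m)) \<in> \<int>"
proof (induction m arbitrary: n)
  case 0
  then show ?case by simp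
next
  case (Suc m)
  show ?case
  proof (cases "m = 0")
    case True
    then obtain c where "D = n * c" using D[of n] Suc.prems by (auto elim: dvdE)
    then show ?thesis using True Suc.prems by simp
  next
    case False
    obtain n' where n: "n = Suc n'" using Suc.prems by (cases n) auto
    have mn: "m \<le> n'" using Suc.prems n by simp
    have pos: "real (n' choose m) > 0" "real (Suc n' choose m) > 0" "real (Suc n' choose Suc m) > 0" 
      using mn by (auto simp: zero_less_binomial_iff simp del: binomial_Suc_Suc)
    have a1: "real (Suc m) * real (Suc n' choose Suc m) = real (Suc n') * real (n' choose m)"
      using Suc_times_binomial_eq[of n' m] by (metis of_nat_mult mult.commute)
    have a2: "real (Suc n' choose m) * (real (Suc n') - real m) = real (Suc n') * real (n' choose m)"
    proof -
      have "(Suc n' - m) * (Suc n' choose m) = Suc n' * (n' choose m)"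
        using binomial_absorb_comp[of "Suc n'" m] by simp
      then have "real (Suc n' - m) * real (Suc n' choose m) = real (Suc n') * real (n' choose m)"
        by (metis of_nat_mult)
      then show ?thesis using mn by (simp add: of_nat_diff mult.commute)
    qed
    define c where "c = real (n' choose m)"
    define x where "x = real (Suc n' choose m)"
    define y where "y = real (Suc m) * real (Suc n' choose Suc m)"
    \<comment> \<open>Recurrence of the triangle: the entry at (n, m + 1) is the entry at (n - 1, m)
      minus the entry at (n, m).\<close>
    have "1 / y = 1 / (real m * c) - 1 / (real m * x)"
    proof -
      have y: "y = real (Suc n') * c" using a1 c_def y_def by simp
      have x: "x * (real (Suc n') - real m) = real (Suc n') * c" using a2 c_def x_def by simp
      have cp: "c > 0" "x > 0" using pos c_def x_def by auto
      have "c / x = (real (Suc n') - real m) / real (Suc n')"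
        using x cp by (simp add: field_simps)
      moreover have "1 / (m * c) - 1 / (m * x) = (1 - c / x) / (m * c)"
        using cp False by (simp add: field_simps)
      ultimately have "1 / (m * c) - 1 / (m * x) = (1 - (real (Suc n') - real m) / real (Suc n')) / (m * c)"
        by simp
      also have "1 - (real (Suc n') - real m) / real (Suc n') = real m / real (Suc n')"
        by (simp add: field_simps)
      also have "real m / real (Suc n') / (m * c) = 1 / y"
        using cp False unfolding y by (simp add: divide_simps)
      finally show ?thesis by simp
    qed
    then have "D / y = D / (real m * c) - D / (real m * x)"
      by (metis (no_types) right_diff_distrib times_divide_eq_right mult.right_neutral)
    moreover have "D / (real m * c) \<in> \<int>"
      using Suc.IH[of n'] False mn Suc.prems n c_def by simp
    moreover have "D / (real m * x) \<in> \<int>"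
      using Suc.IH[of n] False mn Suc.prems n x_def by simp
    ultimately show ?thesis unfolding y_def n by (metis Ints_diff)
  qed
qed

text \<open>Each \<open>D / (m * (N choose m))\<close> is a positive integer, so \<open>D\<close>
  bounds N numbers whose sum is \<open>N * 2 ^ (N - 1)\<close>, and hence their average.\<close>

lemma common_multiple_ge:
  assumes D: "\<And>d. 1 \<le> d \<Longrightarrow> d \<le> N \<Longrightarrow> d dvd (D::nat)" and "D > 0" "N \<ge> 1"
  shows "2 ^ (N - 1) \<le> D"
proof -
  have le: "m * (N choose m) \<le> D" if "1 \<le> m" "m \<le> N" for m
  proof -
    have "real D / (real m * real (N choose m)) \<in> \<int>" 
      using mult_choose_dvd[OF D, of N] that by simp
    moreover have "real D / (real m * real (N choose m)) > 0"
      using that assms by (simp add: zero_less_binomial_iff)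
    ultimately have "real D / (real m * real (N choose m)) \<ge> 1"
      by (auto elim!: Ints_cases)
    moreover have "real m * real (N choose m) > 0"
      using that by (simp add: zero_less_binomial_iff)
    ultimately have "real m * real (N choose m) \<le> real D" by (simp add: field_simps)
    then show ?thesis by (metis of_nat_le_iff of_nat_mult)
  qed
  have "N * 2 ^ (N - 1) = (\<Sum>i\<le>N. i * (N choose i))" by (simp add: choose_linear_sum)
  also have "\<dots> = (\<Sum>i\<in>{1..N}. i * (N choose i))"
    by (rule sum.mono_neutral_right) (auto simp: not_le)
  also have "\<dots> \<le> (\<Sum>i\<in>{1..N}. D)" by (rule sum_mono) (use le in auto)
  also have "\<dots> = N * D" by simp
  finally show ?thesis using assms by simp
qed

text \<open>The product over the primes r \<le> N of the largest power of r that is at most N is a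
  common multiple of 1, ..., N. It has one factor per prime, and each factor is at most N.\<close>

lemma two_power_le_primes:
  assumes "N \<ge> 1"
  shows "2 ^ (N - 1) \<le> N ^ card {r. prime r \<and> r \<le> (N::nat)}"
proof -
  let ?S = "{r. prime r \<and> r \<le> N}"
  have fin: "finite ?S" by simp
  define e where "e r = Max {a. r ^ a \<le> N}" for r :: nat
  have fe: "finite {a. r ^ a \<le> N}" if "r \<ge> 2" for r
  proof (rule finite_subset)
    show "{a. r ^ a \<le> N} \<subseteq> {..N}"
    proof
      fix a assume "a \<in> {a. r ^ a \<le> N}"
      then have "r ^ a \<le> N" by simp
      moreover have "a < 2 ^ a" by (rule less_exp)
      moreover have "(2::nat) ^ a \<le> r ^ a" using that by (simp add: power_mono)
      ultimately have "a < N" by linarith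
      then show "a \<in> {..N}" by simp
    qed
  qed simp
  have e1: "r ^ e r \<le> N" if "r \<in> ?S" for r
  proof -
    have "e r \<in> {a. r ^ a \<le> N}" unfolding e_def
      by (rule Max_in) (use that fe[of r] prime_ge_2_nat assms in \<open>auto intro: exI[of _ 0]\<close>)
    then show ?thesis by simp
  qed
  have e2: "a \<le> e r" if "r \<in> ?S" "r ^ a \<le> N" for r a
    unfolding e_def by (rule Max_ge) (use that fe prime_ge_2_nat in auto)
  define D where "D = (\<Prod>r\<in>?S. r ^ e r)"
  have Dpos: "D > 0" unfolding D_def by (rule prod_pos) (auto simp: prime_gt_0_nat)
  have "d dvd D" if "1 \<le> d" "d \<le> N" for d
  proof (rule multiplicity_le_imp_dvd)
    show "d \<noteq> 0" using that by simp
    fix p :: nat assume p: "prime p"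
    show "multiplicity p d \<le> multiplicity p D"
    proof (cases "p dvd d")
      case True
      have dd: "p ^ multiplicity p d dvd d" by (rule multiplicity_dvd)
      then have "p ^ multiplicity p d \<le> N" using that by (meson dvd_imp_le le_trans less_le_trans zero_less_one)
      moreover have "p \<in> ?S" using p True that by (auto dest: dvd_imp_le)
      ultimately have "multiplicity p d \<le> e p" by (simp add: e2)
      then have "p ^ multiplicity p d dvd p ^ e p" by (rule le_imp_power_dvd)
      also have "p ^ e p dvd D" unfolding D_def using \<open>p \<in> ?S\<close> by (intro dvd_prodI) auto
      finally show ?thesis using Dpos p by (intro multiplicity_geI) auto
    next
      case False
      then show ?thesis by (simp add: not_dvd_imp_multiplicity_0)
    qed
  qed
  then have "2 ^ (N - 1) \<le> D" using common_multiple_ge Dpos assms by blast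
  also have "D \<le> (\<Prod>r\<in>?S. N)" unfolding D_def by (rule prod_mono) (use e1 in auto)
  also have "\<dots> = N ^ card ?S" by simp
  finally show ?thesis .
qed

text \<open>In logarithmic form, \<open>2 ^ (N - 1) \<le> N ^ j\<close> is combined with ln N = 2 ln
  x \<le> 2 (x - 1) for x = sqrt N. A factor x - 1 cancels and leaves x \<le> 4 j, hence the square
  and the constant 16. The summand 1 covers N = 1, j = 0.\<close>

lemma prime_count_lower:
  assumes "card {r. prime r \<and> r \<le> (N::nat)} \<le> j"
  shows "N \<le> 16 * j ^ 2 + 1"
proof (cases "N \<le> 1")
  case False
  then have N: "N \<ge> 2" by simp
  have "2 ^ (N - 1) \<le> N ^ j"
    using le_trans[OF two_power_le_primes[of N] power_increasing[OF assms, of N]] N by simp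
  then have "(2::real) ^ (N - 1) \<le> real N ^ j"
    by (metis of_nat_le_iff of_nat_power of_nat_numeral)
  then have "ln ((2::real) ^ (N - 1)) \<le> ln (real N ^ j)"
    using N by (simp add: ln_le_cancel_iff)
  then have 1: "(real N - 1) * ln 2 \<le> real j * ln (real N)"
    using N by (simp add: ln_realpow of_nat_diff)
  define x where "x = sqrt (real N)"
  have x: "x > 1" "x ^ 2 = real N" using N by (auto simp: x_def)
  have "ln (real N) = 2 * ln x" using x by (metis ln_realpow of_nat_numeral less_trans zero_less_one)
  also have "\<dots> \<le> 2 * (x - 1)" using ln_le_minus_one[of x] x by simp
  finally have "(x ^ 2 - 1) * ln 2 \<le> real j * (2 * (x - 1))"
    using 1 x mult_left_mono[of "ln (real N)" "2 * (x - 1)" "real j"] by simp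
  then have "(x - 1) * ((x + 1) * ln 2) \<le> (x - 1) * (2 * real j)"
    by (simp add: algebra_simps power2_eq_square)
  then have 2: "(x + 1) * ln 2 \<le> 2 * real j" using x by simp
  have "ln 2 \<ge> (1/2 :: real)"
    using ln_le_minus_one[of "1/2 :: real"] by (simp add: ln_div)
  then have "(x + 1) * (1/2) \<le> (x + 1) * ln 2" using x by (intro mult_left_mono) auto
  then have "x \<le> 4 * real j" using 2 by argo
  then have "x ^ 2 \<le> (4 * real j) ^ 2" using x by (intro power_mono) auto
  then have "real N \<le> real (16 * j ^ 2)" using x by (simp add: power_mult_distrib)
  then show ?thesis by linarith
qed simp

section \<open>Greedy choice of prime powers as moduli\<close>

definition nondiv :: "nat \<Rightarrow> nat" where
  "nondiv m = (LEAST p. 2 \<le> p \<and> \<not> p dvd m)"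

definition min_exp :: "nat \<Rightarrow> nat \<Rightarrow> nat" where
  "min_exp L p = (LEAST e. L \<le> p ^ e)"

text \<open>The recursion sees the earlier moduli only through their product. A program therefore
  finds the next prime by trial divisions of this one number; that the result is prime is shown in
  \<open>base_prime_prime_bound\<close>.\<close>

primrec modprod :: "nat \<Rightarrow> nat \<Rightarrow> nat" where
  "modprod L 0 = 1"
| "modprod L (Suc j) = modprod L j * nondiv (modprod L j) ^ min_exp L (nondiv (modprod L j))"

definition base_prime :: "nat \<Rightarrow> nat \<Rightarrow> nat" where "base_prime L j = nondiv (modprod L j)"

definition modulus :: "nat \<Rightarrow> nat \<Rightarrow> nat" where "modulus L j = base_prime L j ^ min_exp L (base_prime L j)"

lemma modprod_Suc: "modprod L (Suc j) = modprod L j * modulus L j"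
  by (simp add: modulus_def base_prime_def)

lemma modprod_eq_prod: "modprod L n = (\<Prod>j<n. modulus L j)"
  by (induction n) (simp_all add: modprod_Suc del: modprod.simps(2))

lemma nondiv:
  assumes "m > 0"
  shows "2 \<le> nondiv m" "\<not> nondiv m dvd m" "\<And>d. 1 \<le> d \<Longrightarrow> d < nondiv m \<Longrightarrow> d dvd m"
proof -
  have "2 \<le> m + 1 \<and> \<not> m + 1 dvd m" using assms by (auto dest: dvd_imp_le)
  then have *: "2 \<le> nondiv m \<and> \<not> nondiv m dvd m"
    unfolding nondiv_def by (rule LeastI)
  then show "2 \<le> nondiv m" "\<not> nondiv m dvd m" by auto
  fix d assume d: "1 \<le> d" "d < nondiv m"
  show "d dvd m"
  proof (cases "d = 1")
    case False
    then show ?thesis using d not_less_Least[of d "\<lambda>p. 2 \<le> p \<and> \<not> p dvd m"] by (auto simp: nondiv_def)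
  qed simp
qed

lemma modprod_pos: "modprod L j > 0"
proof (induction j)
  case (Suc j)
  then show ?case using nondiv(1)[OF Suc] by simp
qed simp

lemma base_prime_ge_2: "base_prime L j \<ge> 2"
  unfolding base_prime_def by (rule nondiv(1)) (rule modprod_pos)

lemma min_exp:
  assumes "p \<ge> 2"
  shows "L \<le> p ^ min_exp L p" "\<And>e. e < min_exp L p \<Longrightarrow> p ^ e < L"
proof -
  have "L < 2 ^ L" by (rule less_exp)
  also have "(2::nat) ^ L \<le> p ^ L" using assms by (rule power_mono) simp
  finally have "L \<le> p ^ L" by simp
  then show "L \<le> p ^ min_exp L p" unfolding min_exp_def by (rule LeastI)
  show "\<And>e. e < min_exp L p \<Longrightarrow> p ^ e < L" unfolding min_exp_def by (meson not_less_Least not_le)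
qed

lemma min_exp_pos: "p \<ge> 2 \<Longrightarrow> L \<ge> 2 \<Longrightarrow> min_exp L p > 0"
  using min_exp(1)[of p L] by (cases "min_exp L p") auto

lemma modulus_ge: "L \<le> modulus L j" and modulus_pos: "modulus L j > 0"
  using min_exp(1)[OF base_prime_ge_2] base_prime_ge_2[of L j] by (auto simp: modulus_def)

lemma modulus_le: assumes "L \<ge> 2" shows "modulus L j \<le> L * base_prime L j"
proof -
  obtain e where e: "min_exp L (base_prime L j) = Suc e" using min_exp_pos[OF base_prime_ge_2 assms] by (metis gr0_implies_Suc)
  then have "base_prime L j ^ e < L" using min_exp(2)[OF base_prime_ge_2] by simp
  then show ?thesis using e by (simp add: modulus_def)
qed

lemma modulus_dvd_modprod: "i < j \<Longrightarrow> modulus L i dvd modprod L j"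
  unfolding modprod_eq_prod by (rule dvd_prodI) auto

lemma prime_dvd_modprod:
  assumes "\<And>i. i < j \<Longrightarrow> prime (base_prime L i)" "prime r" "r dvd modprod L j"
  obtains i where "i < j" "r = base_prime L i"
proof -
  obtain i where "i < j" "r dvd modulus L i"
    using assms(2,3) unfolding modprod_eq_prod by (auto simp: prime_dvd_prod_iff)
  then have "r dvd base_prime L i" using assms(2) prime_dvd_power by (auto simp: modulus_def)
  then have "r = base_prime L i" using assms(1,2) \<open>i < j\<close> by (simp add: primes_dvd_imp_eq)
  then show ?thesis using \<open>i < j\<close> by (rule that[rotated])
qed

text \<open>
  The least non-divisor \<open>p \<le> L\<close> of the product of the previous moduli is prime: every prime power that
  divides a composite \<open>p\<close> is at most \<open>L\<close>, so it divides the modulus belonging to its prime.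
\<close>
lemma base_prime_prime_bound:
  assumes L: "16 * n ^ 2 + 2 \<le> L"
  shows "j < n \<Longrightarrow> prime (base_prime L j) \<and> base_prime L j \<le> 16 * j ^ 2 + 2"
proof (induction j rule: less_induct)
  case (less j)
  let ?p = "base_prime L j" and ?m = "modprod L j"
  have IH: "prime (base_prime L i)" if "i < j" for i using less that by simp
  have p2: "?p \<ge> 2" by (rule base_prime_ge_2)
  have dv: "d dvd ?m" if "1 \<le> d" "d < ?p" for d
    using nondiv(3)[OF modprod_pos] that by (simp add: base_prime_def)
  have nd: "\<not> ?p dvd ?m" using nondiv(2)[OF modprod_pos] by (simp add: base_prime_def)
  \<comment> \<open>All numbers below the least non-divisor divide the product, so the primes among
    them are earlier base primes. There are at most j of these, and the prime count bounds
    \<open>?p - 1\<close>.\<close>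
  have "{r. prime r \<and> r \<le> ?p - 1} \<subseteq> base_prime L ` {..<j}"
  proof
    fix r assume r: "r \<in> {r. prime r \<and> r \<le> ?p - 1}"
    then have "r dvd ?m" using p2 prime_ge_1_nat by (intro dv) auto
    then show "r \<in> base_prime L ` {..<j}" using prime_dvd_modprod[OF IH, of j r] r by auto
  qed
  then have "card {r. prime r \<and> r \<le> ?p - 1} \<le> card (base_prime L ` {..<j})" by (intro card_mono) auto
  also have "\<dots> \<le> j" using card_image_le[of "{..<j}" "base_prime L"] by simp
  finally have bound: "?p \<le> 16 * j ^ 2 + 2" using prime_count_lower[of "?p - 1" j] by linarith
  have "j ^ 2 \<le> n ^ 2" using less.prems by (intro power_mono) auto
  then have pL: "?p \<le> L" using bound L by linarith
  have "prime ?p"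
  proof (rule ccontr)
    assume np: "\<not> prime ?p"
    have "?p dvd ?m"
    proof (rule multiplicity_le_imp_dvd)
      show "?p \<noteq> 0" using p2 by simp
      fix r :: nat assume r: "prime r"
      show "multiplicity r ?p \<le> multiplicity r ?m"
      proof (cases "r dvd ?p")
        case True
        then have "r \<le> ?p" "r \<noteq> ?p" using p2 r np by (auto dest: dvd_imp_le)
        then have "r dvd ?m" using r prime_ge_1_nat by (intro dv) auto
        then obtain i where i: "i < j" "r = base_prime L i" using prime_dvd_modprod[OF IH] r by blast
        have "r ^ multiplicity r ?p \<le> ?p" using p2 by (intro dvd_imp_le multiplicity_dvd) auto
        also have "\<dots> \<le> r ^ min_exp L r" using pL min_exp(1)[of r L] r prime_ge_2_nat by force
        finally have "multiplicity r ?p \<le> min_exp L r"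
          using r prime_gt_1_nat power_le_imp_le_exp by blast
        then have "r ^ multiplicity r ?p dvd r ^ min_exp L r" by (rule le_imp_power_dvd)
        also have "\<dots> = modulus L i" using i by (simp add: modulus_def)
        also have "\<dots> dvd ?m" using i by (intro modulus_dvd_modprod)
        finally show ?thesis using r modprod_pos[of L j] by (intro multiplicity_geI) auto
      qed (simp add: not_dvd_imp_multiplicity_0)
    qed
    then show False using nd by simp
  qed
  then show ?case using bound by simp
qed

lemma coprime_base_prime_modprod:
  assumes "16 * n ^ 2 + 2 \<le> L" "j < n"
  shows "coprime (base_prime L j) (modprod L j)"
  using base_prime_prime_bound[OF assms] nondiv(2)[OF modprod_pos, of L j] 
  by (intro prime_imp_coprime) (auto simp: base_prime_def)

lemma coprime_modulus_modprod:
  assumes "16 * n ^ 2 + 2 \<le> L" "j < n"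
  shows "coprime (modulus L j) (modprod L j)"
  unfolding modulus_def using coprime_base_prime_modprod[OF assms] by simp

lemma coprime_modulus:
  assumes "16 * n ^ 2 + 2 \<le> L" "i < n" "j < n" "i \<noteq> j"
  shows "coprime (modulus L i) (modulus L j)"
proof -
  have *: "coprime (modulus L i) (modulus L j)" if "i < j" "j < n" for i j
    using coprime_modulus_modprod[OF assms(1) \<open>j < n\<close>] modulus_dvd_modprod[OF \<open>i < j\<close>, of L]
    by (meson coprime_commute coprime_divisors dvd_refl)
  show ?thesis using *[of i j] *[of j i] assms by (auto simp: coprime_commute neq_iff)
qed

section \<open>Chinese remaindering with these moduli\<close>

definition crt :: "nat \<Rightarrow> nat \<Rightarrow> (nat \<Rightarrow> nat) \<Rightarrow> nat" where
  "crt L n f = (THE v. v < modprod L n \<and> (\<forall>j<n. [v = f j] (mod modulus L j)))"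

lemma crt_ex1:
  assumes "16 * n ^ 2 + 2 \<le> L"
  shows "\<exists>!v. v < modprod L n \<and> (\<forall>j<n. [v = f j] (mod modulus L j))"
  using chinese_remainder_unique_nat[of "{..<n}" "modulus L" f] coprime_modulus[OF assms] modulus_pos
  by (auto simp: modprod_eq_prod)

lemma crt:
  assumes "16 * n ^ 2 + 2 \<le> L"
  shows "crt L n f < modprod L n" "\<And>j. j < n \<Longrightarrow> [crt L n f = f j] (mod modulus L j)"
  using theI'[OF crt_ex1[OF assms, of f]] by (auto simp: crt_def)

lemma crt_eqI:
  assumes "16 * n ^ 2 + 2 \<le> L" "v < modprod L n" "\<And>j. j < n \<Longrightarrow> [v = f j] (mod modulus L j)"
  shows "crt L n f = v"
  using the1_equality[OF crt_ex1[OF assms(1), of f], of v] assms(2,3) by (auto simp: crt_def)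

lemma crt_0: "16 * n ^ 2 + 2 \<le> L \<Longrightarrow> crt L n (\<lambda>j. 0) = 0"
  by (rule crt_eqI) (use modprod_pos in auto)

lemma crt_cong: "(\<And>j. j < n \<Longrightarrow> f j = g j) \<Longrightarrow> crt L n f = crt L n g"
  by (simp add: crt_def)

section \<open>The levels of the encoding\<close>

primrec tower :: "nat \<Rightarrow> nat" where
  "tower 0 = 1"
| "tower (Suc s) = 2 ^ tower s"

lemma tower_less_Suc: "tower s < tower (Suc s)"
  by simp

text \<open>Yields the existence of \<open>depth\<close> and, through \<open>power_depth\<close>,
  that \<open>(2 * k) ^ depth\<close> is polynomial in \<open>b\<close> for fixed
  \<open>k\<close>.\<close>

lemma tower_ge_power: "2 ^ s \<le> tower s"
proof (induction s)
  case (Suc s)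
  have "2 * 2 ^ s \<le> 2 * tower s" using Suc by simp
  also have "\<dots> \<le> 2 ^ tower s"
  proof (cases "tower s")
    case (Suc n)
    have "2 * Suc n \<le> 2 * (2 ^ n :: nat)" using less_exp by (intro mult_le_mono2 Suc_leI)
    then show ?thesis unfolding Suc power_Suc .
  qed simp
  finally show ?case by simp
qed simp

lemma tower_pos [simp]: "tower s > 0"
  using tower_ge_power[of s] less_le_trans by fastforce

lemma tower_mono: "s \<le> s' \<Longrightarrow> tower s \<le> tower s'"
  using lift_Suc_mono_le[of tower] tower_less_Suc less_imp_le by blast

text \<open>All tower values are powers of 2. The divisibility keeps the fanout free of rounding
  until the width is cut off at \<open>b\<close>.\<close>

lemma tower_dvd_Suc: "tower s dvd tower (Suc s)"
proof (cases s)
  case (Suc s')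
  then show ?thesis using tower_mono[of s' s] by (simp add: le_imp_power_dvd)
qed simp

lemma log_star_gt_tower: "real (tower s) < x \<Longrightarrow> s < log_star x"
proof (induction s arbitrary: x)
  case 0
  then show ?case by (subst log_star_rec) simp
next
  case (Suc s)
  have x: "x > 1" using Suc.prems by (auto intro: less_trans[rotated])
  have "2 powr real (tower s) < x" using Suc.prems by (simp add: powr_realpow)
  then have "real (tower s) < log 2 x" using x by (simp add: less_log_iff)
  then show ?case using Suc.IH x by (subst log_star_rec) auto
qed

text \<open>\<open>b \<ge> 3\<close> forces at least two levels, as \<open>exponent_le\<close>
  requires. The bound 72 = 18 * 4 lets a power of \<open>l\<close> absorb the prime bound
  \<open>16 * j ^ 2 + 2\<close> \<le> 18 * 4 ^ \<open>width s\<close>.\<close>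

locale dimred =
  fixes k b l :: nat
  assumes k: "k \<ge> 2" and b: "b \<ge> 3" and l: "l \<ge> 72"
begin

text \<open>
  At level \<open>s\<close> an entry encodes \<open>width s\<close> bits by a number below \<open>entry_bound s\<close>; \<open>fanout s\<close> entries are
  merged into one entry of level \<open>s + 1\<close>. Positions beyond \<open>b\<close> are padded with \<open>0\<close>.
\<close>
definition width :: "nat \<Rightarrow> nat" where "width s = min (tower s) b"

definition fanout :: "nat \<Rightarrow> nat" where "fanout s = (width (Suc s) + width s - 1) div width s"

primrec entry_bound :: "nat \<Rightarrow> nat" where
  "entry_bound 0 = 2"
| "entry_bound (Suc s) = modprod (l * entry_bound s ^ k) (fanout s)"

definition gip_bound :: "nat \<Rightarrow> nat" where "gip_bound s = l * entry_bound s ^ k"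

text \<open>Every level keeps the index range below \<open>b\<close>, although higher levels have
  only zeros at large indices. This lets a program replace each level by the next inside the
  \<open>b\<close> input cells of a block.\<close>

primrec encode :: "(nat \<Rightarrow> nat) \<Rightarrow> nat \<Rightarrow> nat \<Rightarrow> nat" where
  "encode x 0 g = (if g < b then x g else 0)"
| "encode x (Suc s) g = crt (gip_bound s) (fanout s) (\<lambda>j. if g * fanout s + j < b then encode x s (g * fanout s + j) else 0)"

text \<open>The upper bound makes the set finite, so it can be listed; inner products of encodings
  satisfy it by \<open>level_gip_less\<close>.\<close>

primrec accepted :: "nat \<Rightarrow> nat set" where
  "accepted 0 = {0}"
| "accepted (Suc s) = {v. v < gip_bound (Suc s) \<and> (\<forall>j<fanout s. v mod modulus (gip_bound s) j \<in> accepted s)}"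

definition depth :: nat where "depth = (LEAST s. b \<le> tower s)"

lemma width_0: "width 0 = 1" using b by (simp add: width_def)

text \<open>Once the width has reached \<open>b\<close> it stays there, since
  \<open>b < 2 ^ b\<close>. The next width can thus be computed from the truncated current one,
  without the tower itself.\<close>

lemma width_Suc: "width (Suc s) = min (2 ^ width s) b"
proof (cases "tower s \<le> b")
  case True
  then show ?thesis by (simp add: width_def)
next
  case False
  then have "2 ^ b \<le> (2::nat) ^ tower s" by (intro power_increasing) auto
  moreover have b2: "b < 2 ^ b" by (rule less_exp)
  ultimately have "b \<le> 2 ^ tower s" by linarith
  then show ?thesis using False b2 by (simp add: width_def)
qed

lemma width_pos [simp]: "width s > 0" using b by (simp add: width_def)

lemma width_le: "width s \<le> b" by (simp add: width_def)

lemma fanout_width: "width (Suc s) \<le> fanout s * width s" "fanout s * width s < width (Suc s) + width s"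
proof -
  have "fanout s * width s = (width (Suc s) + width s - 1) - (width (Suc s) + width s - 1) mod width s"
    unfolding fanout_def by (simp add: minus_mod_eq_div_mult)
  moreover have "(width (Suc s) + width s - 1) mod width s < width s" by simp
  ultimately show "width (Suc s) \<le> fanout s * width s" "fanout s * width s < width (Suc s) + width s"
    using width_pos[of s] width_pos[of "Suc s"] by linarith+
qed

lemma fanout_pos [simp]: "fanout s > 0"
  using fanout_width(1)[of s] width_pos[of "Suc s"] by (metis gr0I le_zero_eq less_numeral_extra(3) mult_0)

lemma fanout_le_width: "fanout s \<le> width (Suc s)"
proof -
  have "(width (Suc s) + width s - 1) \<le> width (Suc s) * width s + (width s - 1)"
    using width_pos[of s] by (cases "width s") auto
  then have "fanout s \<le> (width (Suc s) * width s + (width s - 1)) div width s"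
    unfolding fanout_def by (rule div_le_mono)
  also have "\<dots> = width (Suc s)" by (simp add: div_mult_self3)
  finally show ?thesis .
qed

lemma fanout_le: "fanout s \<le> b" and fanout_le_power: "fanout s \<le> 2 ^ width s"
  using fanout_le_width[of s] by (auto simp: width_Suc)

lemma entry_bound_Suc: "entry_bound (Suc s) = modprod (gip_bound s) (fanout s)"
  by (simp add: gip_bound_def)

declare entry_bound.simps(2) [simp del]

lemma prod_modulus_ge: "L ^ n \<le> modprod L n"
proof -
  have "(\<Prod>j<n. L) \<le> modprod L n" unfolding modprod_eq_prod by (rule prod_mono) (simp add: modulus_ge)
  then show ?thesis by simp
qed

lemma entry_bound_ge: "2 ^ width s \<le> entry_bound s"
proof (induction s)
  case 0
  then show ?case by (simp add: width_0)
next
  case (Suc s)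
  have "(2::nat) ^ width (Suc s) \<le> 2 ^ (width s * fanout s)"
    using fanout_width(1) by (intro power_increasing) (auto simp: mult.commute)
  also have "\<dots> = (2 ^ width s) ^ fanout s" by (simp add: power_mult)
  also have "\<dots> \<le> entry_bound s ^ fanout s" using Suc by (rule power_mono) simp
  also have "\<dots> \<le> gip_bound s ^ fanout s"
  proof (rule power_mono)
    have "entry_bound s ^ 1 \<le> entry_bound s ^ k" using k Suc by (intro power_increasing) (use one_le_power[of "2::nat" "width s"] in linarith)+
    then show "entry_bound s \<le> gip_bound s" using l by (simp add: gip_bound_def) (metis le_trans mult_le_mono1 nat_mult_1 one_le_numeral)
  qed simp
  also have "\<dots> \<le> entry_bound (Suc s)" unfolding entry_bound_Suc by (rule prod_modulus_ge)
  finally show ?case .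
qed

lemma entry_bound_ge_2: "2 \<le> entry_bound s"
proof -
  have "(2::nat) ^ 1 \<le> 2 ^ width s" by (intro power_increasing) (auto simp: Suc_leI)
  then show ?thesis using entry_bound_ge[of s] by simp
qed

text \<open>The precondition of all facts about the moduli. The fanout is at most
  \<open>2 ^ width s\<close> \<le> \<open>entry_bound s\<close>, and \<open>k \<ge> 2\<close>
  supplies the square.\<close>

lemma gip_bound_bound: "16 * fanout s ^ 2 + 2 \<le> gip_bound s"
proof -
  have "fanout s ^ 2 \<le> (2 ^ width s) ^ 2" using fanout_le_power by (intro power_mono) auto
  also have "\<dots> \<le> entry_bound s ^ 2" using entry_bound_ge by (intro power_mono) auto
  also have "\<dots> \<le> entry_bound s ^ k" using k entry_bound_ge_2[of s] by (intro power_increasing) auto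
  finally have *: "fanout s ^ 2 \<le> entry_bound s ^ k" .
  moreover have "1 \<le> fanout s ^ 2" by (simp add: Suc_leI)
  ultimately have "16 * fanout s ^ 2 + 2 \<le> 72 * entry_bound s ^ k" by linarith
  also have "\<dots> \<le> gip_bound s" using l by (simp add: gip_bound_def)
  finally show ?thesis .
qed

lemma gip_bound_ge_2: "2 \<le> gip_bound s" using gip_bound_bound[of s] by simp

lemma entry_bound_le_gip_bound: "entry_bound s \<le> gip_bound s"
proof -
  have "entry_bound s ^ 1 \<le> entry_bound s ^ k" using k entry_bound_ge_2[of s] by (intro power_increasing) auto
  also have "\<dots> \<le> l * entry_bound s ^ k" using l by simp
  finally show ?thesis by (simp add: gip_bound_def)
qed

lemma modprod_le_entry_bound: "j < fanout s \<Longrightarrow> modprod (gip_bound s) (Suc j) \<le> entry_bound (Suc s)"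
proof -
  assume "j < fanout s"
  then have "modprod (gip_bound s) (Suc j) dvd entry_bound (Suc s)" unfolding entry_bound_Suc modprod_eq_prod
    by (intro prod_dvd_prod_subset) auto
  then show ?thesis unfolding entry_bound_Suc using modprod_pos by (intro dvd_imp_le) auto
qed

lemma gip_bound_le_entry_bound: "gip_bound s \<le> entry_bound (Suc s)"
proof -
  have "gip_bound s ^ 1 \<le> gip_bound s ^ fanout s" using gip_bound_ge_2[of s] by (intro power_increasing) (auto simp: Suc_leI)
  also have "\<dots> \<le> entry_bound (Suc s)" unfolding entry_bound_Suc by (rule prod_modulus_ge)
  finally show ?thesis by simp
qed

lemma entry_bound_mono: "s \<le> s' \<Longrightarrow> entry_bound s \<le> entry_bound s'"
  using lift_Suc_mono_le[of entry_bound] entry_bound_le_gip_bound gip_bound_le_entry_bound le_trans by metis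

lemma gip_bound_mono: "s \<le> s' \<Longrightarrow> gip_bound s \<le> gip_bound s'"
  unfolding gip_bound_def using entry_bound_mono by (simp add: power_mono)

section \<open>The number of levels and the size of the encoded numbers\<close>

lemma depth: "b \<le> tower depth" "\<And>s. s < depth \<Longrightarrow> tower s < b"
proof -
  have "b \<le> tower b" using tower_ge_power[of b] less_exp[of b] by linarith
  then show "b \<le> tower depth" unfolding depth_def by (rule LeastI)
  show "\<And>s. s < depth \<Longrightarrow> tower s < b" unfolding depth_def by (meson not_less_Least not_le)
qed

lemma width_depth: "width depth = b" using depth(1) by (simp add: width_def)

lemma width_less_depth: "s < depth \<Longrightarrow> width s < b" using depth(2) by (simp add: width_def)

lemma depth_ge_2: "depth \<ge> 2"
proof (rule ccontr)
  assume "\<not> depth \<ge> 2"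
  then have "tower depth \<le> tower 1" by (intro tower_mono) simp
  then show False using depth(1) b by simp
qed

lemma depth_le: "depth \<le> log_star (real b)"
  using log_star_gt_tower[of "depth - 1" "real b"] depth(2)[of "depth - 1"] depth_ge_2 by simp

lemma power_depth: "2 ^ depth < 2 * b"
proof -
  have "2 ^ (depth - 1) \<le> tower (depth - 1)" by (rule tower_ge_power)
  also have "\<dots> < b" using depth(2) depth_ge_2 by simp
  finally have "2 * 2 ^ (depth - 1) < 2 * b" by simp
  then show ?thesis using depth_ge_2 by (cases depth) auto
qed

text \<open>\<open>E\<close> is the exponent of \<open>l\<close> per encoded bit. A modulus is at
  most L times its prime: L contributes \<open>1 + E * width s * k\<close>, the prime at most
  \<open>width s\<close>, and \<open>k * E \<ge> 2\<close> lets a second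
  \<open>k * E * width s\<close> absorb the additive terms. The product
  \<open>fanout s * width s\<close> is the next width rounded up.\<close>

lemma entry_bound_Suc_le:
  assumes "entry_bound s \<le> l ^ (E * width s)" "E \<ge> 1"
  shows "entry_bound (Suc s) \<le> l ^ (2 * k * E * (fanout s * width s))"
proof -
  have "modulus (gip_bound s) j \<le> l ^ (2 * k * E * width s)" if "j < fanout s" for j
  proof -
    have "base_prime (gip_bound s) j \<le> 16 * j ^ 2 + 2" using base_prime_prime_bound[OF gip_bound_bound that] by simp
    also have "j ^ 2 \<le> (2 ^ width s) ^ 2" using that fanout_le_power[of s] by (intro power_mono) auto
    finally have "base_prime (gip_bound s) j \<le> 16 * 4 ^ width s + 2" by (simp add: power_mult[symmetric] mult.commute power_mult)
    \<comment> \<open>The constant 18 is raised to the power \<open>width s\<close> as well, so that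
      the prime is bounded by a power of 72 and hence of \<open>l\<close>.\<close>
    also have "\<dots> \<le> 18 * 4 ^ width s" by simp
    also have "\<dots> \<le> 18 ^ width s * 4 ^ width s" using self_le_power[of "18::nat" "width s"] by simp
    also have "\<dots> = 72 ^ width s" by (simp add: power_mult_distrib[symmetric])
    also have "\<dots> \<le> l ^ width s" using l by (rule power_mono) simp
    finally have p: "base_prime (gip_bound s) j \<le> l ^ width s" .
    have "gip_bound s \<le> l * (l ^ (E * width s)) ^ k" unfolding gip_bound_def
      using assms(1) by (intro mult_left_mono power_mono) auto
    also have "\<dots> = l ^ (1 + E * width s * k)" by (simp add: power_mult)
    finally have "gip_bound s * base_prime (gip_bound s) j \<le> l ^ (1 + E * width s * k) * l ^ width s"
      using p by (rule mult_le_mono)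
    also have "\<dots> = l ^ (1 + E * width s * k + width s)" by (simp add: power_add)
    also have "\<dots> \<le> l ^ (2 * k * E * width s)"
    proof (rule power_increasing)
      have "2 * 1 * width s \<le> k * E * width s" using k assms(2) by (intro mult_le_mono) auto
      moreover have "1 \<le> width s" by (simp add: Suc_leI)
      ultimately show "1 + E * width s * k + width s \<le> 2 * k * E * width s" by (simp add: algebra_simps)
    qed (use l in simp)
    finally show ?thesis using modulus_le[OF gip_bound_ge_2, of s j] by simp
  qed
  then have "(\<Prod>j<fanout s. modulus (gip_bound s) j) \<le> (\<Prod>j<fanout s. l ^ (2 * k * E * width s))" by (intro prod_mono) auto
  then show ?thesis unfolding entry_bound_Suc modprod_eq_prod
    by (simp add: power_mult[symmetric] ac_simps)
qed

text \<open>Before the cut-off the next width is an exact multiple of the current one, so the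
  exponent per bit grows by the factor \<open>2 * k\<close> alone.\<close>

lemma entry_bound_le_tower: "tower s \<le> b \<Longrightarrow> entry_bound s \<le> l ^ ((2 * k) ^ s * width s)"
proof (induction s)
  case 0
  then show ?case using l by (simp add: width_0)
next
  case (Suc s)
  have le: "tower s \<le> b" using Suc.prems tower_less_Suc[of s] by linarith
  have eq: "width s = tower s" "width (Suc s) = tower (Suc s)" using le Suc.prems by (auto simp: width_def)
  obtain c where c: "tower (Suc s) = tower s * c" using tower_dvd_Suc by (auto elim: dvdE)
  have "fanout s * tower s < tower s * (c + 1)" using fanout_width(2)[of s] eq c by simp
  then have "fanout s \<le> c" by (metis Suc_eq_plus1 less_Suc_eq_le mult.commute nat_mult_less_cancel1 tower_pos)
  then have "fanout s * width s \<le> width (Suc s)" using eq c by simp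
  then have "2 * k * (2 * k) ^ s * (fanout s * width s) \<le> (2 * k) ^ Suc s * width (Suc s)" by simp
  then show ?case
    using entry_bound_Suc_le[OF Suc.IH[OF le]] k l 
      power_increasing[of "2 * k * (2 * k) ^ s * (fanout s * width s)" "(2 * k) ^ Suc s * width (Suc s)" l]
    by (simp add: le_trans Suc_leI)
qed

text \<open>The last level may round up: \<open>fanout s * width s\<close> is below the sum of two
  widths, hence at most \<open>2 * b\<close>. This is the leading factor 2.\<close>

lemma entry_bound_depth_le: "entry_bound depth \<le> l ^ (2 * (2 * k) ^ depth * b)"
proof -
  obtain s where s: "depth = Suc s" using depth_ge_2 by (cases depth) auto
  have "entry_bound (Suc s) \<le> l ^ (2 * k * (2 * k) ^ s * (fanout s * width s))"
    using depth(2)[of s] s k by (intro entry_bound_Suc_le entry_bound_le_tower) (auto simp: Suc_leI)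
  also have "\<dots> \<le> l ^ (2 * (2 * k) ^ depth * b)"
  proof (rule power_increasing)
    have "fanout s * width s \<le> 2 * b" using fanout_width(2)[of s] width_le[of s] width_le[of "Suc s"] by linarith
    then have "(2 * k) ^ Suc s * (fanout s * width s) \<le> (2 * k) ^ Suc s * (2 * b)" by (rule mult_left_mono) simp
    then show "2 * k * (2 * k) ^ s * (fanout s * width s) \<le> 2 * (2 * k) ^ depth * b" using s by (simp add: ac_simps)
  qed (use l in simp)
  finally show ?thesis using s by simp
qed

text \<open>From n = 2 on, \<open>2 * 2 ^ n \<le> 3 ^ n\<close>, so the change from base
  \<open>2 * k\<close> to \<open>3 * k\<close> pays for the factor 2.\<close>

lemma exponent_le: "2 * (2 * k) ^ depth * b \<le> (3 * k) ^ log_star (real b) * b"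
proof -
  have "2 * 2 ^ n \<le> (3::nat) ^ n" if "n \<ge> 2" for n using that by (induction n rule: dec_induct) auto
  then have "2 * 2 ^ depth * k ^ depth \<le> 3 ^ depth * k ^ depth" using depth_ge_2 by (intro mult_right_mono) auto
  then have "2 * (2 * k) ^ depth \<le> (3 * k) ^ depth" by (simp add: power_mult_distrib)
  also have "\<dots> \<le> (3 * k) ^ log_star (real b)" using depth_le k by (intro power_increasing) auto
  finally show ?thesis by simp
qed

lemma entry_bound_depth_le': "entry_bound depth \<le> l ^ ((3 * k) ^ log_star (real b) * b)"
  using entry_bound_depth_le power_increasing[OF exponent_le, of l] l by linarith

text \<open>Bounds the number of values scanned when \<open>V\<close> is listed; its factor
  \<open>2 * k\<close> becomes the constant \<open>c'\<close> of the theorem.\<close>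

lemma gip_bound_depth_le: "gip_bound depth \<le> l ^ (2 * k * ((3 * k) ^ log_star (real b) * b))"
proof -
  let ?e = "(3 * k) ^ log_star (real b) * b"
  have "gip_bound depth \<le> l * (l ^ ?e) ^ k" unfolding gip_bound_def using entry_bound_depth_le' by (intro mult_left_mono power_mono) auto
  also have "\<dots> = l ^ (1 + ?e * k)" by (simp add: power_mult)
  also have "\<dots> \<le> l ^ (2 * k * ?e)"
  proof (rule power_increasing)
    have "1 * 1 \<le> ?e * k" using k b by (intro mult_le_mono) (auto simp: Suc_leI)
    then show "1 + ?e * k \<le> 2 * k * ?e" by (simp add: algebra_simps)
  qed (use l in simp)
  finally show ?thesis .
qed

text \<open>Since \<open>2 ^ depth < 2 * b\<close> \<le> \<open>b ^ 2\<close> and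
  \<open>2 * k \<le> 2 ^ (2 * k)\<close>, the power \<open>(2 * k) ^ depth\<close> is at most
  \<open>b ^ (4 * k)\<close>. The result fixes the word length of the machine and is a number that a
  program can compute directly from \<open>b\<close> and \<open>l\<close>.\<close>

lemma gip_bound_depth_le_poly:
  assumes "b \<ge> 4 * k"
  shows "gip_bound depth \<le> l ^ (b ^ (4 * k + 2))"
proof -
  have "k \<le> 2 ^ k" using less_exp[of k] by simp
  then have "(2 * k) \<le> 2 ^ (2 * k)" using less_exp[of "2 * k"] by simp
  then have "(2 * k) ^ depth \<le> (2 ^ (2 * k)) ^ depth" by (rule power_mono) simp
  also have "\<dots> = (2 ^ depth) ^ (2 * k)" by (simp add: power_mult[symmetric] mult.commute)
  also have "\<dots> \<le> (b ^ 2) ^ (2 * k)"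
  proof (rule power_mono)
    have "2 * b \<le> b * b" using b by (intro mult_le_mono1) linarith
    then have "2 ^ depth \<le> b * b" using power_depth by linarith
    then show "2 ^ depth \<le> b ^ 2" by (simp add: power2_eq_square)
  qed simp
  also have "\<dots> = b ^ (4 * k)" by (simp add: power_mult[symmetric])
  finally have e: "2 * (2 * k) ^ depth * b \<le> 2 * b ^ (4 * k) * b" by simp
  have "gip_bound depth \<le> l * (l ^ (2 * (2 * k) ^ depth * b)) ^ k"
    unfolding gip_bound_def using entry_bound_depth_le by (intro mult_left_mono power_mono) auto
  also have "\<dots> = l ^ (1 + 2 * (2 * k) ^ depth * b * k)" by (simp add: power_mult)
  also have "\<dots> \<le> l ^ (b ^ (4 * k + 2))"
  proof (rule power_increasing)
    have "1 + 2 * (2 * k) ^ depth * b * k \<le> 1 + 2 * b ^ (4 * k) * b * k" using e by simp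
    also have "\<dots> \<le> b ^ (4 * k) * b * (4 * k)"
    proof -
      have "1 \<le> b ^ (4 * k) * b * k" using b k by simp
      then show ?thesis by simp
    qed
    also have "\<dots> \<le> b ^ (4 * k) * b * b" using assms by (intro mult_left_mono) auto
    also have "\<dots> = b ^ (4 * k + 2)" by (simp add: power_add power2_eq_square)
    finally show "1 + 2 * (2 * k) ^ depth * b * k \<le> b ^ (4 * k + 2)" .
  qed (use l in simp)
  finally show ?thesis .
qed

section \<open>Correctness of the encoding\<close>

lemma encode_Suc_cong: "j < fanout s \<Longrightarrow>
    [encode x (Suc s) g = (if g * fanout s + j < b then encode x s (g * fanout s + j) else 0)] (mod modulus (gip_bound s) j)"
  using crt(2)[OF gip_bound_bound, of j s "\<lambda>j. if g * fanout s + j < b then encode x s (g * fanout s + j) else 0"] by simp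

lemma encode_less: "(\<And>g. x g \<le> 1) \<Longrightarrow> encode x s g < entry_bound s"
  by (cases s) (auto simp: entry_bound_Suc crt(1)[OF gip_bound_bound] less_Suc_eq_le numeral_2_eq_2)

lemma encode_zero: "b \<le> g * width s \<Longrightarrow> encode x s g = 0"
proof (induction s arbitrary: g)
  case 0
  then show ?case by (simp add: width_0)
next
  case (Suc s)
  have "(if g * fanout s + j < b then encode x s (g * fanout s + j) else 0) = 0" if "j < fanout s" for j
  proof -
    have "b \<le> g * (fanout s * width s)"
      using Suc.prems fanout_width(1)[of s] by (meson le_trans mult_le_mono2)
    also have "\<dots> \<le> (g * fanout s + j) * width s" by (simp add: algebra_simps)
    finally show ?thesis using Suc.IH by simp
  qed
  then have "encode x (Suc s) g = crt (gip_bound s) (fanout s) (\<lambda>j. 0)" unfolding encode.simps by (intro crt_cong) auto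
  then show ?case using crt_0[OF gip_bound_bound] by simp
qed

text \<open>\<open>x t i\<close> is block i of vector t. On bits, the value at level 0 counts the
  blocks whose bit g is 1 in all \<open>k\<close> vectors.\<close>

definition level_gip :: "(nat \<Rightarrow> nat \<Rightarrow> nat \<Rightarrow> nat) \<Rightarrow> nat \<Rightarrow> nat \<Rightarrow> nat" where
  "level_gip x s g = (\<Sum>i<l. \<Prod>t<k. encode (x t i) s g)"

lemma level_gip_less: assumes "\<And>t i g. t < k \<Longrightarrow> x t i g \<le> 1" shows "level_gip x s g < gip_bound s"
proof -
  have "level_gip x s g \<le> (\<Sum>i<l. (entry_bound s - 1) ^ k)" unfolding level_gip_def
  proof (rule sum_mono)
    fix i
    have "encode (x t i) s g \<le> entry_bound s - 1" if "t < k" for t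
      using encode_less[of "x t i" s g] assms that by fastforce
    then have "(\<Prod>t<k. encode (x t i) s g) \<le> (\<Prod>t<k. entry_bound s - 1)" by (intro prod_mono) auto
    then show "(\<Prod>t<k. encode (x t i) s g) \<le> (entry_bound s - 1) ^ k" by simp
  qed
  also have "\<dots> = l * (entry_bound s - 1) ^ k" by simp
  also have "\<dots> < l * entry_bound s ^ k" using l k entry_bound_ge_2[of s] by (intro mult_strict_left_mono power_strict_mono) auto
  finally show ?thesis by (simp add: gip_bound_def)
qed

lemma zero_in_accepted: "0 \<in> accepted s"
  by (induction s) (use gip_bound_ge_2 in \<open>auto intro: less_le_trans[of 0 2]\<close>)

lemma accepted_less: "v \<in> accepted s \<Longrightarrow> v < gip_bound s"
  using gip_bound_ge_2[of 0] by (cases s) auto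

text \<open>Residues commute with sums and products, and the inner product one level down is below
  \<open>gip_bound s\<close>, hence below the modulus: it is its own residue.\<close>

lemma level_gip_Suc_mod:
  assumes "\<And>t i g. t < k \<Longrightarrow> x t i g \<le> 1" "j < fanout s"
  shows "level_gip x (Suc s) g mod modulus (gip_bound s) j = (if g * fanout s + j < b then level_gip x s (g * fanout s + j) else 0)"
proof -
  let ?h = "g * fanout s + j"
  have "[level_gip x (Suc s) g = (\<Sum>i<l. \<Prod>t<k. if ?h < b then encode (x t i) s ?h else 0)] (mod modulus (gip_bound s) j)"
    unfolding level_gip_def by (intro cong_sum cong_prod encode_Suc_cong assms(2))
  also have "(\<Sum>i<l. \<Prod>t<k. if ?h < b then encode (x t i) s ?h else 0) = (if ?h < b then level_gip x s ?h else 0)"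
    \<comment> \<open>For the padding this uses that a product of \<open>k > 0\<close> zeros
      vanishes.\<close>
    using k by (auto simp: level_gip_def power_0_left)
  finally have "[level_gip x (Suc s) g = (if ?h < b then level_gip x s ?h else 0)] (mod modulus (gip_bound s) j)" .
  moreover have "(if ?h < b then level_gip x s ?h else 0) < modulus (gip_bound s) j"
    using level_gip_less[of x s ?h, OF assms(1)] modulus_ge[of "gip_bound s" j] modulus_pos[of "gip_bound s" j] by auto
  ultimately show ?thesis by (simp add: cong_def)
qed

text \<open>Division with remainder by the fanout splits each lower index into a group and a place
  in it; places at or beyond \<open>b\<close> give 0, which is always accepted. Quantifying over all
  positions makes the equivalence usable for induction on the level.\<close>

lemma level_gip_accepted_Suc:
  assumes "\<And>t i g. t < k \<Longrightarrow> x t i g \<le> 1"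
  shows "(\<forall>g<b. level_gip x (Suc s) g \<in> accepted (Suc s)) \<longleftrightarrow> (\<forall>g<b. level_gip x s g \<in> accepted s)"
proof
  assume *: "\<forall>g<b. level_gip x (Suc s) g \<in> accepted (Suc s)"
  show "\<forall>g<b. level_gip x s g \<in> accepted s"
  proof (intro allI impI)
    fix h assume h: "h < b"
    have hd: "h div fanout s * fanout s + h mod fanout s = h" by (rule div_mult_mod_eq)
    have "h div fanout s < b" using h by (meson div_le_dividend le_less_trans)
    then have "level_gip x (Suc s) (h div fanout s) mod modulus (gip_bound s) (h mod fanout s) \<in> accepted s"
      using * by simp
    then show "level_gip x s h \<in> accepted s" using level_gip_Suc_mod[of x "h mod fanout s" s "h div fanout s"] assms h hd by simp
  qed
next
  assume *: "\<forall>g<b. level_gip x s g \<in> accepted s"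
  show "\<forall>g<b. level_gip x (Suc s) g \<in> accepted (Suc s)"
    using * level_gip_less[of x, OF assms] level_gip_Suc_mod[of x, OF assms] zero_in_accepted by (simp add: accepted.simps)
qed

lemma level_gip_depth:
  assumes "\<And>t i g. t < k \<Longrightarrow> x t i g \<le> 1"
  shows "level_gip x depth 0 \<in> accepted depth \<longleftrightarrow> (\<forall>i<l. \<forall>g<b. \<exists>t<k. x t i g = 0)"
proof -
  \<comment> \<open>At the top the width is \<open>b\<close>, so position 0 holds the whole block
    and the other positions hold padding only.\<close>
  have "level_gip x depth g \<in> accepted depth" if "g > 0" for g
  proof -
    have "encode (x t i) depth g = 0" for t i using that by (intro encode_zero) (simp add: width_depth Suc_leI)
    then have "level_gip x depth g = 0" using k by (simp add: level_gip_def power_0_left)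
    then show ?thesis by (simp add: zero_in_accepted)
  qed
  moreover have "b > 0" using b by simp
  ultimately have "level_gip x depth 0 \<in> accepted depth \<longleftrightarrow> (\<forall>g<b. level_gip x depth g \<in> accepted depth)" by (metis gr0I)
  also have "\<dots> \<longleftrightarrow> (\<forall>g<b. level_gip x 0 g = 0)"
  proof -
    have "(\<forall>g<b. level_gip x s g \<in> accepted s) \<longleftrightarrow> (\<forall>g<b. level_gip x 0 g \<in> accepted 0)" for s
      by (induction s) (use level_gip_accepted_Suc[of x, OF assms] in \<open>simp_all del: accepted.simps\<close>)
    then show ?thesis by simp
  qed
  also have "\<dots> \<longleftrightarrow> (\<forall>i<l. \<forall>g<b. \<exists>t<k. x t i g = 0)"
    unfolding level_gip_def by (auto simp: sum_eq_0_iff)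
  finally show ?thesis .
qed

definition block_bits :: "int list \<Rightarrow> nat \<Rightarrow> nat \<Rightarrow> nat" where
  "block_bits x i g = (if i < l \<and> g < b then nat (x ! (i * b + g)) else 0)"

definition psi :: "int list \<Rightarrow> int list" where
  "psi x = map (\<lambda>i. int (encode (block_bits x i) depth 0)) [0..<l]"

lemma index_less: "i < l \<Longrightarrow> g < b \<Longrightarrow> i * b + g < b * l"
proof -
  assume "i < l" "g < b"
  then have "i * b + g < Suc i * b" by simp
  also have "\<dots> \<le> l * b" using \<open>i < l\<close> by (intro mult_le_mono1) simp
  finally show ?thesis by (simp add: mult.commute)
qed

lemma cube_nth: assumes "x \<in> cube n" "s < n" shows "x ! s \<in> {0, 1}"
proof -
  have "x ! s \<in> set x" using assms by (auto simp: cube_def)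
  also have "set x \<subseteq> {0, 1}" using assms by (simp add: cube_def)
  finally show ?thesis .
qed

lemma block_bits_le: assumes "x \<in> cube (b * l)" shows "block_bits x i g \<le> 1"
  using cube_nth[OF assms index_less, of i g] by (auto simp: block_bits_def)

lemma psi_bounds:
  assumes "x \<in> cube (b * l)" "i < l"
  shows "0 \<le> psi x ! i" "psi x ! i < int l ^ ((3 * k) ^ log_star (real b) * b)"
proof -
  have eq: "psi x ! i = int (encode (block_bits x i) depth 0)" using assms by (simp add: psi_def)
  then show "0 \<le> psi x ! i" by simp
  have "encode (block_bits x i) depth 0 < entry_bound depth" using block_bits_le[OF assms(1)] by (intro encode_less) simp
  then have "encode (block_bits x i) depth 0 < l ^ ((3 * k) ^ log_star (real b) * b)" using entry_bound_depth_le' by linarith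
  then show "psi x ! i < int l ^ ((3 * k) ^ log_star (real b) * b)" 
    unfolding eq by (metis of_nat_less_iff of_nat_power)
qed

lemma psi_correct:
  assumes x: "\<And>t. t < k \<Longrightarrow> x t \<in> cube (b * l)"
  shows "gip k (b * l) x = 0 \<longleftrightarrow> gip k l (\<lambda>t. psi (x t)) \<in> int ` accepted depth"
proof -
  have nn: "(\<Prod>t<k. x t ! s) \<ge> 0" if "s < b * l" for s
    using cube_nth[OF x that] by (intro prod_nonneg) fastforce
  have "gip k (b * l) x = 0 \<longleftrightarrow> (\<forall>s<b * l. (\<Prod>t<k. x t ! s) = 0)"
    unfolding gip_def by (subst sum_nonneg_eq_0_iff) (use nn in auto)
  also have "\<dots> \<longleftrightarrow> (\<forall>s<b * l. \<exists>t<k. x t ! s = 0)" by auto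
  also have "\<dots> \<longleftrightarrow> (\<forall>i<l. \<forall>g<b. \<exists>t<k. block_bits (x t) i g = 0)"
  proof (intro iffI allI impI)
    fix i g assume *: "\<forall>s<b * l. \<exists>t<k. x t ! s = 0" "i < l" "g < b"
    then show "\<exists>t<k. block_bits (x t) i g = 0" using index_less[of i g] by (force simp: block_bits_def)
  next
    fix s assume *: "\<forall>i<l. \<forall>g<b. \<exists>t<k. block_bits (x t) i g = 0" "s < b * l"
    have 1: "s div b < l" "s mod b < b" using *(2) b 
      by (auto simp: less_mult_imp_div_less mult.commute)
    then obtain t where t: "t < k" "block_bits (x t) (s div b) (s mod b) = 0" using *(1) by blast
    then have "nat (x t ! s) = 0" using 1 by (simp add: block_bits_def)
    then show "\<exists>t<k. x t ! s = 0" using t cube_nth[OF x *(2)] by fastforce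
  qed
  also have "\<dots> \<longleftrightarrow> level_gip (\<lambda>t. block_bits (x t)) depth 0 \<in> accepted depth"
    by (subst level_gip_depth) (use block_bits_le[OF x] in auto)
  also have "\<dots> \<longleftrightarrow> gip k l (\<lambda>t. psi (x t)) \<in> int ` accepted depth"
  proof -
    have "gip k l (\<lambda>t. psi (x t)) = int (level_gip (\<lambda>t. block_bits (x t)) depth 0)"
      by (simp add: gip_def psi_def level_gip_def)
    then show ?thesis by auto
  qed
  finally show ?thesis .
qed

end

section \<open>Step counting on the machine\<close>

definition bounded_mem :: "nat \<Rightarrow> mem \<Rightarrow> bool" where
  "bounded_mem W s \<longleftrightarrow> (\<forall>a. \<bar>s a\<bar> \<le> 2 ^ W)"

text \<open>A static exponent: over cells of size at most \<open>2 ^ W\<close> the value of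
  \<open>e\<close> is at most \<open>2 ^ (W * aexp_weight e)\<close>. A constant n gets 1 + |n|
  because |n| \<le> 2^|n|, and the 1 at a binary node leaves room for a sum.\<close>

primrec aexp_weight :: "aexp \<Rightarrow> nat" where
  "aexp_weight (Num n) = 1 + nat \<bar>n\<bar>"
| "aexp_weight (Mem e) = aexp_weight e + 1"
| "aexp_weight (Add e f) = aexp_weight e + aexp_weight f + 1"
| "aexp_weight (Sub e f) = aexp_weight e + aexp_weight f + 1"
| "aexp_weight (Mul e f) = aexp_weight e + aexp_weight f + 1"
| "aexp_weight (Div e f) = aexp_weight e + aexp_weight f + 1"
| "aexp_weight (Mod e f) = aexp_weight e + aexp_weight f + 1"

lemma abs_div_le: "\<bar>a div b\<bar> \<le> \<bar>a :: int\<bar>"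
proof (cases "b = 0")
  case False
  have pos: "\<bar>a div b\<bar> \<le> \<bar>a\<bar>" if "b > 0" for a b :: int
  proof (cases "a \<ge> 0")
    case True
    then show ?thesis using that zdiv_mono2[of a 1 b] by (simp add: pos_imp_zdiv_nonneg_iff)
  next
    case False
    have "a * b \<le> a * 1" using False that by (intro mult_left_mono_neg) auto
    then have "a * b div b \<le> a div b" using that by (intro zdiv_mono1) auto
    then have "a \<le> a div b" using that by simp
    moreover have "a div b < 0" using False that by (simp add: neg_imp_zdiv_neg_iff pos_imp_zdiv_neg_iff)
    ultimately show ?thesis by simp
  qed
  show ?thesis using pos[of b a] pos[of "-b" "-a"] False by (cases "b > 0") auto
qed simp

lemma abs_mod_le: "\<bar>a mod b\<bar> \<le> max \<bar>a\<bar> \<bar>b :: int\<bar>"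
  by (cases "b = 0") (use abs_mod_less[of b a] in auto)

lemma power_sum_le:
  assumes "W \<ge> 1" "\<bar>x\<bar> \<le> 2 ^ (W * m)" "\<bar>y\<bar> \<le> (2 :: int) ^ (W * n)"
  shows "\<bar>x\<bar> + \<bar>y\<bar> \<le> 2 ^ (W * (m + n + 1))" "\<bar>x\<bar> * \<bar>y\<bar> \<le> 2 ^ (W * (m + n + 1))"
    "max \<bar>x\<bar> \<bar>y\<bar> \<le> 2 ^ (W * (m + n + 1))"
proof -
  have "(2::int) ^ (W * (m + n + 1)) = 2 ^ W * (2 ^ (W * m) * 2 ^ (W * n))"
    by (simp add: power_add[symmetric] algebra_simps)
  moreover have "2 ^ 1 \<le> (2::int) ^ W" using assms(1) by (intro power_increasing) auto
  ultimately have 1: "(2::int) ^ (W * (m + n + 1)) \<ge> 2 * (2 ^ (W * m) * 2 ^ (W * n))"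
    by (simp add: mult_right_mono)
  define u v where "u = (2::int) ^ (W * m)" and "v = (2::int) ^ (W * n)"
  have uv: "u \<ge> 1" "v \<ge> 1" by (auto simp: u_def v_def)
  then have "u * v \<ge> u" "u * v \<ge> v" by (auto simp: mult_le_cancel_left1 mult_le_cancel_right1)
  then have 2: "u \<le> u * v" "v \<le> u * v" .
  show "\<bar>x\<bar> + \<bar>y\<bar> \<le> 2 ^ (W * (m + n + 1))" "max \<bar>x\<bar> \<bar>y\<bar> \<le> 2 ^ (W * (m + n + 1))"
    using 1 2 assms(2,3) uv unfolding u_def[symmetric] v_def[symmetric] by linarith+
  have "\<bar>x\<bar> * \<bar>y\<bar> \<le> u * v" using assms(2,3) by (intro mult_mono) (auto simp: u_def v_def)
  then show "\<bar>x\<bar> * \<bar>y\<bar> \<le> 2 ^ (W * (m + n + 1))"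
    using 1 2 uv unfolding u_def[symmetric] v_def[symmetric] by linarith
qed

lemma abs_val_le:
  assumes "bounded_mem W s" "W \<ge> 1"
  shows "\<bar>val e s\<bar> \<le> 2 ^ (W * aexp_weight e)"
proof (induction e)
  case (Num n)
  have "nat \<bar>n\<bar> < 2 ^ nat \<bar>n\<bar>" by (rule less_exp)
  then have "\<bar>n\<bar> \<le> 2 ^ nat \<bar>n\<bar>" by (metis abs_ge_zero int_nat_eq less_imp_le of_nat_le_iff of_nat_numeral of_nat_power)
  also have "\<dots> \<le> 2 ^ (W * aexp_weight (Num n))"
  proof (rule power_increasing)
    have "1 * nat \<bar>n\<bar> \<le> W * aexp_weight (Num n)" using assms(2) by (intro mult_le_mono) auto
    then show "nat \<bar>n\<bar> \<le> W * aexp_weight (Num n)" by simp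
  qed simp
  finally show ?case by simp
next
  case (Mem e)
  have "\<bar>val (Mem e) s\<bar> \<le> 2 ^ W" using assms(1) by (simp add: bounded_mem_def)
  also have "(2::int) ^ W \<le> 2 ^ (W * aexp_weight (Mem e))" by (intro power_increasing) auto
  finally show ?case .
next
  case (Add e f)
  show ?case using power_sum_le(1)[OF assms(2) Add] by (auto intro: order_trans[OF abs_triangle_ineq])
next
  case (Sub e f)
  show ?case using power_sum_le(1)[OF assms(2) Sub] by (auto intro: order_trans[OF abs_triangle_ineq4])
next
  case (Mul e f)
  show ?case using power_sum_le(2)[OF assms(2) Mul] by (simp add: abs_mult)
next
  case (Div e f)
  show ?case using power_sum_le(3)[OF assms(2) Div] abs_div_le[of "val e s" "val f s"] by simp
next
  case (Mod e f)
  show ?case using power_sum_le(3)[OF assms(2) Mod] abs_mod_le[of "val e s" "val f s"] by (simp only: val.simps aexp_weight.simps)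
qed

lemma size_cost_le: "\<bar>v\<bar> \<le> 2 ^ m \<Longrightarrow> size_cost v \<le> m + 2"
proof -
  assume "\<bar>v\<bar> \<le> 2 ^ m"
  moreover have "(2::int) ^ m < 2 ^ (m + 1)" by simp
  ultimately have "\<bar>v\<bar> < 2 ^ (m + 1)" by linarith
  then have "int (nat \<bar>v\<bar>) < int (2 ^ (m + 1))" by simp
  then have "floorlog 2 (nat \<bar>v\<bar>) \<le> m + 1" by (intro floorlog_leI) linarith+
  then show ?thesis by (simp add: size_cost_def)
qed

lemma aexp_weight_pos: "aexp_weight e \<ge> 1" by (cases e) auto

text \<open>Each node is charged at most \<open>3 * W\<close> times its own weight, and the weight
  also bounds the number of nodes; hence the square.\<close>

lemma cost_le:
  assumes "bounded_mem W s" "W \<ge> 1"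
  shows "cost e s \<le> 3 * W * aexp_weight e ^ 2"
proof -
  have sc: "size_cost (val e s) \<le> 3 * W * aexp_weight e" for e
  proof -
    have "size_cost (val e s) \<le> W * aexp_weight e + 2" by (rule size_cost_le[OF abs_val_le[OF assms]])
    moreover have "1 * 1 \<le> W * aexp_weight e" using assms(2) aexp_weight_pos by (intro mult_le_mono)
    then have "2 \<le> 2 * (W * aexp_weight e)" by simp
    ultimately have "size_cost (val e s) \<le> W * aexp_weight e + 2 * (W * aexp_weight e)" by linarith
    then show ?thesis by simp
  qed
  have bin: "c \<le> 3 * W * m ^ 2 \<Longrightarrow> d \<le> 3 * W * n ^ 2 \<Longrightarrow> e \<le> 3 * W * (m + n + 1) \<Longrightarrow>
      c + d + e \<le> 3 * W * (m + n + 1) ^ 2" for c d e m n :: nat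
  proof -
    assume "c \<le> 3 * W * m ^ 2" "d \<le> 3 * W * n ^ 2" "e \<le> 3 * W * (m + n + 1)"
    then have "c + d + e \<le> 3 * W * (m ^ 2 + n ^ 2 + (m + n + 1))" by (simp add: algebra_simps)
    also have "\<dots> \<le> 3 * W * (m + n + 1) ^ 2" by (intro mult_left_mono) (auto simp: power2_eq_square algebra_simps)
    finally show ?thesis .
  qed
  show ?thesis
  proof (induction e)
    case (Num n)
    have "size_cost n \<le> 3 * W * aexp_weight (Num n)" using sc[of "Num n"] by simp
    also have "\<dots> \<le> 3 * W * aexp_weight (Num n) ^ 2" by (intro mult_left_mono) (auto simp: power2_eq_square)
    finally show ?case by simp
  next
    case (Mem e)
    \<comment> \<open>A unary node is treated as a binary one whose second operand has weight and
      cost 0.\<close>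
    then show ?case using bin[of "cost e s" "aexp_weight e" 0 0 "size_cost (val (Mem e) s)"] sc[of "Mem e"] by simp
  next
    case (Add e f)
    then show ?case using bin sc[of "Add e f"] by simp
  next
    case (Sub e f)
    then show ?case using bin sc[of "Sub e f"] by simp
  next
    case (Mul e f)
    then show ?case using bin sc[of "Mul e f"] by simp
  next
    case (Div e f)
    then show ?case using bin sc[of "Div e f"] by simp
  next
    case (Mod e f)
    then show ?case using bin sc[of "Mod e f"] by simp
  qed
qed

primrec com_weight :: "com \<Rightarrow> nat" where
  "com_weight Skip = 1"
| "com_weight (Store e f) = 1 + 3 * aexp_weight e ^ 2 + 3 * aexp_weight f ^ 2"
| "com_weight (Seq c d) = com_weight c + com_weight d"
| "com_weight (Cond e c d) = 1 + 3 * aexp_weight e ^ 2 + com_weight c + com_weight d"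
| "com_weight (While e c) = 1 + 3 * aexp_weight e ^ 2 + com_weight c"

text \<open>
  Execution that counts steps and requires all cells to stay within \<open>2 ^ W\<close>, so that a step costs \<open>O(W)\<close>
  with a constant depending on the program only.
\<close>
inductive sexec :: "nat \<Rightarrow> com \<Rightarrow> mem \<Rightarrow> nat \<Rightarrow> mem \<Rightarrow> bool" for W where
  Skip: "sexec W Skip s 1 s"
| Store: "bounded_mem W s \<Longrightarrow> sexec W (Store e f) s 1 (s(nat (val e s) := val f s))"
| Seq: "sexec W c s m s' \<Longrightarrow> sexec W d s' n s'' \<Longrightarrow> sexec W (Seq c d) s (m + n) s''"
| CondT: "bounded_mem W s \<Longrightarrow> val e s > 0 \<Longrightarrow> sexec W c s m s' \<Longrightarrow> sexec W (Cond e c d) s (1 + m) s'"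
| CondF: "bounded_mem W s \<Longrightarrow> val e s \<le> 0 \<Longrightarrow> sexec W d s m s' \<Longrightarrow> sexec W (Cond e c d) s (1 + m) s'"
| WhileF: "bounded_mem W s \<Longrightarrow> val e s \<le> 0 \<Longrightarrow> sexec W (While e c) s 1 s"
| WhileT: "bounded_mem W s \<Longrightarrow> val e s > 0 \<Longrightarrow> sexec W c s m s' \<Longrightarrow> sexec W (While e c) s' n s'' \<Longrightarrow>
    sexec W (While e c) s (1 + m + n) s''"

lemma sexec_exec:
  assumes "sexec W c s n s'" "W \<ge> 1"
  shows "\<exists>t \<le> n * (com_weight c * W). exec c s t s'"
  using assms
proof (induction rule: sexec.induct)
  case (Skip s)
  then show ?case using exec.Skip by fastforce
next
  case (Store s e f)
  have "1 + cost e s + cost f s \<le> com_weight (Store e f) * W"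
    using cost_le[OF Store.hyps Store.prems, of e] cost_le[OF Store.hyps Store.prems, of f] Store.prems
    by (simp add: algebra_simps)
  then show ?case using exec.Store[of e f s] by (metis mult_1)
next
  case (Seq c s m s' d n s'')
  then obtain t u where tu: "t \<le> m * (com_weight c * W)" "exec c s t s'" "u \<le> n * (com_weight d * W)" "exec d s' u s''" by blast
  have "t + u \<le> (m + n) * (com_weight (Seq c d) * W)" using tu by (simp add: algebra_simps)
  then show ?case using exec.Seq[OF tu(2,4)] by blast
next
  case (CondT s e c m s' d)
  then obtain t where t: "t \<le> m * (com_weight c * W)" "exec c s t s'" by blast
  have "1 + cost e s + t \<le> (1 + m) * (com_weight (Cond e c d) * W)"
    using cost_le[OF CondT.hyps(1) CondT.prems, of e] t CondT.prems by (simp add: algebra_simps)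
  then show ?case using exec.CondT[OF CondT.hyps(2) t(2)] by blast
next
  case (CondF s e d m s' c)
  then obtain t where t: "t \<le> m * (com_weight d * W)" "exec d s t s'" by blast
  have "1 + cost e s + t \<le> (1 + m) * (com_weight (Cond e c d) * W)"
    using cost_le[OF CondF.hyps(1) CondF.prems, of e] t CondF.prems by (simp add: algebra_simps)
  then show ?case using exec.CondF[OF CondF.hyps(2) t(2)] by blast
next
  case (WhileF s e c)
  have "1 + cost e s \<le> 1 * (com_weight (While e c) * W)"
    using cost_le[OF WhileF.hyps(1) WhileF.prems, of e] WhileF.prems by (simp add: algebra_simps)
  then show ?case using exec.WhileF[OF WhileF.hyps(2)] by blast
next
  case (WhileT s e c m s' n s'')
  then obtain t u where tu: "t \<le> m * (com_weight c * W)" "exec c s t s'"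
    "u \<le> n * (com_weight (While e c) * W)" "exec (While e c) s' u s''" by blast
  have "1 + cost e s + t \<le> (1 + m) * (com_weight (While e c) * W)"
    using cost_le[OF WhileT.hyps(1) WhileT.prems, of e] tu(1) WhileT.prems by (simp add: algebra_simps)
  then have "1 + cost e s + t + u \<le> (1 + m + n) * (com_weight (While e c) * W)"
    using tu(3) by (simp only: add_mult_distrib)
  then show ?case using exec.WhileT[OF WhileT.hyps(2) tu(2,4)] by blast
qed

section \<open>Memory layout and a step-counting program logic\<close>

text \<open>
  Register \<open>c < 30\<close> lives in cell \<open>n + 1 + c\<close>, where \<open>n\<close> is the content of cell \<open>0\<close>. This leaves the
  cells \<open>1..n\<close> to the input and the output.
\<close>
definition layout :: "nat \<Rightarrow> (nat \<Rightarrow> int) \<Rightarrow> mem \<Rightarrow> mem" where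
  "layout n r h = (\<lambda>a. if n < a \<and> a \<le> n + 30 then r (a - n - 1) else h a)"

definition ok :: "nat \<Rightarrow> nat \<Rightarrow> (nat \<Rightarrow> int) \<Rightarrow> mem \<Rightarrow> bool" where
  "ok W n r h \<longleftrightarrow> h 0 = int n \<and> (\<forall>c. \<bar>r c\<bar> \<le> 2 ^ W) \<and> (\<forall>a. \<bar>h a\<bar> \<le> 2 ^ W)"

definition regaddr :: "nat \<Rightarrow> aexp" where "regaddr c = Add (Mem (Num 0)) (Num (int c + 1))"

definition reg :: "nat \<Rightarrow> aexp" where "reg c = Mem (regaddr c)"

abbreviation setr :: "nat \<Rightarrow> aexp \<Rightarrow> com" where "setr c e \<equiv> Store (regaddr c) e"

lemma layout_out: "a \<le> n \<or> a > n + 30 \<Longrightarrow> layout n r h a = h a"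
  by (auto simp: layout_def)

lemma ok_bounded_mem: "ok W n r h \<Longrightarrow> bounded_mem W (layout n r h)"
  by (auto simp: ok_def bounded_mem_def layout_def)

lemma val_regaddr: "ok W n r h \<Longrightarrow> val (regaddr c) (layout n r h) = int (n + c + 1)"
  by (simp add: regaddr_def layout_out ok_def)

lemma val_reg: "ok W n r h \<Longrightarrow> c < 30 \<Longrightarrow> val (reg c) (layout n r h) = r c"
  using val_regaddr[of W n r h c] by (simp add: reg_def nat_add_distrib) (simp add: layout_def)

lemma val_Mem: "val e (layout n r h) = int a \<Longrightarrow> a \<le> n \<or> a > n + 30 \<Longrightarrow> val (Mem e) (layout n r h) = h a"
  by (simp add: layout_out)

lemma layout_upd_reg: "c < 30 \<Longrightarrow> (layout n r h)(n + c + 1 := v) = layout n (r(c := v)) h"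
  by (rule ext) (auto simp: layout_def)

lemma layout_upd_heap: "a \<le> n \<or> a > n + 30 \<Longrightarrow> (layout n r h)(a := v) = layout n r (h(a := v))"
  by (rule ext) (auto simp: layout_def)

lemma ok_upd: "ok W n r h \<Longrightarrow> \<bar>v\<bar> \<le> 2 ^ W \<Longrightarrow> ok W n (r(c := v)) h"
  by (auto simp: ok_def)

lemma ok_upd_heap: "ok W n r h \<Longrightarrow> \<bar>v\<bar> \<le> 2 ^ W \<Longrightarrow> a \<noteq> 0 \<Longrightarrow> ok W n r (h(a := v))"
  by (auto simp: ok_def)

text \<open>Total correctness with a step bound. Start and end share the same \<open>n\<close>, so a
  program that changes cell 0 leaves this logic and is treated with \<open>sexec\<close>
  directly.\<close>

definition wp :: "nat \<Rightarrow> nat \<Rightarrow> com \<Rightarrow> nat \<Rightarrow> (nat \<Rightarrow> int) \<Rightarrow> mem \<Rightarrow>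
    ((nat \<Rightarrow> int) \<Rightarrow> mem \<Rightarrow> bool) \<Rightarrow> bool" where
  "wp W n c N r h Q \<longleftrightarrow> (\<exists>m \<le> N. \<exists>r' h'. sexec W c (layout n r h) m (layout n r' h') \<and> ok W n r' h' \<and> Q r' h')"

lemma wp_mono: "wp W n c N r h Q \<Longrightarrow> N \<le> N' \<Longrightarrow> (\<And>r' h'. ok W n r' h' \<Longrightarrow> Q r' h' \<Longrightarrow> Q' r' h') \<Longrightarrow> wp W n c N' r h Q'"
  unfolding wp_def by (meson le_trans)

lemma wp_set:
  assumes "ok W n r h" "val e (layout n r h) = v" "c < 30" "\<bar>v\<bar> \<le> 2 ^ W" "Q (r(c := v)) h"
  shows "wp W n (setr c e) 1 r h Q"
proof -
  have "sexec W (setr c e) (layout n r h) 1 (layout n (r(c := v)) h)"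
    using sexec.Store[OF ok_bounded_mem[OF assms(1)], of "regaddr c" e] assms(2) layout_upd_reg[OF assms(3), of n r h v]
    by (simp add: val_regaddr[OF assms(1)] nat_add_distrib)
  then show ?thesis unfolding wp_def using assms ok_upd by blast
qed

lemma wp_store:
  assumes "ok W n r h" "val e (layout n r h) = int a" "a \<le> n \<or> a > n + 30" "a \<noteq> 0"
    "val f (layout n r h) = v" "\<bar>v\<bar> \<le> 2 ^ W" "Q r (h(a := v))"
  shows "wp W n (Store e f) 1 r h Q"
proof -
  have "sexec W (Store e f) (layout n r h) 1 (layout n r (h(a := v)))"
    using sexec.Store[OF ok_bounded_mem[OF assms(1)], of e f] assms(2,5) layout_upd_heap[OF assms(3), of r h v] by simp
  then show ?thesis unfolding wp_def using assms ok_upd_heap by blast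
qed

lemma abs_int_le: "x \<le> 2 ^ W \<Longrightarrow> \<bar>int x\<bar> \<le> 2 ^ W"
  by (metis abs_of_nat of_nat_le_iff of_nat_numeral of_nat_power)

lemma wp_skip: "ok W n r h \<Longrightarrow> Q r h \<Longrightarrow> wp W n Skip 1 r h Q"
  unfolding wp_def using sexec.Skip by blast

lemma wp_seq:
  assumes "wp W n c N r h R" "\<And>r' h'. ok W n r' h' \<Longrightarrow> R r' h' \<Longrightarrow> wp W n d M r' h' Q"
  shows "wp W n (Seq c d) (N + M) r h Q"
proof -
  obtain m r' h' where 1: "m \<le> N" "sexec W c (layout n r h) m (layout n r' h')" "ok W n r' h'" "R r' h'"
    using assms(1) by (auto simp: wp_def)
  obtain m' r'' h'' where 2: "m' \<le> M" "sexec W d (layout n r' h') m' (layout n r'' h'')" "ok W n r'' h''" "Q r'' h''"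
    using assms(2)[OF 1(3,4)] by (auto simp: wp_def)
  show ?thesis unfolding wp_def
    using sexec.Seq[OF 1(2) 2(2)] 1(1) 2 by (meson add_mono)
qed

lemma wp_set_seq:
  assumes "ok W n r h" "val e (layout n r h) = v" "c < 30" "\<bar>v\<bar> \<le> 2 ^ W"
    "ok W n (r(c := v)) h \<Longrightarrow> wp W n d M (r(c := v)) h Q"
  shows "wp W n (Seq (setr c e) d) (1 + M) r h Q"
proof (rule wp_seq)
  show "wp W n (setr c e) 1 r h (\<lambda>r' h'. r' = r(c := v) \<and> h' = h)"
    by (rule wp_set[OF assms(1-4)]) simp
qed (use assms(5) in auto)

lemma wp_store_seq:
  assumes "ok W n r h" "val e (layout n r h) = int a" "a \<le> n \<or> a > n + 30" "a \<noteq> 0"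
    "val f (layout n r h) = v" "\<bar>v\<bar> \<le> 2 ^ W"
    "ok W n r (h(a := v)) \<Longrightarrow> wp W n d M r (h(a := v)) Q"
  shows "wp W n (Seq (Store e f) d) (1 + M) r h Q"
proof (rule wp_seq)
  show "wp W n (Store e f) 1 r h (\<lambda>r' h'. r' = r \<and> h' = h(a := v))"
    by (rule wp_store[OF assms(1-6)]) simp
qed (use assms(7) in auto)

lemma wp_cond:
  assumes "ok W n r h" "val e (layout n r h) > 0 \<Longrightarrow> wp W n c N r h Q" "val e (layout n r h) \<le> 0 \<Longrightarrow> wp W n d N r h Q"
  shows "wp W n (Cond e c d) (1 + N) r h Q"
proof (cases "val e (layout n r h) > 0")
  case True
  then obtain m r' h' where "m \<le> N" "sexec W c (layout n r h) m (layout n r' h')" "ok W n r' h'" "Q r' h'"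
    using assms(2) by (auto simp: wp_def)
  then show ?thesis unfolding wp_def
    using sexec.CondT[OF ok_bounded_mem[OF assms(1)] True] by (meson add_left_mono)
next
  case False
  then obtain m r' h' where "m \<le> N" "sexec W d (layout n r h) m (layout n r' h')" "ok W n r' h'" "Q r' h'"
    using assms(3) by (auto simp: wp_def)
  then show ?thesis unfolding wp_def
    using sexec.CondF[OF ok_bounded_mem[OF assms(1)]] False by (meson add_left_mono not_less)
qed

text \<open>For loops whose number of rounds is known: the invariant is indexed by the round, each
  round pays 1 for its guard, and the final 1 is the failing guard.\<close>

lemma wp_for_aux:
  assumes step: "\<And>i r h. i < m \<Longrightarrow> ok W n r h \<Longrightarrow> I i r h \<Longrightarrow> val e (layout n r h) > 0 \<and> wp W n c N r h (I (Suc i))"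
    and stop: "\<And>r h. ok W n r h \<Longrightarrow> I m r h \<Longrightarrow> val e (layout n r h) \<le> 0"
  shows "i \<le> m \<Longrightarrow> ok W n r h \<Longrightarrow> I i r h \<Longrightarrow> wp W n (While e c) ((m - i) * (N + 1) + 1) r h (I m)"
proof (induction "m - i" arbitrary: i r h)
  case 0
  then show ?case using stop[of r h] sexec.WhileF[OF ok_bounded_mem, of W n r h e c]
    unfolding wp_def by (metis add.left_neutral diff_is_0_eq eq_iff le_add2)
next
  case (Suc x)
  then have im: "i < m" by simp
  have v: "val e (layout n r h) > 0" "wp W n c N r h (I (Suc i))" using step[OF im] Suc.prems by auto
  then obtain j r' h' where 1: "j \<le> N" "sexec W c (layout n r h) j (layout n r' h')" "ok W n r' h'" "I (Suc i) r' h'"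
    by (auto simp: wp_def)
  have "wp W n (While e c) ((m - Suc i) * (N + 1) + 1) r' h' (I m)"
    using Suc 1 im by (intro Suc.hyps(1)) auto
  then obtain j' r'' h'' where 2: "j' \<le> (m - Suc i) * (N + 1) + 1"
    "sexec W (While e c) (layout n r' h') j' (layout n r'' h'')" "ok W n r'' h''" "I m r'' h''"
    by (auto simp: wp_def)
  have "m - i = Suc (m - Suc i)" using im by simp
  then have "1 + j + j' \<le> (m - i) * (N + 1) + 1" using 1(1) 2(1) by simp
  then show ?case unfolding wp_def
    using sexec.WhileT[OF ok_bounded_mem[OF Suc.prems(2)] v(1) 1(2) 2(2)] 2(3,4) by blast
qed

lemma wp_for:
  assumes "ok W n r h" "I 0 r h"
    and "\<And>i r h. i < m \<Longrightarrow> ok W n r h \<Longrightarrow> I i r h \<Longrightarrow> val e (layout n r h) > 0"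
    and "\<And>i r h. i < m \<Longrightarrow> ok W n r h \<Longrightarrow> I i r h \<Longrightarrow> wp W n c N r h (I (Suc i))"
    and "\<And>r h. ok W n r h \<Longrightarrow> I m r h \<Longrightarrow> val e (layout n r h) \<le> 0"
  shows "wp W n (While e c) (m * (N + 1) + 1) r h (I m)"
  using wp_for_aux[of m W n I e c N 0 r h] assms by simp

section \<open>Computing the moduli of a level\<close>

text \<open>The exponent is fixed when the program is written: \<open>k\<close> is a parameter of
  the programs, not part of their input.\<close>

primrec epow :: "aexp \<Rightarrow> nat \<Rightarrow> aexp" where
  "epow e 0 = Num 1"
| "epow e (Suc k) = Mul e (epow e k)"

lemma val_epow: "val (epow e k) s = val e s ^ k"
  by (induction k) auto

notation Seq (infixr ";;" 60)

text \<open>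
  Registers: 2 \<open>b\<close>, 3 \<open>\<ell>\<close>, 4 and 6 the width of the current and the next level, 5 the entry bound, 8 the
  fanout, 9 \<open>L\<close>, 10 the product of the moduli so far, 11 the current prime \<open>p\<close>, 12 a power of \<open>p\<close>,
  13 the index \<open>j\<close> of the modulus, 14 the index of the group, 15 the index of the block, 16 and 17 the
  number under construction and the wanted residue, 18 the current modulus or a truth value, 19 a
  counter, 20 an index.
\<close>
definition find_nondiv :: com where
  "find_nondiv = setr 11 (Num 2) ;;
    While (Sub (Num 1) (Mod (reg 10) (reg 11))) (setr 11 (Add (reg 11) (Num 1)))"

text \<open>The guard \<open>1 - m mod p\<close> is positive exactly when p divides m. The number of
  steps is linear in the value found, which is acceptable because \<open>base_prime_le\<close>
  bounds it by O(b^2).\<close>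

lemma wp_find_nondiv:
  assumes "ok W n r h" "r 10 = int m" "m > 0" "nondiv m \<le> 2 ^ W"
  shows "wp W n find_nondiv (2 * nondiv m) r h (\<lambda>r' h'. r' = r(11 := int (nondiv m)) \<and> h' = h)"
proof -
  define I where "I = (\<lambda>i r' h'. r' = r(11 := int (2 + i)) \<and> h' = h)"
  obtain q where q: "nondiv m = q + 2" using nondiv(1)[OF assms(3)] by (metis le_add_diff_inverse2)
  have W: "\<bar>int (2 + i)\<bar> \<le> 2 ^ W" if "i \<le> q" for i
    using assms(4) that q by (intro abs_int_le) linarith
  have "wp W n find_nondiv (1 + (q * (1 + 1) + 1)) r h (I q)"
    unfolding find_nondiv_def
  proof (rule wp_seq)
    show "wp W n (setr 11 (Num 2)) 1 r h (I 0)"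
      by (rule wp_set[OF assms(1)]) (use W[of 0] in \<open>auto simp: I_def\<close>)
    fix r' h' assume ok': "ok W n r' h'" and I0: "I 0 r' h'"
    show "wp W n (While (Sub (Num 1) (Mod (reg 10) (reg 11))) (setr 11 (Add (reg 11) (Num 1))))
        (q * (1 + 1) + 1) r' h' (I q)"
    proof (rule wp_for[where I = I, OF ok' I0])
      fix i r h assume i: "i < q" and ok: "ok W n r h" and I: "I i r h"
      have "(2 + i) dvd m" using nondiv(3)[OF assms(3), of "2 + i"] i q by simp
      then have "int (2 + i) dvd int m" by (simp only: of_nat_dvd_iff)
      then have "int m mod int (2 + i) = 0" by (rule dvd_imp_mod_0)
      then show "val (Sub (Num 1) (Mod (reg 10) (reg 11))) (layout n r h) > 0"
        using I assms(2) ok by (simp add: val_reg I_def)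
      show "wp W n (setr 11 (Add (reg 11) (Num 1))) 1 r h (I (Suc i))"
        by (rule wp_set[OF ok]) (use I W[of "Suc i"] i ok in \<open>auto simp: val_reg I_def\<close>)
    next
      fix r h assume ok: "ok W n r h" and I: "I q r h"
      have "\<not> nondiv m dvd m" using nondiv(2)[OF assms(3)] .
      then have "m mod nondiv m > 0" by (simp add: mod_greater_zero_iff_not_dvd)
      then have "int m mod int (nondiv m) > 0" by (simp only: of_nat_0_less_iff flip: zmod_int)
      then show "val (Sub (Num 1) (Mod (reg 10) (reg 11))) (layout n r h) \<le> 0"
        using I assms(2) q ok by (simp add: val_reg I_def)
    qed
  qed
  then show ?thesis
    by (rule wp_mono) (use q in \<open>auto simp: I_def\<close>)
qed

definition find_power :: com where
  "find_power = setr 12 (Num 1) ;; While (Sub (reg 9) (reg 12)) (setr 12 (Mul (reg 12) (reg 11)))"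

lemma wp_find_power:
  assumes "ok W n r h" "r 9 = int L" "r 11 = int p" "p \<ge> 2" "p ^ min_exp L p \<le> 2 ^ W"
  shows "wp W n find_power (2 * W + 2) r h (\<lambda>r' h'. r' = r(12 := int (p ^ min_exp L p)) \<and> h' = h)"
proof -
  let ?e = "min_exp L p"
  define I where "I = (\<lambda>i r' h'. r' = r(12 := int (p ^ i)) \<and> h' = h)"
  have W: "\<bar>int (p ^ i)\<bar> \<le> 2 ^ W" if "i \<le> ?e" for i
    using power_increasing[OF that, of p] assms(4,5) by (intro abs_int_le) linarith
  \<comment> \<open>Because of \<open>p \<ge> 2\<close> the exponent is at most the word length, so
    the loop takes O(\<open>W\<close>) steps.\<close>
  have "2 ^ ?e \<le> p ^ ?e" using assms(4) by (rule power_mono) simp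
  then have "(2::nat) ^ ?e \<le> 2 ^ W" using assms(5) by linarith
  then have eW: "?e \<le> W" by simp
  have "wp W n find_power (1 + (?e * (1 + 1) + 1)) r h (I ?e)"
    unfolding find_power_def
  proof (rule wp_seq)
    show "wp W n (setr 12 (Num 1)) 1 r h (I 0)"
      by (rule wp_set[OF assms(1)]) (use W[of 0] in \<open>auto simp: I_def\<close>)
    fix r' h' assume ok': "ok W n r' h'" and I0: "I 0 r' h'"
    show "wp W n (While (Sub (reg 9) (reg 12)) (setr 12 (Mul (reg 12) (reg 11))))
        (?e * (1 + 1) + 1) r' h' (I ?e)"
    proof (rule wp_for[where I = I, OF ok' I0])
      fix i r h assume i: "i < ?e" and ok: "ok W n r h" and I: "I i r h"
      have "int (p ^ i) < int L" using min_exp(2)[OF assms(4) i] by (simp only: of_nat_less_iff)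
      then show "val (Sub (reg 9) (reg 12)) (layout n r h) > 0"
        using I assms(2) ok by (simp add: val_reg I_def)
      show "wp W n (setr 12 (Mul (reg 12) (reg 11))) 1 r h (I (Suc i))"
        by (rule wp_set[OF ok]) (use I W[of "Suc i"] i assms(3) ok in \<open>auto simp: val_reg I_def\<close>)
    next
      fix r h assume ok: "ok W n r h" and I: "I ?e r h"
      have "int L \<le> int (p ^ ?e)" using min_exp(1)[OF assms(4)] by (simp only: of_nat_le_iff)
      then show "val (Sub (reg 9) (reg 12)) (layout n r h) \<le> 0"
        using I assms(2) ok by (simp add: val_reg I_def)
    qed
  qed
  then show ?thesis
    by (rule wp_mono) (use eW in \<open>auto simp: I_def\<close>)
qed

text \<open>The \<open>j\<close>-th prime and modulus are stored in the cells \<open>n + 31 + 2 j\<close> and \<open>n + 32 + 2 j\<close>.\<close>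
definition tab :: "int \<Rightarrow> aexp" where
  "tab i = Add (Mem (Num 0)) (Add (Num (31 + i)) (Mul (Num 2) (reg 13)))"

lemma val_tab: "ok W n r h \<Longrightarrow> r 13 = int j \<Longrightarrow> val (tab (int i)) (layout n r h) = int (n + 31 + i + 2 * j)"
  by (simp add: tab_def val_reg layout_out) (simp add: ok_def)

definition gen_size :: com where
  "gen_size = setr 6 (Num 1) ;; setr 7 (Num 0) ;;
    While (Sub (reg 4) (reg 7)) (setr 6 (Mul (Num 2) (reg 6)) ;; setr 7 (Add (reg 7) (Num 1))) ;;
    Cond (Sub (reg 6) (reg 2)) (setr 6 (reg 2)) Skip"

definition gen_step :: com where
  "gen_step = find_nondiv ;; find_power ;; Store (tab 0) (reg 11) ;; Store (tab 1) (reg 12) ;;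
    setr 10 (Mul (reg 10) (reg 12)) ;; setr 13 (Add (reg 13) (Num 1))"

definition gen_moduli :: "nat \<Rightarrow> com" where
  "gen_moduli k = gen_size ;;
    setr 8 (Div (Sub (Add (reg 6) (reg 4)) (Num 1)) (reg 4)) ;;
    setr 9 (Mul (reg 3) (epow (reg 5) k)) ;; setr 10 (Num 1) ;; setr 13 (Num 0) ;;
    While (Sub (reg 8) (reg 13)) gen_step"

text \<open>A cell must hold the largest number of the construction. The second bound provides for
  indices below \<open>b ^ 2\<close> and, through \<open>b \<le> W\<close>, for the intermediate
  value \<open>2 ^ width s\<close>.\<close>

locale machine = dimred +
  fixes W n :: nat
  assumes W: "gip_bound depth \<le> 2 ^ W" "b ^ 2 + b \<le> W"
begin

lemma b_le: "b \<le> W" using W(2) by simp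

lemma b2_le_W: "b ^ 2 + b \<le> 2 ^ W"
  by (rule le_trans[OF W(2) less_imp_le[OF less_exp]])

lemma b_le_W: "b \<le> 2 ^ W"
  by (rule le_trans[OF b_le less_imp_le[OF less_exp]])

lemma gip_bound_le_W: "s \<le> depth \<Longrightarrow> gip_bound s \<le> 2 ^ W"
  using gip_bound_mono[of s depth] W(1) by linarith

lemma entry_bound_le_W: "s \<le> depth \<Longrightarrow> entry_bound s \<le> 2 ^ W"
  using gip_bound_le_W[of s] entry_bound_le_gip_bound[of s] by linarith

text \<open>The power \<open>2 ^ width s\<close> is computed before it is cut off at
  \<open>b\<close>; it fits into a cell because \<open>width s\<close> \<le> \<open>b\<close> \<le>
  \<open>W\<close>.\<close>

lemma wp_gen_size:
  assumes "ok W n r h" "s < depth" "r 2 = int b" "r 4 = int (width s)"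
  shows "wp W n gen_size (3 * b + 5) r h (\<lambda>r' h'. r' = r(6 := int (width (Suc s)), 7 := int (width s)) \<and> h' = h)"
proof -
  let ?B = "width s"
  define I where "I = (\<lambda>i r' h'. r' = r(6 := 2 ^ i, 7 := int i) \<and> h' = h)"
  have pW: "\<bar>2 ^ i :: int\<bar> \<le> 2 ^ W" if "i \<le> b" for i
    using that b_le by (simp add: power_increasing)
  have iW: "\<bar>int i\<bar> \<le> 2 ^ W" if "i \<le> b" for i
    using that b_le_W by (intro abs_int_le) linarith
  have "wp W n gen_size (1 + (1 + ((?B * (2 + 1) + 1) + (1 + 1)))) r h 
      (\<lambda>r' h'. r' = r(6 := int (width (Suc s)), 7 := int (width s)) \<and> h' = h)"
    unfolding gen_size_def
  proof (rule wp_set_seq[OF assms(1)])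
    assume ok1: "ok W n (r(6 := 1)) h"
    show "wp W n (setr 7 (Num 0) ;; While (Sub (reg 4) (reg 7)) (setr 6 (Mul (Num 2) (reg 6)) ;; setr 7 (Add (reg 7) (Num 1))) ;;
        Cond (Sub (reg 6) (reg 2)) (setr 6 (reg 2)) Skip) (1 + ((?B * (2 + 1) + 1) + (1 + 1))) (r(6 := 1)) h
       (\<lambda>r' h'. r' = r(6 := int (width (Suc s)), 7 := int (width s)) \<and> h' = h)"
    proof (rule wp_set_seq[OF ok1])
      assume ok2: "ok W n (r(6 := 1, 7 := 0)) h"
    show "wp W n (While (Sub (reg 4) (reg 7)) (setr 6 (Mul (Num 2) (reg 6)) ;; setr 7 (Add (reg 7) (Num 1))) ;;
        Cond (Sub (reg 6) (reg 2)) (setr 6 (reg 2)) Skip) (?B * (2 + 1) + 1 + (1 + 1)) (r(6 := 1, 7 := 0)) h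
       (\<lambda>r' h'. r' = r(6 := int (width (Suc s)), 7 := int (width s)) \<and> h' = h)"
    proof (rule wp_seq)
      show "wp W n (While (Sub (reg 4) (reg 7)) (setr 6 (Mul (Num 2) (reg 6)) ;; setr 7 (Add (reg 7) (Num 1))))
         (?B * (2 + 1) + 1) (r(6 := 1, 7 := 0)) h (I ?B)"
      proof (rule wp_for[where I = I, OF ok2])
        show "I 0 (r(6 := 1, 7 := 0)) h" by (simp add: I_def)
        fix i r' h' assume i: "i < ?B" and ok: "ok W n r' h'" and I: "I i r' h'"
        show "val (Sub (reg 4) (reg 7)) (layout n r' h') > 0"
          using I i assms(4) ok by (simp add: val_reg I_def)
        have "wp W n (setr 6 (Mul (Num 2) (reg 6)) ;; setr 7 (Add (reg 7) (Num 1))) (1 + 1) r' h' (I (Suc i))"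
        proof (rule wp_set_seq[OF ok])
          show "val (Mul (Num 2) (reg 6)) (layout n r' h') = 2 ^ Suc i"
            using I ok by (simp add: val_reg I_def)
          show "\<bar>2 ^ Suc i :: int\<bar> \<le> 2 ^ W" using i width_le[of s] by (intro pW) simp
          assume ok3: "ok W n (r'(6 := 2 ^ Suc i)) h'"
          show "wp W n (setr 7 (Add (reg 7) (Num 1))) 1 (r'(6 := 2 ^ Suc i)) h' (I (Suc i))"
            by (rule wp_set[OF ok3])
              (use I iW[of "Suc i"] i width_le[of s] ok3 in \<open>auto simp: val_reg I_def fun_eq_iff\<close>)
        qed simp
        then show "wp W n (setr 6 (Mul (Num 2) (reg 6)) ;; setr 7 (Add (reg 7) (Num 1))) 2 r' h' (I (Suc i))"
          by (simp only: one_add_one)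
      next
        fix r' h' assume ok: "ok W n r' h'" and I: "I ?B r' h'"
        show "val (Sub (reg 4) (reg 7)) (layout n r' h') \<le> 0"
          using I assms(4) ok by (simp add: val_reg I_def)
      qed
      fix r' h' assume ok: "ok W n r' h'" and I: "I ?B r' h'"
      have 6: "r' 6 = int (2 ^ ?B)" "r' 2 = int b" using I assms(3) by (auto simp: I_def)
      have bs: "width (Suc s) = min (2 ^ ?B) b" by (rule width_Suc)
      have v: "val (Sub (reg 6) (reg 2)) (layout n r' h') > 0 \<longleftrightarrow> 2 ^ ?B > b"
        using 6 ok by (simp add: val_reg del: of_nat_power)
      show "wp W n (Cond (Sub (reg 6) (reg 2)) (setr 6 (reg 2)) Skip) (1 + 1) r' h'
         (\<lambda>r' h'. r' = r(6 := int (width (Suc s)), 7 := int (width s)) \<and> h' = h)"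
      proof (rule wp_cond[OF ok])
        assume "val (Sub (reg 6) (reg 2)) (layout n r' h') > 0"
        then have "width (Suc s) = b" using v bs by simp
        then show "wp W n (setr 6 (reg 2)) 1 r' h'
           (\<lambda>r' h'. r' = r(6 := int (width (Suc s)), 7 := int (width s)) \<and> h' = h)"
          by (intro wp_set[OF ok]) (use 6 iW[of b] I ok in \<open>auto simp: val_reg I_def fun_eq_iff\<close>)
      next
        assume "val (Sub (reg 6) (reg 2)) (layout n r' h') \<le> 0"
        then have "width (Suc s) = 2 ^ ?B" using v bs by simp
        then show "wp W n Skip 1 r' h'
           (\<lambda>r' h'. r' = r(6 := int (width (Suc s)), 7 := int (width s)) \<and> h' = h)"
          by (intro wp_skip[OF ok]) (use I in \<open>auto simp: I_def\<close>)
      qed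
    qed
    qed simp_all
  qed simp_all
  then show ?thesis by (rule wp_mono) (use width_le[of s] in auto)
qed

definition tables :: "nat \<Rightarrow> nat \<Rightarrow> mem \<Rightarrow> bool" where
  "tables s i h \<longleftrightarrow> (\<forall>j<i. h (n + 31 + 2 * j) = int (base_prime (gip_bound s) j) \<and> h (n + 32 + 2 * j) = int (modulus (gip_bound s) j))"

lemma base_prime_le: "j < fanout s \<Longrightarrow> base_prime (gip_bound s) j \<le> 16 * b ^ 2 + 2"
proof -
  assume j: "j < fanout s"
  then have "j ^ 2 \<le> b ^ 2" using fanout_le[of s] by (intro power_mono) auto
  then show ?thesis using base_prime_prime_bound[OF gip_bound_bound j] by linarith
qed

lemma modulus_le_W: "s < depth \<Longrightarrow> j < fanout s \<Longrightarrow> modulus (gip_bound s) j \<le> 2 ^ W" 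
  and modprod_le_W: "s < depth \<Longrightarrow> j \<le> fanout s \<Longrightarrow> modprod (gip_bound s) j \<le> 2 ^ W"
  and base_prime_le_W: "s < depth \<Longrightarrow> j < fanout s \<Longrightarrow> base_prime (gip_bound s) j \<le> 2 ^ W"
proof -
  show *: "modprod (gip_bound s) j \<le> 2 ^ W" if "s < depth" "j \<le> fanout s" for j
  proof (cases j)
    case (Suc j')
    then show ?thesis using modprod_le_entry_bound[of j' s] entry_bound_le_W[of "Suc s"] that by simp
  qed simp
  assume 1: "s < depth" "j < fanout s"
  have "1 * modulus (gip_bound s) j \<le> modprod (gip_bound s) (Suc j)"
    unfolding modprod_Suc using modprod_pos[of "gip_bound s" j] by (intro mult_le_mono1) simp
  then show 2: "modulus (gip_bound s) j \<le> 2 ^ W" using *[of "Suc j"] 1 by simp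
  have "base_prime (gip_bound s) j ^ 1 \<le> modulus (gip_bound s) j" unfolding modulus_def
    using min_exp_pos[OF base_prime_ge_2[of "gip_bound s" j] gip_bound_ge_2[of s]] base_prime_ge_2[of "gip_bound s" j] by (intro power_increasing) linarith+
  then show "base_prime (gip_bound s) j \<le> 2 ^ W" using 2 by simp
qed

definition gen_inv :: "nat \<Rightarrow> (nat \<Rightarrow> int) \<Rightarrow> mem \<Rightarrow> nat \<Rightarrow> (nat \<Rightarrow> int) \<Rightarrow> mem \<Rightarrow> bool" where
  "gen_inv s r h i r' h' \<longleftrightarrow> (\<forall>c. c < 10 \<or> c > 13 \<longrightarrow> r' c = r c) \<and> r' 13 = int i \<and>
    r' 10 = int (modprod (gip_bound s) i) \<and> tables s i h' \<and> (\<forall>a. a \<le> n + 30 \<or> a \<ge> n + 31 + 2 * b \<longrightarrow> h' a = h a)"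

lemma wp_gen_step:
  assumes ok: "ok W n r' h'" and s: "s < depth" and i: "i < fanout s" and I: "gen_inv s r h i r' h'"
    and r9: "r 9 = int (gip_bound s)"
  shows "wp W n gen_step (32 * b ^ 2 + 2 * W + 10) r' h' (gen_inv s r h (Suc i))"
proof -
  let ?p = "base_prime (gip_bound s) i" and ?q = "modulus (gip_bound s) i"
  note Wb = modulus_le_W[OF s i] base_prime_le_W[OF s i] modprod_le_W[OF s, of "Suc i"]
  have b: "i < b" using i fanout_le[of s] by simp
  have "wp W n gen_step (2 * ?p + ((2 * W + 2) + (1 + (1 + (1 + 1))))) r' h' (gen_inv s r h (Suc i))"
    unfolding gen_step_def
  proof (rule wp_seq)
    show "wp W n find_nondiv (2 * ?p) r' h' (\<lambda>r'' h''. r'' = r'(11 := int ?p) \<and> h'' = h')"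
      unfolding base_prime_def using ok I modprod_pos base_prime_le_W[OF s i] 
      by (intro wp_find_nondiv) (auto simp: gen_inv_def base_prime_def)
    fix r1 h1 assume ok1: "ok W n r1 h1" and 1: "r1 = r'(11 := int ?p) \<and> h1 = h'"
    show "wp W n (find_power ;; Store (tab 0) (reg 11) ;; Store (tab 1) (reg 12) ;;
      setr 10 (Mul (reg 10) (reg 12)) ;; setr 13 (Add (reg 13) (Num 1))) 
      (2 * W + 2 + (1 + (1 + (1 + 1)))) r1 h1 (gen_inv s r h (Suc i))"
    proof (rule wp_seq)
      show "wp W n find_power (2 * W + 2) r1 h1 (\<lambda>r'' h''. r'' = r1(12 := int ?q) \<and> h'' = h1)"
        unfolding modulus_def using 1 I r9 Wb base_prime_ge_2
        by (intro wp_find_power[OF ok1]) (auto simp: gen_inv_def modulus_def)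
      fix r2 h2 assume ok2: "ok W n r2 h2" and 2: "r2 = r1(12 := int ?q) \<and> h2 = h1"
      have r2: "r2 11 = int ?p" "r2 12 = int ?q" "r2 13 = int i" "r2 10 = int (modprod (gip_bound s) i)"
        using 1 2 I by (auto simp: gen_inv_def)
      show "wp W n (Store (tab 0) (reg 11) ;; Store (tab 1) (reg 12) ;;
        setr 10 (Mul (reg 10) (reg 12)) ;; setr 13 (Add (reg 13) (Num 1))) 
        (1 + (1 + (1 + 1))) r2 h2 (gen_inv s r h (Suc i))"
      proof (rule wp_store_seq[OF ok2])
        show "val (tab 0) (layout n r2 h2) = int (n + 31 + 0 + 2 * i)"
          using val_tab[OF ok2 r2(3), of 0] by simp
        show "val (reg 11) (layout n r2 h2) = int ?p" using r2 ok2 by (simp add: val_reg)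
        show "\<bar>int ?p\<bar> \<le> 2 ^ W" by (rule abs_int_le) (rule Wb)
        let ?h3 = "h2(n + 31 + 0 + 2 * i := int ?p)"
        assume ok3: "ok W n r2 ?h3"
        show "wp W n (Store (tab 1) (reg 12) ;;
          setr 10 (Mul (reg 10) (reg 12)) ;; setr 13 (Add (reg 13) (Num 1))) (1 + (1 + 1)) r2 ?h3 (gen_inv s r h (Suc i))"
        proof (rule wp_store_seq[OF ok3])
          show "val (tab 1) (layout n r2 ?h3) = int (n + 31 + 1 + 2 * i)"
            using val_tab[OF ok3 r2(3), of 1] by simp
          show "val (reg 12) (layout n r2 ?h3) = int ?q" using r2 ok3 by (simp add: val_reg)
          show "\<bar>int ?q\<bar> \<le> 2 ^ W" by (rule abs_int_le) (rule Wb)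
          let ?h4 = "?h3(n + 31 + 1 + 2 * i := int ?q)"
          assume ok4: "ok W n r2 ?h4"
          show "wp W n (setr 10 (Mul (reg 10) (reg 12)) ;; setr 13 (Add (reg 13) (Num 1))) (1 + 1) r2 ?h4 (gen_inv s r h (Suc i))"
          proof (rule wp_set_seq[OF ok4])
            show "val (Mul (reg 10) (reg 12)) (layout n r2 ?h4) = int (modprod (gip_bound s) (Suc i))"
              using r2 ok4 by (simp add: val_reg modprod_Suc del: modprod.simps)
            show "\<bar>int (modprod (gip_bound s) (Suc i))\<bar> \<le> 2 ^ W" using i by (intro abs_int_le Wb) simp
            let ?r5 = "r2(10 := int (modprod (gip_bound s) (Suc i)))"
            assume ok5: "ok W n ?r5 ?h4"
            have "gen_inv s r h (Suc i) (?r5(13 := int (Suc i))) ?h4"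
              using I 1 2 b unfolding gen_inv_def tables_def by (auto simp: less_Suc_eq simp del: modprod.simps)
            then show "wp W n (setr 13 (Add (reg 13) (Num 1))) 1 ?r5 ?h4 (gen_inv s r h (Suc i))"
              using r2 abs_int_le[OF le_trans[OF Suc_leI[OF b] b_le_W]]
              by (intro wp_set[OF ok5]) (use ok5 in \<open>auto simp: val_reg\<close>)
          qed simp
        qed simp_all
      qed simp_all
    qed
  qed
  then show ?thesis by (rule wp_mono) (use base_prime_le[OF i] in auto)
qed

lemma wp_gen_moduli:
  assumes ok: "ok W n r h" and s: "s < depth"
    and r: "r 2 = int b" "r 3 = int l" "r 4 = int (width s)" "r 5 = int (entry_bound s)"
  shows "wp W n (gen_moduli k) (b * (32 * b ^ 2 + 2 * W + 14) + 10) r h (\<lambda>r' h'. 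
    (\<forall>c. c < 6 \<or> c > 13 \<longrightarrow> r' c = r c) \<and> r' 6 = int (width (Suc s)) \<and> r' 8 = int (fanout s) \<and>
    r' 10 = int (entry_bound (Suc s)) \<and> tables s (fanout s) h' \<and> (\<forall>a. a \<le> n + 30 \<or> a \<ge> n + 31 + 2 * b \<longrightarrow> h' a = h a))"
    (is "wp _ _ _ _ _ _ ?Q")
proof -
  let ?N = "32 * b ^ 2 + 2 * W + 10"
  have "wp W n (gen_moduli k) ((3 * b + 5) + (1 + (1 + (1 + (1 + (fanout s * (?N + 1) + 1)))))) r h ?Q"
    unfolding gen_moduli_def
  proof (rule wp_seq[OF wp_gen_size[OF ok s r(1,3)]])
    fix r1 h1 assume ok1: "ok W n r1 h1" and 1: "r1 = r(6 := int (width (Suc s)), 7 := int (width s)) \<and> h1 = h"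
    let ?r2 = "r1(8 := int (fanout s))" let ?r3 = "?r2(9 := int (gip_bound s))" 
    let ?r4 = "?r3(10 := 1)" let ?r5 = "?r4(13 := 0)"
    show "wp W n (setr 8 (Div (Sub (Add (reg 6) (reg 4)) (Num 1)) (reg 4)) ;;
      setr 9 (Mul (reg 3) (epow (reg 5) k)) ;; setr 10 (Num 1) ;; setr 13 (Num 0) ;;
      While (Sub (reg 8) (reg 13)) gen_step) (1 + (1 + (1 + (1 + (fanout s * (?N + 1) + 1))))) r1 h1 ?Q"
    proof (rule wp_set_seq[OF ok1])
      have "int (fanout s) = (int (width (Suc s)) + int (width s) - 1) div int (width s)"
        unfolding fanout_def zdiv_int by (subst of_nat_diff) (simp_all add: Suc_leI trans_le_add2)
      then show "val (Div (Sub (Add (reg 6) (reg 4)) (Num 1)) (reg 4)) (layout n r1 h1) = int (fanout s)"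
        using 1 r ok1 by (simp add: val_reg)
      show "\<bar>int (fanout s)\<bar> \<le> 2 ^ W" using fanout_le[of s] b_le_W by (intro abs_int_le) linarith
      assume ok2: "ok W n ?r2 h1"
      show "wp W n (setr 9 (Mul (reg 3) (epow (reg 5) k)) ;; setr 10 (Num 1) ;; setr 13 (Num 0) ;;
        While (Sub (reg 8) (reg 13)) gen_step) (1 + (1 + (1 + (fanout s * (?N + 1) + 1)))) ?r2 h1 ?Q"
      proof (rule wp_set_seq[OF ok2])
        show "val (Mul (reg 3) (epow (reg 5) k)) (layout n ?r2 h1) = int (gip_bound s)"
          using 1 r ok2 by (simp add: val_reg val_epow gip_bound_def)
        show "\<bar>int (gip_bound s)\<bar> \<le> 2 ^ W" using s by (intro abs_int_le gip_bound_le_W) simp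
        assume ok3: "ok W n ?r3 h1"
        show "wp W n (setr 10 (Num 1) ;; setr 13 (Num 0) ;;
          While (Sub (reg 8) (reg 13)) gen_step) (1 + (1 + (fanout s * (?N + 1) + 1))) ?r3 h1 ?Q"
        proof (rule wp_set_seq[OF ok3])
          assume ok4: "ok W n ?r4 h1"
          show "wp W n (setr 13 (Num 0) ;;
            While (Sub (reg 8) (reg 13)) gen_step) (1 + (fanout s * (?N + 1) + 1)) ?r4 h1 ?Q"
          proof (rule wp_set_seq[OF ok4])
            assume ok5: "ok W n ?r5 h1"
            have "wp W n (While (Sub (reg 8) (reg 13)) gen_step) (fanout s * (?N + 1) + 1) ?r5 h1 (gen_inv s ?r5 h1 (fanout s))"
            proof (rule wp_for[where I = "gen_inv s ?r5 h1", OF ok5])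
              show "gen_inv s ?r5 h1 0 ?r5 h1" by (simp add: gen_inv_def tables_def)
              fix i r' h' assume i: "i < fanout s" and ok: "ok W n r' h'" and I: "gen_inv s ?r5 h1 i r' h'"
              show "val (Sub (reg 8) (reg 13)) (layout n r' h') > 0"
                using I i ok by (simp add: val_reg gen_inv_def)
              show "wp W n gen_step ?N r' h' (gen_inv s ?r5 h1 (Suc i))"
                by (rule wp_gen_step[OF ok s i I]) simp
            next
              fix r' h' assume ok: "ok W n r' h'" and I: "gen_inv s ?r5 h1 (fanout s) r' h'"
              show "val (Sub (reg 8) (reg 13)) (layout n r' h') \<le> 0"
                using I ok by (simp add: val_reg gen_inv_def)
            qed
            then show "wp W n (While (Sub (reg 8) (reg 13)) gen_step) (fanout s * (?N + 1) + 1) ?r5 h1 ?Q"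
              by (rule wp_mono) (use 1 in \<open>auto simp: gen_inv_def entry_bound_Suc\<close>)
          qed simp_all
        qed simp_all
      qed simp
    qed simp
  qed
  moreover have "(3 * b + 5) + (1 + (1 + (1 + (1 + (fanout s * (?N + 1) + 1))))) \<le> b * (32 * b ^ 2 + 2 * W + 14) + 10"
  proof -
    have "fanout s * (?N + 1) \<le> b * (?N + 1)" using fanout_le by (rule mult_le_mono1)
    then show ?thesis by (simp add: algebra_simps)
  qed
  ultimately show ?thesis by (rule wp_mono)
qed

end

section \<open>Computing the encoding\<close>

text \<open>The common skeleton of both programs: \<open>body\<close> lifts the data by one level,
  with register 5 already holding the next entry bound. The loop stops when the width reaches
  \<open>b\<close>, so \<open>log_star\<close> is not evaluated.\<close>

definition levels :: "nat \<Rightarrow> com \<Rightarrow> com" where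
  "levels k body = While (Sub (reg 2) (reg 4)) (gen_moduli k ;; setr 5 (reg 10) ;; body ;; setr 4 (reg 6))"

text \<open>
  Garner's algorithm, with the residue modulo \<open>p ^ e\<close> corrected one base-\<open>p\<close> digit at a time: at most
  \<open>p - 1\<close> additions per digit replace the modular inverse.
\<close>
definition hensel_digit :: com where
  "hensel_digit = While (Mod (Sub (reg 16) (reg 17)) (Mul (reg 12) (reg 11)))
    (setr 16 (Add (reg 16) (Mul (reg 10) (reg 12))))"

definition hensel :: com where
  "hensel = While (Sub (reg 18) (reg 12)) (hensel_digit ;; setr 12 (Mul (reg 12) (reg 11)))"

text \<open>With x - v = P u the congruence becomes t m \<equiv> u modulo p, and m is invertible
  modulo p.\<close>

lemma hensel_ex:
  assumes "coprime m p" "p > 0" "[v = x] (mod P)"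
  shows "\<exists>t<p. [v + t * (m * P) = x] (mod (P * p :: nat))"
proof -
  obtain z where z: "[int m * z = 1] (mod int p)"
    using cong_solve_coprime_int[of "int m" "int p"] assms(1) by auto
  have "int P dvd int x - int v" using assms(3) by (metis cong_iff_dvd_diff cong_int_iff cong_sym)
  then obtain u where u: "int x - int v = int P * u" by (auto elim: dvdE)
  define t where "t = nat ((z * u) mod int p)"
  have t: "int t = (z * u) mod int p" using assms(2) by (simp add: t_def)
  have "[int t * int m = z * u * int m] (mod int p)" unfolding t by (intro cong_scalar_right) simp
  also have "z * u * int m = (int m * z) * u" by simp
  also have "[(int m * z) * u = 1 * u] (mod int p)" using z by (rule cong_scalar_right)
  finally have "int p dvd int t * int m - u" by (simp add: cong_iff_dvd_diff)
  then have "int P * int p dvd int P * (int t * int m - u)" by simp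
  also have "int P * (int t * int m - u) = int (v + t * (m * P)) - int x"
    using u by (simp add: algebra_simps)
  finally have "[int (v + t * (m * P)) = int x] (mod int (P * p))" by (simp add: cong_iff_dvd_diff)
  then have "[v + t * (m * P) = x] (mod (P * p))" by (simp only: cong_int_iff)
  moreover have "t < p" using t assms(2) by (metis of_nat_0_less_iff of_nat_less_iff pos_mod_bound)
  ultimately show ?thesis by blast
qed

text \<open>For the guard of \<open>hensel_digit\<close>: floor remainders are nonnegative even if v
  < x, so positivity expresses incongruence.\<close>

lemma mod_diff_pos_iff: "q > 0 \<Longrightarrow> (int v - int x) mod int q > 0 \<longleftrightarrow> \<not> [v = x] (mod q)"
proof -
  assume q: "q > 0"
  have "[v = x] (mod q) \<longleftrightarrow> (int v - int x) mod int q = 0"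
    by (simp add: cong_iff_dvd_diff dvd_eq_mod_eq_0 flip: cong_int_iff)
  moreover have "(int v - int x) mod int q \<ge> 0" using q by simp
  ultimately show ?thesis by linarith
qed

text \<open>The loop stops at the least solution T < p. From v < m P at most p - 1 summands m P are
  added, so the value stays below m P p and is already the reduced representative.\<close>

lemma wp_hensel_digit:
  assumes ok: "ok W n r h" and r: "r 10 = int m" "r 11 = int p" "r 12 = int P" "r 16 = int v" "r 17 = int x"
    and W: "m * (P * p) \<le> 2 ^ W" and v: "v < m * P" "[v = x] (mod P)" and p: "coprime m p" "p > 0"
  shows "wp W n hensel_digit (2 * p + 1) r h (\<lambda>r' h'. h' = h \<and> (\<exists>v'. r' = r(16 := int v') \<and>
    v' < m * (P * p) \<and> [v' = v] (mod m) \<and> [v' = x] (mod (P * p))))" (is "wp _ _ _ _ _ _ ?Q")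
proof -
  define T where "T = (LEAST t. [v + t * (m * P) = x] (mod (P * p)))"
  define w where "w i = v + i * (m * P)" for i
  obtain t where t: "t < p" "[w t = x] (mod (P * p))" using hensel_ex[OF p v(2)] by (auto simp: w_def)
  have T1: "[w T = x] (mod (P * p))" unfolding T_def w_def using t(2)[unfolded w_def] by (rule LeastI)
  have "T \<le> t" unfolding T_def using t(2)[unfolded w_def] by (rule Least_le)
  then have Tp: "T < p" using t by simp
  have T2: "\<not> [w i = x] (mod (P * p))" if "i < T" for i
    using that not_less_Least unfolding T_def w_def by blast
  have Pp: "P * p > 0" using v p by (cases P) auto
  have wb: "w i < m * (P * p)" if "i \<le> T" for i
  proof -
    have "w i < Suc i * (m * P)" using v(1) by (simp add: w_def)
    also have "\<dots> \<le> p * (m * P)" using that Tp by (intro mult_le_mono1) simp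
    finally show ?thesis by (simp add: ac_simps)
  qed
  define I where "I = (\<lambda>i r' h'. r' = r(16 := int (w i)) \<and> h' = h)"
  have guard: "val (Mod (Sub (reg 16) (reg 17)) (Mul (reg 12) (reg 11))) (layout n r' h') > 0 \<longleftrightarrow> \<not> [w i = x] (mod (P * p))"
    if "ok W n r' h'" "I i r' h'" for i r' h'
    using mod_diff_pos_iff[OF Pp, of "w i" x] that r by (simp add: val_reg I_def)
  have "wp W n hensel_digit (T * (1 + 1) + 1) r h (I T)"
    unfolding hensel_digit_def
  proof (rule wp_for[where I = I, OF ok])
    show "I 0 r h" using r by (auto simp: I_def w_def)
    fix i r' h' assume i: "i < T" and ok': "ok W n r' h'" and I: "I i r' h'"
    show "val (Mod (Sub (reg 16) (reg 17)) (Mul (reg 12) (reg 11))) (layout n r' h') > 0"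
      using guard[OF ok' I] T2[OF i] by simp
    have e: "val (Add (reg 16) (Mul (reg 10) (reg 12))) (layout n r' h') = int (w (Suc i))"
      using I ok' r by (simp add: val_reg I_def w_def algebra_simps)
    have "w (Suc i) \<le> 2 ^ W" using wb[of "Suc i"] i W by linarith
    then show "wp W n (setr 16 (Add (reg 16) (Mul (reg 10) (reg 12)))) 1 r' h' (I (Suc i))"
      by (intro wp_set[OF ok' e] abs_int_le) (use I in \<open>auto simp: I_def\<close>)
  next
    fix r' h' assume ok': "ok W n r' h'" and I: "I T r' h'"
    show "val (Mod (Sub (reg 16) (reg 17)) (Mul (reg 12) (reg 11))) (layout n r' h') \<le> 0"
      using guard[OF ok' I] T1 by simp
  qed
  then show ?thesis
  proof (rule wp_mono)
    fix r' h' assume "I T r' h'"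
    moreover have "[w T = v] (mod m)" 
      unfolding w_def cong_def by (metis mod_mult_self1 mult.left_commute mult.commute)
    ultimately show "?Q r' h'" using T1 wb[of T] by (auto simp: I_def)
  qed (use Tp in simp)
qed

text \<open>Each round fixes one more base-p digit and preserves the residue modulo m. There are e
  \<le> W rounds, since p \<ge> 2 and p^e fits into a cell.\<close>

lemma wp_hensel:
  assumes ok: "ok W n r h"
    and r: "r 10 = int m" "r 11 = int p" "r 12 = 1" "r 16 = int v" "r 17 = int x" "r 18 = int (p ^ e)"
    and W: "m * p ^ e \<le> 2 ^ W" and v: "v < m" and p: "coprime m p" "p \<ge> 2"
  shows "wp W n hensel (W * (2 * p + 3) + 1) r h (\<lambda>r' h'. h' = h \<and> (\<exists>v'. r' = r(12 := int (p ^ e), 16 := int v') \<and>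
    v' < m * p ^ e \<and> [v' = v] (mod m) \<and> [v' = x] (mod (p ^ e))))" (is "wp _ _ _ _ _ _ ?Q")
proof -
  define I where "I = (\<lambda>i r' h'. h' = h \<and> (\<exists>v'. r' = r(12 := int (p ^ i), 16 := int v') \<and>
    v' < m * p ^ i \<and> [v' = v] (mod m) \<and> [v' = x] (mod (p ^ i))))"
  have "1 * p ^ e \<le> m * p ^ e" using v by (intro mult_le_mono1) simp
  then have peW: "p ^ e \<le> 2 ^ W" using W by (simp only: mult_1)
  moreover have "2 ^ e \<le> p ^ e" using p(2) by (rule power_mono) simp
  ultimately have "(2::nat) ^ e \<le> 2 ^ W" by (rule le_trans[rotated])
  then have eW: "e \<le> W" by simp
  have "wp W n hensel (e * ((2 * p + 2) + 1) + 1) r h (I e)"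
    unfolding hensel_def
  proof (rule wp_for[where I = I, OF ok])
    show "I 0 r h" unfolding I_def using r v by (intro conjI exI[of _ v]) (auto simp: fun_eq_iff)
    fix i r' h' assume i: "i < e" and ok': "ok W n r' h'" and I: "I i r' h'"
    from I obtain v' where v': "r' = r(12 := int (p ^ i), 16 := int v')" "h' = h"
      "v' < m * p ^ i" "[v' = v] (mod m)" "[v' = x] (mod (p ^ i))" by (auto simp: I_def)
    have lt: "p ^ i < p ^ e" using i p(2) by (simp add: power_strict_increasing)
    then have "int (p ^ i) < int (p ^ e)" by (simp only: of_nat_less_iff)
    then show "val (Sub (reg 18) (reg 12)) (layout n r' h') > 0"
      using ok' v' r by (simp add: val_reg)
    have le: "p ^ Suc i \<le> p ^ e" using i p(2) by (intro power_increasing) auto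
    have "m * p ^ Suc i \<le> m * p ^ e" using le by (rule mult_le_mono2)
    then have "m * p ^ Suc i \<le> 2 ^ W" using W by (rule le_trans)
    then have mW: "m * (p ^ i * p) \<le> 2 ^ W" by (simp only: power_Suc2)
    have "wp W n (hensel_digit ;; setr 12 (Mul (reg 12) (reg 11))) ((2 * p + 1) + 1) r' h' (I (Suc i))"
    proof (rule wp_seq)
      show "wp W n hensel_digit (2 * p + 1) r' h' (\<lambda>r'' h''. h'' = h' \<and> (\<exists>w. r'' = r'(16 := int w) \<and>
        w < m * (p ^ i * p) \<and> [w = v'] (mod m) \<and> [w = x] (mod (p ^ i * p))))"
        by (rule wp_hensel_digit[OF ok']) (use v' r p mW in auto)
      fix r1 h1 assume ok1: "ok W n r1 h1" and "h1 = h' \<and> (\<exists>w. r1 = r'(16 := int w) \<and>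
        w < m * (p ^ i * p) \<and> [w = v'] (mod m) \<and> [w = x] (mod (p ^ i * p)))"
      then obtain w where w: "h1 = h'" "r1 = r'(16 := int w)"
        "w < m * (p ^ i * p)" "[w = v'] (mod m)" "[w = x] (mod (p ^ i * p))" by auto
      have e1: "val (Mul (reg 12) (reg 11)) (layout n r1 h1) = int (p ^ Suc i)"
        using ok1 w v' r by (simp add: val_reg mult.commute)
      show "wp W n (setr 12 (Mul (reg 12) (reg 11))) 1 r1 h1 (I (Suc i))"
      proof (rule wp_set[OF ok1 e1])
        show "\<bar>int (p ^ Suc i)\<bar> \<le> 2 ^ W" using le peW by (intro abs_int_le) linarith
        have "[w = v] (mod m)" using w(4) v'(4) by (rule cong_trans)
        moreover have "r1(12 := int (p ^ Suc i)) = r(12 := int (p ^ Suc i), 16 := int w)"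
          using w v' by (auto simp: fun_eq_iff)
        ultimately show "I (Suc i) (r1(12 := int (p ^ Suc i))) h1"
          unfolding I_def using w v' by (auto simp: ac_simps intro!: exI[of _ w])
      qed simp
    qed
    then show "wp W n (hensel_digit ;; setr 12 (Mul (reg 12) (reg 11))) (2 * p + 2) r' h' (I (Suc i))"
      by simp
  next
    fix r' h' assume ok': "ok W n r' h'" and "I e r' h'"
    then show "val (Sub (reg 18) (reg 12)) (layout n r' h') \<le> 0" using r by (auto simp: val_reg I_def)
  qed
  then show ?thesis
  proof (rule wp_mono)
    have "e * (2 * p + 2 + 1) \<le> W * (2 * p + 3)" using eW by (intro mult_le_mono) auto
    then show "e * (2 * p + 2 + 1) + 1 \<le> W * (2 * p + 3) + 1" by simp
  qed (simp add: I_def)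
qed

context machine
begin

text \<open>\<open>J\<close> describes the data lifted by \<open>body\<close>: the blocks for
  \<psi>, the membership table for \<open>V\<close>. The frame hypothesis demands that it survive
  changes in the \<open>2 * b\<close> cells where the moduli are stored.\<close>

lemma wp_levels:
  assumes ok: "ok W n r h"
    and r: "r 2 = int b" "r 3 = int l" "r 4 = 1" "r 5 = 2" and J0: "J 0 h"
    and frame: "\<And>s h h'. J s h \<Longrightarrow> (\<And>a. a \<le> n + 30 \<or> a \<ge> n + 31 + 2 * b \<Longrightarrow> h' a = h a) \<Longrightarrow> J s h'"
    and body: "\<And>s r h. s < depth \<Longrightarrow> ok W n r h \<Longrightarrow> r 2 = int b \<Longrightarrow> r 3 = int l \<Longrightarrow>
      r 5 = int (entry_bound (Suc s)) \<Longrightarrow> r 8 = int (fanout s) \<Longrightarrow> tables s (fanout s) h \<Longrightarrow> J s h \<Longrightarrow>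
      wp W n body N r h (\<lambda>r' h'. (\<forall>c<10. r' c = r c) \<and> J (Suc s) h')"
  shows "wp W n (levels k body) (depth * (b * (32 * b ^ 2 + 2 * W + 14) + N + 13) + 1) r h
    (\<lambda>r' h'. r' 2 = int b \<and> r' 3 = int l \<and> r' 5 = int (entry_bound depth) \<and> J depth h')"
proof -
  define I where "I = (\<lambda>s (r' :: nat \<Rightarrow> int) h'. r' 2 = int b \<and> r' 3 = int l \<and> r' 4 = int (width s) \<and> r' 5 = int (entry_bound s) \<and> J s h')"
  let ?G = "b * (32 * b ^ 2 + 2 * W + 14) + 10"
  have "wp W n (levels k body) (depth * ((?G + (1 + (N + 1))) + 1) + 1) r h (I depth)"
    unfolding levels_def
  proof (rule wp_for[where I = I, OF ok])
    show "I 0 r h" using r J0 by (simp add: I_def width_0)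
    fix s r' h' assume s: "s < depth" and ok': "ok W n r' h'" and I: "I s r' h'"
    show "val (Sub (reg 2) (reg 4)) (layout n r' h') > 0"
      using I ok' width_less_depth[OF s] by (simp add: val_reg I_def)
    show "wp W n (gen_moduli k ;; setr 5 (reg 10) ;; body ;; setr 4 (reg 6)) (?G + (1 + (N + 1))) r' h' (I (Suc s))"
    proof (rule wp_seq)
      show "wp W n (gen_moduli k) ?G r' h' (\<lambda>r'' h''. 
        (\<forall>c. c < 6 \<or> c > 13 \<longrightarrow> r'' c = r' c) \<and> r'' 6 = int (width (Suc s)) \<and> r'' 8 = int (fanout s) \<and>
        r'' 10 = int (entry_bound (Suc s)) \<and> tables s (fanout s) h'' \<and> (\<forall>a. a \<le> n + 30 \<or> a \<ge> n + 31 + 2 * b \<longrightarrow> h'' a = h' a))"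
        by (rule wp_gen_moduli[OF ok' s]) (use I in \<open>auto simp: I_def\<close>)
      fix r1 h1 assume ok1: "ok W n r1 h1" and 1: "(\<forall>c. c < 6 \<or> c > 13 \<longrightarrow> r1 c = r' c) \<and> r1 6 = int (width (Suc s)) \<and> r1 8 = int (fanout s) \<and>
        r1 10 = int (entry_bound (Suc s)) \<and> tables s (fanout s) h1 \<and> (\<forall>a. a \<le> n + 30 \<or> a \<ge> n + 31 + 2 * b \<longrightarrow> h1 a = h' a)"
      have J1: "J s h1" using 1 I frame[of s h' h1] by (auto simp: I_def)
      show "wp W n (setr 5 (reg 10) ;; body ;; setr 4 (reg 6)) (1 + (N + 1)) r1 h1 (I (Suc s))"
      proof (rule wp_set_seq[OF ok1])
        show "val (reg 10) (layout n r1 h1) = int (entry_bound (Suc s))" using 1 ok1 by (simp add: val_reg)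
        show "\<bar>int (entry_bound (Suc s))\<bar> \<le> 2 ^ W" using s by (intro abs_int_le entry_bound_le_W) simp
        let ?r2 = "r1(5 := int (entry_bound (Suc s)))"
        assume ok2: "ok W n ?r2 h1"
        show "wp W n (body ;; setr 4 (reg 6)) (N + 1) ?r2 h1 (I (Suc s))"
        proof (rule wp_seq)
          show "wp W n body N ?r2 h1 (\<lambda>r' h'. (\<forall>c<10. r' c = ?r2 c) \<and> J (Suc s) h')"
            by (rule body[OF s ok2]) (use 1 I J1 in \<open>auto simp: I_def\<close>)
          fix r3 h3 assume ok3: "ok W n r3 h3" and 3: "(\<forall>c<10. r3 c = ?r2 c) \<and> J (Suc s) h3"
          have r3: "r3 2 = int b" "r3 3 = int l" "r3 5 = int (entry_bound (Suc s))" "r3 6 = int (width (Suc s))"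
            using 3 1 I by (auto simp: I_def)
          have v: "val (reg 6) (layout n r3 h3) = int (width (Suc s))" using r3 ok3 by (simp add: val_reg)
          show "wp W n (setr 4 (reg 6)) 1 r3 h3 (I (Suc s))"
            by (rule wp_set[OF ok3 v _ abs_int_le[OF le_trans[OF width_le b_le_W]]]) (use r3 3 in \<open>auto simp: I_def\<close>)
        qed
      qed simp
    qed
  next
    fix r' h' assume "ok W n r' h'" "I depth r' h'"
    then show "val (Sub (reg 2) (reg 4)) (layout n r' h') \<le> 0" by (simp add: val_reg I_def width_depth)
  qed
  then show ?thesis by (rule wp_mono) (auto simp: I_def algebra_simps)
qed

end

text \<open>Cell 0 holds the input length and cells 1 and 2 hold b and \<ell>, hence the offset
  3.\<close>

definition inaddr :: "aexp \<Rightarrow> aexp" where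
  "inaddr e = Add (Num 3) (Add (Mul (reg 15) (reg 2)) e)"

definition garner_step :: com where
  "garner_step = setr 20 (Add (Mul (reg 14) (reg 8)) (reg 13)) ;;
    Cond (Sub (reg 2) (reg 20)) (setr 17 (Mem (inaddr (reg 20)))) (setr 17 (Num 0)) ;;
    setr 11 (Mem (tab 0)) ;; setr 18 (Mem (tab 1)) ;; setr 12 (Num 1) ;; hensel ;;
    setr 10 (Mul (reg 10) (reg 18)) ;; setr 13 (Add (reg 13) (Num 1))"

text \<open>
  Works in place: group \<open>g\<close> reads the positions \<open>g * fanout + j \<ge> g\<close> and then overwrites position \<open>g\<close>.
\<close>
definition garner_group :: com where
  "garner_group = setr 16 (Num 0) ;; setr 10 (Num 1) ;; setr 13 (Num 0) ;;
    While (Sub (reg 8) (reg 13)) garner_step ;;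
    Store (inaddr (reg 14)) (reg 16) ;; setr 14 (Add (reg 14) (Num 1))"

definition garner_block :: com where
  "garner_block = setr 14 (Num 0) ;; While (Sub (reg 2) (reg 14)) garner_group ;;
    setr 15 (Add (reg 15) (Num 1))"

definition garner_all :: com where
  "garner_all = setr 15 (Num 0) ;; While (Sub (reg 3) (reg 15)) garner_block"

definition copy_out :: com where
  "copy_out = setr 15 (Num 0) ;; While (Sub (reg 3) (reg 15))
    (Store (Add (reg 15) (Num 1)) (Mem (inaddr (Num 0))) ;; setr 15 (Add (reg 15) (Num 1)))"

definition psi_prog :: "nat \<Rightarrow> com" where
  "psi_prog k = setr 2 (Mem (Num 1)) ;; setr 3 (Mem (Num 2)) ;; setr 4 (Num 1) ;; setr 5 (Num 2) ;;
    levels k garner_all ;; copy_out"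

lemma val_inaddr: "ok W n r h \<Longrightarrow> r 15 = int i \<Longrightarrow> r 2 = int b \<Longrightarrow> val e (layout n r h) = int a \<Longrightarrow>
    val (inaddr e) (layout n r h) = int (3 + i * b + a)"
  by (simp add: inaddr_def val_reg)

context machine
begin

definition chunk :: "(nat \<Rightarrow> nat) \<Rightarrow> nat \<Rightarrow> nat \<Rightarrow> nat \<Rightarrow> nat" where
  "chunk x s g j = (if g * fanout s + j < b then encode x s (g * fanout s + j) else 0)"

lemma encode_Suc: "encode x (Suc s) g = crt (gip_bound s) (fanout s) (chunk x s g)"
  by (simp add: chunk_def[abs_def])

definition garner_inv :: "(nat \<Rightarrow> nat) \<Rightarrow> nat \<Rightarrow> nat \<Rightarrow> (nat \<Rightarrow> int) \<Rightarrow> mem \<Rightarrow> nat \<Rightarrow> (nat \<Rightarrow> int) \<Rightarrow> mem \<Rightarrow> bool" where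
  "garner_inv x s g r h j r' h' \<longleftrightarrow> h' = h \<and> (\<forall>c. c < 10 \<or> c = 14 \<or> c = 15 \<longrightarrow> r' c = r c) \<and> r' 13 = int j \<and>
    r' 10 = int (modprod (gip_bound s) j) \<and>
    (\<exists>v. r' 16 = int v \<and> v < modprod (gip_bound s) j \<and> (\<forall>j'<j. [v = chunk x s g j'] (mod modulus (gip_bound s) j')))"

lemma index_le: "i < l \<Longrightarrow> a < b \<Longrightarrow> b * l + 2 \<le> n \<Longrightarrow> 3 + i * b + a \<le> n"
  using index_less[of i a] by simp

lemma wp_garner_step:
  assumes ok: "ok W n r' h'" and s: "s < depth" and j: "j < fanout s" and I: "garner_inv x s g r h j r' h'"
    and r: "r 2 = int b" "r 8 = int (fanout s)" "r 14 = int g" "r 15 = int i"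
    and n: "b * l + 2 \<le> n" and i: "i < l" and g: "g < b" and tabs: "tables s (fanout s) h"
    and rd: "\<And>a. g \<le> a \<Longrightarrow> a < b \<Longrightarrow> h (3 + i * b + a) = int (encode x s a)"
  shows "wp W n garner_step (W * (32 * b ^ 2 + 7) + 10) r' h' (garner_inv x s g r h (Suc j))"
proof -
  let ?p = "base_prime (gip_bound s) j" and ?q = "modulus (gip_bound s) j" and ?m = "modprod (gip_bound s) j" and ?x = "chunk x s g j"
  define a where "a = g * fanout s + j"
  obtain v where v: "r' 16 = int v" "v < ?m" "\<forall>j'<j. [v = chunk x s g j'] (mod modulus (gip_bound s) j')"
    using I by (auto simp: garner_inv_def)
  have h: "h' = h" using I by (simp add: garner_inv_def)
  have r': "r' 2 = int b" "r' 8 = int (fanout s)" "r' 14 = int g" "r' 15 = int i" "r' 13 = int j" "r' 10 = int ?m"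
    using I r by (auto simp: garner_inv_def)
  \<comment> \<open>The index is computed before it is compared with \<open>b\<close>, so it must
    fit into a cell even when it points into the padding.\<close>
  have "a \<le> 2 ^ W"
  proof -
    have "a < Suc g * fanout s" using j by (simp add: a_def)
    also have "\<dots> \<le> b * b" using g fanout_le[of s] by (intro mult_le_mono) auto
    finally show ?thesis using b2_le_W by (simp add: power2_eq_square)
  qed
  then have aW: "\<bar>int a\<bar> \<le> 2 ^ W" by (rule abs_int_le)
  have "g * 1 \<le> g * fanout s" using fanout_pos[of s] by (intro mult_le_mono2) linarith
  then have ga: "g \<le> a" unfolding a_def by linarith
  have jW: "\<bar>int (Suc j)\<bar> \<le> 2 ^ W" using j fanout_le[of s] b_le_W by (intro abs_int_le) linarith
  define B where "B = setr 11 (Mem (tab 0)) ;; setr 18 (Mem (tab 1)) ;; setr 12 (Num 1) ;; hensel ;;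
    setr 10 (Mul (reg 10) (reg 18)) ;; setr 13 (Add (reg 13) (Num 1))"
  let ?H = "W * (2 * ?p + 3) + 1"
  let ?r1 = "r'(20 := int a)" let ?r2 = "?r1(17 := int ?x)"
  have B: "wp W n B (1 + (1 + (1 + (?H + (1 + 1))))) ?r2 h (garner_inv x s g r h (Suc j))" if ok2: "ok W n ?r2 h"
    unfolding B_def
  proof (rule wp_set_seq[OF ok2])
    have "val (tab 0) (layout n ?r2 h) = int (n + 31 + 0 + 2 * j)"
      using val_tab[OF ok2, of j 0] r' by simp
    from val_Mem[OF this] show "val (Mem (tab 0)) (layout n ?r2 h) = int ?p"
      using tabs j by (simp add: tables_def)
    show "\<bar>int ?p\<bar> \<le> 2 ^ W" by (rule abs_int_le) (rule base_prime_le_W[OF s j])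
    let ?r3 = "?r2(11 := int ?p)"
    assume ok3: "ok W n ?r3 h"
    show "wp W n (setr 18 (Mem (tab 1)) ;; setr 12 (Num 1) ;; hensel ;;
      setr 10 (Mul (reg 10) (reg 18)) ;; setr 13 (Add (reg 13) (Num 1)))
      (1 + (1 + (?H + (1 + 1)))) ?r3 h (garner_inv x s g r h (Suc j))"
    proof (rule wp_set_seq[OF ok3])
      have "val (tab 1) (layout n ?r3 h) = int (n + 32 + 2 * j)"
        using val_tab[OF ok3, of j 1] r' by simp
      from val_Mem[OF this] show "val (Mem (tab 1)) (layout n ?r3 h) = int ?q"
        using tabs j by (simp add: tables_def)
      show "\<bar>int ?q\<bar> \<le> 2 ^ W" by (rule abs_int_le) (rule modulus_le_W[OF s j])
      let ?r4 = "?r3(18 := int ?q)"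
      assume ok4: "ok W n ?r4 h"
      show "wp W n (setr 12 (Num 1) ;; hensel ;;
        setr 10 (Mul (reg 10) (reg 18)) ;; setr 13 (Add (reg 13) (Num 1)))
        (1 + (?H + (1 + 1))) ?r4 h (garner_inv x s g r h (Suc j))"
      proof (rule wp_set_seq[OF ok4])
        let ?r5 = "?r4(12 := 1)"
        assume ok5: "ok W n ?r5 h"
        show "wp W n (hensel ;; setr 10 (Mul (reg 10) (reg 18)) ;; setr 13 (Add (reg 13) (Num 1)))
          (?H + (1 + 1)) ?r5 h (garner_inv x s g r h (Suc j))"
        proof (rule wp_seq)
          have mW: "?m * ?p ^ min_exp (gip_bound s) ?p \<le> 2 ^ W"
            using modprod_le_W[OF s, of "Suc j"] j by (simp add: base_prime_def)
          show "wp W n hensel ?H ?r5 h (\<lambda>r'' h''. h'' = h \<and> (\<exists>v'. r'' = ?r5(12 := int (?p ^ min_exp (gip_bound s) ?p), 16 := int v') \<and>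
            v' < ?m * ?p ^ min_exp (gip_bound s) ?p \<and> [v' = v] (mod ?m) \<and> [v' = ?x] (mod (?p ^ min_exp (gip_bound s) ?p))))"
            by (rule wp_hensel[OF ok5])
              (use r' v mW base_prime_ge_2 coprime_base_prime_modprod[OF gip_bound_bound j] in \<open>auto simp: modulus_def coprime_commute\<close>)
          fix r6 h6 assume ok6: "ok W n r6 h6" and "h6 = h \<and> (\<exists>v'. r6 = ?r5(12 := int (?p ^ min_exp (gip_bound s) ?p), 16 := int v') \<and>
            v' < ?m * ?p ^ min_exp (gip_bound s) ?p \<and> [v' = v] (mod ?m) \<and> [v' = ?x] (mod (?p ^ min_exp (gip_bound s) ?p)))"
          then obtain v' where 6: "h6 = h" "r6 = ?r5(12 := int ?q, 16 := int v')"
            "v' < ?m * ?q" "[v' = v] (mod ?m)" "[v' = ?x] (mod ?q)" by (auto simp: modulus_def)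
          have vc: "[v' = chunk x s g j'] (mod modulus (gip_bound s) j')" if "j' < Suc j" for j'
          proof (cases "j' = j")
            case False
            then have j': "j' < j" using that by simp
            have "[v' = v] (mod modulus (gip_bound s) j')"
              using 6(4) modulus_dvd_modprod[OF j'] by (rule cong_dvd_modulus_nat)
            then show ?thesis using v(3) j' cong_trans by blast
          qed (use 6 in simp)
          show "wp W n (setr 10 (Mul (reg 10) (reg 18)) ;; setr 13 (Add (reg 13) (Num 1)))
            (1 + 1) r6 h6 (garner_inv x s g r h (Suc j))"
          proof (rule wp_set_seq[OF ok6])
            show "val (Mul (reg 10) (reg 18)) (layout n r6 h6) = int (modprod (gip_bound s) (Suc j))"
              using ok6 6 r' by (simp add: val_reg modprod_Suc del: modprod.simps)
            show "\<bar>int (modprod (gip_bound s) (Suc j))\<bar> \<le> 2 ^ W"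
              using j by (intro abs_int_le modprod_le_W[OF s]) simp
            let ?r7 = "r6(10 := int (modprod (gip_bound s) (Suc j)))"
            assume ok7: "ok W n ?r7 h6"
            have e: "val (Add (reg 13) (Num 1)) (layout n ?r7 h6) = int (Suc j)"
              using ok7 6 r' by (simp add: val_reg del: modprod.simps)
            show "wp W n (setr 13 (Add (reg 13) (Num 1))) 1 ?r7 h6 (garner_inv x s g r h (Suc j))"
            proof (rule wp_set[OF ok7 e _ jW])
              show "garner_inv x s g r h (Suc j) (?r7(13 := int (Suc j))) h6"
                unfolding garner_inv_def using I 6 vc h
                by (auto simp: garner_inv_def modprod_Suc simp del: modprod.simps)
            qed simp
          qed simp
        qed
      qed simp_all
    qed simp
  qed simp
  have "wp W n garner_step (1 + ((1 + 1) + (1 + (1 + (1 + (?H + (1 + 1))))))) r' h' (garner_inv x s g r h (Suc j))"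
    unfolding garner_step_def B_def[symmetric]
  proof (rule wp_set_seq[OF ok])
    show "val (Add (Mul (reg 14) (reg 8)) (reg 13)) (layout n r' h') = int a"
      using r' ok by (simp add: val_reg a_def)
    show "\<bar>int a\<bar> \<le> 2 ^ W" by (rule aW)
    assume ok1: "ok W n ?r1 h'"
    show "wp W n (Cond (Sub (reg 2) (reg 20)) (setr 17 (Mem (inaddr (reg 20)))) (setr 17 (Num 0)) ;; B)
      ((1 + 1) + (1 + (1 + (1 + (?H + (1 + 1)))))) ?r1 h' (garner_inv x s g r h (Suc j))"
    proof (rule wp_seq)
      show "wp W n (Cond (Sub (reg 2) (reg 20)) (setr 17 (Mem (inaddr (reg 20)))) (setr 17 (Num 0))) (1 + 1) ?r1 h'
        (\<lambda>r'' h''. r'' = ?r2 \<and> h'' = h)"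
      proof (rule wp_cond[OF ok1])
        assume "val (Sub (reg 2) (reg 20)) (layout n ?r1 h') > 0"
        then have ab: "a < b" using r' ok1 by (simp add: val_reg)
        have x: "?x = encode x s a" using ab by (simp add: chunk_def a_def)
        have "val (inaddr (reg 20)) (layout n ?r1 h') = int (3 + i * b + a)"
          by (rule val_inaddr[OF ok1]) (use r' ok1 in \<open>auto simp: val_reg\<close>)
        from val_Mem[OF this] have e: "val (Mem (inaddr (reg 20))) (layout n ?r1 h') = int ?x"
          using index_le[OF i ab n] rd[OF ga ab] x h by simp
        have "\<bar>h (3 + i * b + a)\<bar> \<le> 2 ^ W" using ok1 h by (simp add: ok_def)
        then have "\<bar>int ?x\<bar> \<le> 2 ^ W" using rd[OF ga ab] x by simp
        then show "wp W n (setr 17 (Mem (inaddr (reg 20)))) 1 ?r1 h' (\<lambda>r'' h''. r'' = ?r2 \<and> h'' = h)"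
          by (intro wp_set[OF ok1 e]) (use h in auto)
      next
        assume "val (Sub (reg 2) (reg 20)) (layout n ?r1 h') \<le> 0"
        then have ab: "\<not> a < b" using r' ok1 by (simp add: val_reg)
        then have "?x = 0" by (simp add: chunk_def a_def)
        then show "wp W n (setr 17 (Num 0)) 1 ?r1 h' (\<lambda>r'' h''. r'' = ?r2 \<and> h'' = h)"
          by (intro wp_set[OF ok1]) (use h in auto)
      qed
    qed (use B in auto)
  qed simp
  then show ?thesis
  proof (rule wp_mono)
    have "2 * ?p + 3 \<le> 32 * b ^ 2 + 7" using base_prime_le[OF j] by simp
    then have "W * (2 * ?p + 3) \<le> W * (32 * b ^ 2 + 7)" by (rule mult_le_mono2)
    then show "1 + ((1 + 1) + (1 + (1 + (1 + (?H + (1 + 1)))))) \<le> W * (32 * b ^ 2 + 7) + 10" by linarith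
  qed
qed

text \<open>Progress in lexicographic order: the positions before (i, g) already hold level
  \<open>Suc s\<close>, the others still hold level \<open>s\<close>.\<close>

definition garner_heap :: "(nat \<Rightarrow> nat \<Rightarrow> nat) \<Rightarrow> nat \<Rightarrow> nat \<Rightarrow> nat \<Rightarrow> mem \<Rightarrow> bool" where
  "garner_heap X s i g h \<longleftrightarrow> (\<forall>i'<l. \<forall>g'<b. h (3 + i' * b + g') =
    int (encode (X i') (if i' < i \<or> i' = i \<and> g' < g then Suc s else s) g'))"

definition block_inv :: "(nat \<Rightarrow> nat \<Rightarrow> nat) \<Rightarrow> nat \<Rightarrow> nat \<Rightarrow> (nat \<Rightarrow> int) \<Rightarrow> nat \<Rightarrow> (nat \<Rightarrow> int) \<Rightarrow> mem \<Rightarrow> bool" where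
  "block_inv X s i r g r' h' \<longleftrightarrow> (\<forall>c. c < 10 \<or> c = 15 \<longrightarrow> r' c = r c) \<and> r' 14 = int g \<and>
    garner_heap X s i g h' \<and> tables s (fanout s) h'"

lemma index_inj: "g < b \<Longrightarrow> g' < b \<Longrightarrow> i * b + g = i' * b + g' \<longleftrightarrow> i = i' \<and> g = g'"
proof
  assume "g < b" "g' < b" "i * b + g = i' * b + g'"
  then have "(i * b + g) div b = (i' * b + g') div b" "(i * b + g) mod b = (i' * b + g') mod b" by simp_all
  then show "i = i' \<and> g = g'" using \<open>g < b\<close> \<open>g' < b\<close> by simp
qed simp

lemma wp_garner_group:
  assumes ok: "ok W n r' h'" and s: "s < depth" and g: "g < b" and I: "block_inv X s i r g r' h'"
    and r: "r 2 = int b" "r 8 = int (fanout s)" "r 15 = int i"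
    and n: "b * l + 2 \<le> n" and i: "i < l" and X: "\<And>i g. X i g \<le> 1"
  shows "wp W n garner_group (b * (W * (32 * b ^ 2 + 7) + 11) + 6) r' h' (block_inv X s i r (Suc g))"
proof -
  let ?N = "W * (32 * b ^ 2 + 7) + 10"
  let ?r1 = "r'(16 := 0)" let ?r2 = "?r1(10 := 1)" let ?r3 = "?r2(13 := 0)"
  define a where "a = 3 + i * b + g"
  have r': "r' 2 = int b" "r' 8 = int (fanout s)" "r' 14 = int g" "r' 15 = int i"
    using I r by (auto simp: block_inv_def)
  have tabs: "tables s (fanout s) h'" using I by (simp add: block_inv_def)
  have rd: "h' (3 + i * b + a) = int (encode (X i) s a)" if "g \<le> a" "a < b" for a
    using I i that by (simp add: block_inv_def garner_heap_def)
  have "wp W n garner_group (1 + (1 + (1 + ((fanout s * (?N + 1) + 1) + (1 + 1))))) r' h' (block_inv X s i r (Suc g))"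
    unfolding garner_group_def
  proof (rule wp_set_seq[OF ok])
    assume ok1: "ok W n ?r1 h'"
    show "wp W n (setr 10 (Num 1) ;; setr 13 (Num 0) ;; While (Sub (reg 8) (reg 13)) garner_step ;;
      Store (inaddr (reg 14)) (reg 16) ;; setr 14 (Add (reg 14) (Num 1))) 
      (1 + (1 + ((fanout s * (?N + 1) + 1) + (1 + 1)))) ?r1 h' (block_inv X s i r (Suc g))"
    proof (rule wp_set_seq[OF ok1])
      assume ok2: "ok W n ?r2 h'"
      show "wp W n (setr 13 (Num 0) ;; While (Sub (reg 8) (reg 13)) garner_step ;;
        Store (inaddr (reg 14)) (reg 16) ;; setr 14 (Add (reg 14) (Num 1))) 
        (1 + ((fanout s * (?N + 1) + 1) + (1 + 1))) ?r2 h' (block_inv X s i r (Suc g))"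
      proof (rule wp_set_seq[OF ok2])
        assume ok3: "ok W n ?r3 h'"
        show "wp W n (While (Sub (reg 8) (reg 13)) garner_step ;;
          Store (inaddr (reg 14)) (reg 16) ;; setr 14 (Add (reg 14) (Num 1))) 
          ((fanout s * (?N + 1) + 1) + (1 + 1)) ?r3 h' (block_inv X s i r (Suc g))"
        proof (rule wp_seq)
          show "wp W n (While (Sub (reg 8) (reg 13)) garner_step) (fanout s * (?N + 1) + 1) ?r3 h'
            (garner_inv (X i) s g ?r3 h' (fanout s))"
          proof (rule wp_for[where I = "garner_inv (X i) s g ?r3 h'", OF ok3])
            show "garner_inv (X i) s g ?r3 h' 0 ?r3 h'" by (auto simp: garner_inv_def intro!: exI[of _ 0])
            fix j r'' h'' assume j: "j < fanout s" and ok': "ok W n r'' h''" and I': "garner_inv (X i) s g ?r3 h' j r'' h''"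
            show "val (Sub (reg 8) (reg 13)) (layout n r'' h'') > 0"
              using I' ok' j r' by (simp add: val_reg garner_inv_def)
            show "wp W n garner_step ?N r'' h'' (garner_inv (X i) s g ?r3 h' (Suc j))"
              by (rule wp_garner_step[OF ok' s j I' _ _ _ _ n i g tabs rd]) (use r' in auto)
          next
            fix r'' h'' assume ok': "ok W n r'' h''" and I': "garner_inv (X i) s g ?r3 h' (fanout s) r'' h''"
            then show "val (Sub (reg 8) (reg 13)) (layout n r'' h'') \<le> 0"
              using r' by (simp add: val_reg garner_inv_def)
          qed
          fix r4 h4 assume ok4: "ok W n r4 h4" and I4: "garner_inv (X i) s g ?r3 h' (fanout s) r4 h4"
          then have h4: "h4 = h'" and fr4: "\<forall>c. c < 10 \<or> c = 15 \<longrightarrow> r4 c = r c"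
            and r4: "r4 14 = int g" "r4 15 = int i" "r4 2 = int b"
            using I r' r by (auto simp: garner_inv_def block_inv_def)
          obtain v where v: "r4 16 = int v" "v < modprod (gip_bound s) (fanout s)" "\<forall>j'<fanout s. [v = chunk (X i) s g j'] (mod modulus (gip_bound s) j')"
            using I4 by (auto simp: garner_inv_def)
          have vA: "v = encode (X i) (Suc s) g" unfolding encode_Suc using v by (intro crt_eqI[OF gip_bound_bound, symmetric]) auto
          let ?h5 = "h4(a := int v)"
          show "wp W n (Store (inaddr (reg 14)) (reg 16) ;; setr 14 (Add (reg 14) (Num 1))) (1 + 1) r4 h4 (block_inv X s i r (Suc g))"
          proof (rule wp_store_seq[OF ok4])
            show "val (inaddr (reg 14)) (layout n r4 h4) = int a" unfolding a_def
              by (rule val_inaddr[OF ok4]) (use r4 ok4 in \<open>auto simp: val_reg\<close>)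
            show "a \<le> n \<or> a > n + 30" using index_le[OF i g n] by (simp add: a_def)
            show "a \<noteq> 0" by (simp add: a_def)
            show "val (reg 16) (layout n r4 h4) = int v" using v ok4 by (simp add: val_reg)
            show "\<bar>int v\<bar> \<le> 2 ^ W" using v(2) modprod_le_W[OF s, of "fanout s"] by (intro abs_int_le) simp
            assume ok5: "ok W n r4 ?h5"
            have e: "val (Add (reg 14) (Num 1)) (layout n r4 ?h5) = int (Suc g)" using ok5 r4 by (simp add: val_reg)
            have gW: "\<bar>int (Suc g)\<bar> \<le> 2 ^ W" using g b_le_W by (intro abs_int_le) linarith
            have tabs5: "tables s (fanout s) ?h5"
              using tabs h4 index_le[OF i g n] by (auto simp: tables_def a_def)
            have heap5: "garner_heap X s i (Suc g) ?h5"
              unfolding garner_heap_def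
            proof (intro allI impI)
              fix i' g' assume 1: "i' < l" "g' < b"
              have "3 + i' * b + g' = a \<longleftrightarrow> i' = i \<and> g' = g" using index_inj[OF 1(2) g, of i' i] by (simp add: a_def)
              then show "?h5 (3 + i' * b + g') = int (encode (X i') (if i' < i \<or> i' = i \<and> g' < Suc g then Suc s else s) g')"
                using I h4 vA 1 by (auto simp: block_inv_def garner_heap_def less_Suc_eq simp del: encode.simps)
            qed
            show "wp W n (setr 14 (Add (reg 14) (Num 1))) 1 r4 ?h5 (block_inv X s i r (Suc g))"
              by (rule wp_set[OF ok5 e _ gW]) (use fr4 tabs5 heap5 in \<open>auto simp: block_inv_def\<close>)
          qed
        qed
      qed simp_all
    qed simp_all
  qed simp_all
  then show ?thesis
  proof (rule wp_mono)
    have "fanout s * (?N + 1) \<le> b * (?N + 1)" using fanout_le by (rule mult_le_mono1)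
    then show "1 + (1 + (1 + ((fanout s * (?N + 1) + 1) + (1 + 1)))) \<le> b * (W * (32 * b ^ 2 + 7) + 11) + 6"
      by (simp add: algebra_simps)
  qed
qed

definition all_inv :: "(nat \<Rightarrow> nat \<Rightarrow> nat) \<Rightarrow> nat \<Rightarrow> (nat \<Rightarrow> int) \<Rightarrow> nat \<Rightarrow> (nat \<Rightarrow> int) \<Rightarrow> mem \<Rightarrow> bool" where
  "all_inv X s r i r' h' \<longleftrightarrow> (\<forall>c<10. r' c = r c) \<and> r' 15 = int i \<and>
    garner_heap X s i 0 h' \<and> tables s (fanout s) h'"

lemma l_le_W: "l \<le> 2 ^ W"
proof -
  have "l * 1 \<le> gip_bound depth" unfolding gip_bound_def using entry_bound_ge_2[of depth] by (intro mult_le_mono) auto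
  then show ?thesis using W(1) by simp
qed

lemma wp_garner_block:
  assumes ok: "ok W n r' h'" and s: "s < depth" and i: "i < l" and I: "all_inv X s r i r' h'"
    and r: "r 2 = int b" "r 8 = int (fanout s)"
    and n: "b * l + 2 \<le> n" and X: "\<And>i g. X i g \<le> 1"
  shows "wp W n garner_block (b * (b * (W * (32 * b ^ 2 + 7) + 11) + 7) + 3) r' h' (all_inv X s r (Suc i))"
proof -
  let ?N = "b * (W * (32 * b ^ 2 + 7) + 11) + 6"
  let ?r1 = "r'(14 := 0)"
  have r': "r' 2 = int b" "r' 8 = int (fanout s)" "r' 15 = int i" using I r by (auto simp: all_inv_def)
  have "wp W n garner_block (1 + ((b * (?N + 1) + 1) + 1)) r' h' (all_inv X s r (Suc i))"
    unfolding garner_block_def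
  proof (rule wp_set_seq[OF ok])
    assume ok1: "ok W n ?r1 h'"
    show "wp W n (While (Sub (reg 2) (reg 14)) garner_group ;; setr 15 (Add (reg 15) (Num 1))) ((b * (?N + 1) + 1) + 1) ?r1 h' (all_inv X s r (Suc i))"
    proof (rule wp_seq)
      show "wp W n (While (Sub (reg 2) (reg 14)) garner_group) (b * (?N + 1) + 1) ?r1 h' (block_inv X s i ?r1 b)"
      proof (rule wp_for[where I = "block_inv X s i ?r1", OF ok1])
        show "block_inv X s i ?r1 0 ?r1 h'" using I by (auto simp: block_inv_def all_inv_def)
        fix g r'' h'' assume g: "g < b" and ok': "ok W n r'' h''" and I': "block_inv X s i ?r1 g r'' h''"
        show "val (Sub (reg 2) (reg 14)) (layout n r'' h'') > 0"
          using I' ok' g r' by (simp add: val_reg block_inv_def)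
        show "wp W n garner_group ?N r'' h'' (block_inv X s i ?r1 (Suc g))"
          by (rule wp_garner_group[OF ok' s g I' _ _ _ n i X]) (use r' in auto)
      next
        fix r'' h'' assume "ok W n r'' h''" "block_inv X s i ?r1 b r'' h''"
        then show "val (Sub (reg 2) (reg 14)) (layout n r'' h'') \<le> 0" using r' by (simp add: val_reg block_inv_def)
      qed
      fix r2 h2 assume ok2: "ok W n r2 h2" and I2: "block_inv X s i ?r1 b r2 h2"
      have r2: "\<forall>c<10. r2 c = r c" "r2 15 = int i" "tables s (fanout s) h2"
        using I2 I r' by (auto simp: block_inv_def all_inv_def)
      \<comment> \<open>Progress (i, b) and progress (i + 1, 0) describe the same memory.\<close>
      have heap: "garner_heap X s (Suc i) 0 h2"
        using I2 by (simp add: block_inv_def garner_heap_def less_Suc_eq del: encode.simps)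
      have e: "val (Add (reg 15) (Num 1)) (layout n r2 h2) = int (Suc i)" using ok2 r2 by (simp add: val_reg)
      have iW: "\<bar>int (Suc i)\<bar> \<le> 2 ^ W" using i l_le_W by (intro abs_int_le) linarith
      show "wp W n (setr 15 (Add (reg 15) (Num 1))) 1 r2 h2 (all_inv X s r (Suc i))"
        by (rule wp_set[OF ok2 e _ iW]) (use r2 heap in \<open>auto simp: all_inv_def\<close>)
    qed
  qed simp_all
  then show ?thesis by (rule wp_mono) simp
qed

lemma wp_garner_all:
  assumes ok: "ok W n r h" and s: "s < depth"
    and r: "r 2 = int b" "r 3 = int l" "r 8 = int (fanout s)" and "garner_heap X s 0 0 h" "tables s (fanout s) h"
    and n: "b * l + 2 \<le> n" and X: "\<And>i g. X i g \<le> 1"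
  shows "wp W n garner_all (l * (b * (b * (W * (32 * b ^ 2 + 7) + 11) + 7) + 4) + 2) r h
    (\<lambda>r' h'. (\<forall>c<10. r' c = r c) \<and> garner_heap X (Suc s) 0 0 h')"
proof -
  let ?N = "b * (b * (W * (32 * b ^ 2 + 7) + 11) + 7) + 3"
  let ?r1 = "r(15 := 0)"
  have "wp W n garner_all (1 + (l * (?N + 1) + 1)) r h (all_inv X s ?r1 l)"
    unfolding garner_all_def
  proof (rule wp_set_seq[OF ok])
    assume ok1: "ok W n ?r1 h"
    show "wp W n (While (Sub (reg 3) (reg 15)) garner_block) (l * (?N + 1) + 1) ?r1 h (all_inv X s ?r1 l)"
    proof (rule wp_for[where I = "all_inv X s ?r1", OF ok1])
      show "all_inv X s ?r1 0 ?r1 h" using assms by (auto simp: all_inv_def)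
      fix i r'' h'' assume i: "i < l" and ok': "ok W n r'' h''" and I': "all_inv X s ?r1 i r'' h''"
      show "val (Sub (reg 3) (reg 15)) (layout n r'' h'') > 0" using I' ok' i r by (simp add: val_reg all_inv_def)
      show "wp W n garner_block ?N r'' h'' (all_inv X s ?r1 (Suc i))"
        by (rule wp_garner_block[OF ok' s i I' _ _ n X]) (use r in auto)
    next
      fix r'' h'' assume "ok W n r'' h''" "all_inv X s ?r1 l r'' h''"
      then show "val (Sub (reg 3) (reg 15)) (layout n r'' h'') \<le> 0" using r by (simp add: val_reg all_inv_def)
    qed
  qed simp_all
  then show ?thesis
    by (rule wp_mono) (simp_all add: all_inv_def garner_heap_def del: encode.simps)
qed

lemma wp_copy_out:
  assumes ok: "ok W n r h" and r: "r 2 = int b" "r 3 = int l" and heap: "garner_heap X s 0 0 h"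
    and n: "b * l + 2 \<le> n"
  shows "wp W n copy_out (3 * l + 2) r h
    (\<lambda>r' h'. r' 3 = int l \<and> (\<forall>i<l. h' (Suc i) = int (encode (X i) s 0)))"
proof -
  define I where "I = (\<lambda>i0 (r' :: nat \<Rightarrow> int) h'. r' 2 = int b \<and> r' 3 = int l \<and> r' 15 = int i0 \<and>
    (\<forall>i<i0. h' (Suc i) = int (encode (X i) s 0)) \<and> (\<forall>i. i0 \<le> i \<and> i < l \<longrightarrow> h' (3 + i * b) = int (encode (X i) s 0)))"
  let ?r1 = "r(15 := 0)"
  have bp: "b > 0" using b by simp
  have "wp W n copy_out (1 + (l * ((1 + 1) + 1) + 1)) r h (I l)"
    unfolding copy_out_def
  proof (rule wp_set_seq[OF ok])
    assume ok1: "ok W n ?r1 h"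
    show "wp W n (While (Sub (reg 3) (reg 15))
      (Store (Add (reg 15) (Num 1)) (Mem (inaddr (Num 0))) ;; setr 15 (Add (reg 15) (Num 1)))) (l * ((1 + 1) + 1) + 1) ?r1 h (I l)"
    proof (rule wp_for[where I = I, OF ok1])
      have "h (3 + i * b) = int (encode (X i) s 0)" if "i < l" for i
        using heap[unfolded garner_heap_def, rule_format, OF that bp] by (simp del: encode.simps)
      then show "I 0 ?r1 h" using r by (simp add: I_def)
      fix i r' h' assume i: "i < l" and ok': "ok W n r' h'" and I: "I i r' h'"
      have r': "r' 2 = int b" "r' 3 = int l" "r' 15 = int i" using I by (auto simp: I_def)
      show "val (Sub (reg 3) (reg 15)) (layout n r' h') > 0" using r' ok' i by (simp add: val_reg)
      let ?v = "int (encode (X i) s 0)"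
      let ?h2 = "h'(Suc i := ?v)"
      have hv: "h' (3 + i * b) = ?v" using I i by (auto simp: I_def)
      show "wp W n (Store (Add (reg 15) (Num 1)) (Mem (inaddr (Num 0))) ;; setr 15 (Add (reg 15) (Num 1)))
        (1 + 1) r' h' (I (Suc i))"
      proof (rule wp_store_seq[OF ok'])
        show "val (Add (reg 15) (Num 1)) (layout n r' h') = int (Suc i)" using r' ok' by (simp add: val_reg)
        have "1 * i \<le> b * i" using bp by (intro mult_le_mono1) simp
        also have "b * i < b * l" using i bp by simp
        finally have "i < b * l" by simp
        then show "Suc i \<le> n \<or> n + 30 < Suc i" using n by simp
        show "Suc i \<noteq> 0" by simp
        have "val (inaddr (Num 0)) (layout n r' h') = int (3 + i * b + 0)"
          by (rule val_inaddr[OF ok']) (use r' in auto)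
        from val_Mem[OF this] show "val (Mem (inaddr (Num 0))) (layout n r' h') = ?v"
          using hv index_le[OF i bp n] by simp
        have "\<bar>h' (3 + i * b)\<bar> \<le> 2 ^ W" using ok' by (simp add: ok_def)
        then show "\<bar>?v\<bar> \<le> 2 ^ W" using hv by simp
        assume ok2: "ok W n r' ?h2"
        have e: "val (Add (reg 15) (Num 1)) (layout n r' ?h2) = int (Suc i)" using r' ok2 by (simp add: val_reg)
        have iW: "\<bar>int (Suc i)\<bar> \<le> 2 ^ W" using i l_le_W by (intro abs_int_le) linarith
        \<comment> \<open>The target cell i + 1 lies below the sources of all later blocks, so the
          copying loses nothing.\<close>
        have "3 + i' * b \<noteq> Suc i" if "Suc i \<le> i'" for i'
        proof -
          have "Suc i * 1 \<le> i' * b" using that bp by (intro mult_le_mono) auto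
          then show ?thesis by simp
        qed
        then have "I (Suc i) (r'(15 := int (Suc i))) ?h2" using I unfolding I_def by (auto simp: less_Suc_eq)
        then show "wp W n (setr 15 (Add (reg 15) (Num 1))) 1 r' ?h2 (I (Suc i))"
          by (intro wp_set[OF ok2 e _ iW]) auto
      qed
    next
      fix r' h' assume "ok W n r' h'" "I l r' h'"
      then show "val (Sub (reg 3) (reg 15)) (layout n r' h') \<le> 0" by (simp add: val_reg I_def)
    qed
  qed simp_all
  then show ?thesis by (rule wp_mono) (auto simp: I_def)
qed

definition psi_steps :: nat where
  "psi_steps = depth * (b * (32 * b ^ 2 + 2 * W + 14) +
    (l * (b * (b * (W * (32 * b ^ 2 + 7) + 11) + 7) + 4) + 2) + 13) + 3 * l + 7"

lemma wp_psi_prog: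
  assumes ok: "ok W n (\<lambda>_. 0) h" and h: "h 1 = int b" "h 2 = int l" "\<And>i g. i < l \<Longrightarrow> g < b \<Longrightarrow> h (3 + i * b + g) = int (X i g)"
    and n: "b * l + 2 \<le> n" and X: "\<And>i g. X i g \<le> 1"
  shows "wp W n (psi_prog k) psi_steps (\<lambda>_. 0) h (\<lambda>r' h'. r' 3 = int l \<and> (\<forall>i<l. h' (Suc i) = int (encode (X i) depth 0)))"
    (is "wp _ _ _ _ _ _ ?Q")
proof -
  let ?r1 = "(\<lambda>_. 0)(2 := int b)" let ?r2 = "?r1(3 := int l)" let ?r3 = "?r2(4 := 1)" let ?r4 = "?r3(5 := 2)"
  let ?N = "l * (b * (b * (W * (32 * b ^ 2 + 7) + 11) + 7) + 4) + 2"
  let ?L = "depth * (b * (32 * b ^ 2 + 2 * W + 14) + ?N + 13) + 1"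
  have W1: "(2::nat) ^ 1 \<le> 2 ^ W" using b_le b by (intro power_increasing) auto
  have "wp W n (psi_prog k) (1 + (1 + (1 + (1 + (?L + (3 * l + 2)))))) (\<lambda>_. 0) h ?Q"
    unfolding psi_prog_def
  proof (rule wp_set_seq[OF ok])
    show "val (Mem (Num 1)) (layout n (\<lambda>_. 0) h) = int b"
      using val_Mem[of "Num 1" n "\<lambda>_. 0" h 1] h n by simp
    show "\<bar>int b\<bar> \<le> 2 ^ W" by (rule abs_int_le[OF b_le_W])
    assume ok1: "ok W n ?r1 h"
    show "wp W n (setr 3 (Mem (Num 2)) ;; setr 4 (Num 1) ;; setr 5 (Num 2) ;; levels k garner_all ;; copy_out)
      (1 + (1 + (1 + (?L + (3 * l + 2))))) ?r1 h ?Q"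
    proof (rule wp_set_seq[OF ok1])
      show "val (Mem (Num 2)) (layout n ?r1 h) = int l" using val_Mem[of "Num 2" n ?r1 h 2] h n by simp
      show "\<bar>int l\<bar> \<le> 2 ^ W" by (rule abs_int_le[OF l_le_W])
      assume ok2: "ok W n ?r2 h"
      show "wp W n (setr 4 (Num 1) ;; setr 5 (Num 2) ;; levels k garner_all ;; copy_out)
        (1 + (1 + (?L + (3 * l + 2)))) ?r2 h ?Q"
      proof (rule wp_set_seq[OF ok2])
        assume ok3: "ok W n ?r3 h"
        show "wp W n (setr 5 (Num 2) ;; levels k garner_all ;; copy_out)
          (1 + (?L + (3 * l + 2))) ?r3 h ?Q"
        proof (rule wp_set_seq[OF ok3])
          show "\<bar>2 :: int\<bar> \<le> 2 ^ W" using abs_int_le[of 2 W] W1 by simp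
          assume ok4: "ok W n ?r4 h"
          show "wp W n (levels k garner_all ;; copy_out) (?L + (3 * l + 2)) ?r4 h ?Q"
          proof (rule wp_seq)
            show "wp W n (levels k garner_all) ?L ?r4 h
              (\<lambda>r' h'. r' 2 = int b \<and> r' 3 = int l \<and> r' 5 = int (entry_bound depth) \<and> garner_heap X depth 0 0 h')"
            proof (rule wp_levels[where J = "\<lambda>s. garner_heap X s 0 0", OF ok4])
              show "garner_heap X 0 0 0 h" using h(3) by (simp add: garner_heap_def)
              fix s h h' assume "garner_heap X s 0 0 h" and "\<And>a. a \<le> n + 30 \<or> a \<ge> n + 31 + 2 * b \<Longrightarrow> h' a = h a"
              then show "garner_heap X s 0 0 h'" unfolding garner_heap_def
                using index_le[OF _ _ n] by (metis trans_le_add1)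
            next
              fix s r h assume "s < depth" "ok W n r h" "r 2 = int b" "r 3 = int l" "r 5 = int (entry_bound (Suc s))"
                "r 8 = int (fanout s)" "tables s (fanout s) h" "garner_heap X s 0 0 h"
              then show "wp W n garner_all ?N r h (\<lambda>r' h'. (\<forall>c<10. r' c = r c) \<and> garner_heap X (Suc s) 0 0 h')"
                by (intro wp_garner_all n X)
            qed simp_all
            fix r5 h5 assume "ok W n r5 h5" "r5 2 = int b \<and> r5 3 = int l \<and> r5 5 = int (entry_bound depth) \<and> garner_heap X depth 0 0 h5"
            then show "wp W n copy_out (3 * l + 2) r5 h5 ?Q" by (intro wp_copy_out n) auto
          qed
        qed simp_all
      qed simp_all
    qed simp_all
  qed simp_all
  then show ?thesis by (rule wp_mono) (simp_all add: psi_steps_def)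
qed

end

section \<open>Enumerating the accepted values\<close>

text \<open>The membership table is indexed by value and starts behind the \<open>2 * b\<close>
  cells of the moduli.\<close>

definition vtab :: "aexp \<Rightarrow> aexp" where
  "vtab e = Add (Mem (Num 0)) (Add (Num 31) (Add (Mul (Num 2) (reg 2)) e))"

definition flag_step :: com where
  "flag_step = setr 17 (Mod (reg 16) (Mem (tab 1))) ;; setr 18 (Mul (reg 18) (Mem (vtab (reg 17)))) ;;
    setr 13 (Add (reg 13) (Num 1))"

text \<open>
  The table of a level is turned into that of the next level in place, for descending \<open>v\<close>, since only
  positions \<open>v mod q \<le> v\<close> are read.
\<close>
definition flag_item :: com where
  "flag_item = setr 16 (Sub (reg 16) (Num 1)) ;; setr 18 (Num 1) ;; setr 13 (Num 0) ;;
    While (Sub (reg 8) (reg 13)) flag_step ;; Store (vtab (reg 16)) (reg 18)"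

definition flag_all :: "nat \<Rightarrow> com" where
  "flag_all k = setr 16 (Mul (reg 3) (epow (reg 5) k)) ;; While (reg 16) flag_item"

text \<open>The two skips give both branches the same number of steps.\<close>

definition emit_step :: com where
  "emit_step = Cond (Mem (vtab (reg 16))) (setr 19 (Add (reg 19) (Num 1)) ;; Store (reg 19) (reg 16)) (Skip ;; Skip) ;;
    setr 16 (Add (reg 16) (Num 1))"

definition emit :: "nat \<Rightarrow> com" where
  "emit k = setr 9 (Mul (reg 3) (epow (reg 5) k)) ;; setr 16 (Num 0) ;; setr 19 (Num 0) ;;
    While (Sub (reg 9) (reg 16)) emit_step"

definition V_main :: "nat \<Rightarrow> com" where
  "V_main k = setr 2 (Mem (Num 1)) ;; setr 3 (Mem (Num 2)) ;; setr 4 (Num 1) ;; setr 5 (Num 2) ;;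
    Store (vtab (Num 0)) (Num 1) ;; levels k (flag_all k) ;; emit k"

lemma val_vtab: "ok W n r h \<Longrightarrow> r 2 = int b \<Longrightarrow> val e (layout n r h) = int a \<Longrightarrow>
    val (vtab e) (layout n r h) = int (n + 31 + 2 * b + a)"
  by (simp add: vtab_def val_reg layout_out) (simp add: ok_def)

context machine
begin

text \<open>The condition ranges over all v: accepted values are bounded and the memory behind them
  is 0, so the length of the table need not be tracked.\<close>

definition vtable :: "(nat \<Rightarrow> bool) \<Rightarrow> mem \<Rightarrow> bool" where
  "vtable P h \<longleftrightarrow> (\<forall>v. h (n + 31 + 2 * b + v) = of_bool (P v))"

definition flag_inv :: "nat \<Rightarrow> (nat \<Rightarrow> int) \<Rightarrow> mem \<Rightarrow> nat \<Rightarrow> nat \<Rightarrow> (nat \<Rightarrow> int) \<Rightarrow> mem \<Rightarrow> bool" where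
  "flag_inv s r h v j r' h' \<longleftrightarrow> h' = h \<and> (\<forall>c<10. r' c = r c) \<and> r' 13 = int j \<and> r' 16 = int v \<and>
    r' 18 = of_bool (\<forall>j'<j. v mod modulus (gip_bound s) j' \<in> accepted s)"

definition flags_inv :: "nat \<Rightarrow> (nat \<Rightarrow> int) \<Rightarrow> nat \<Rightarrow> (nat \<Rightarrow> int) \<Rightarrow> mem \<Rightarrow> bool" where
  "flags_inv s r v r' h' \<longleftrightarrow> (\<forall>c<10. r' c = r c) \<and> r' 16 = int v \<and> tables s (fanout s) h' \<and>
    vtable (\<lambda>u. if u < v then u \<in> accepted s else u \<in> accepted (Suc s)) h'"

lemma wp_flag_step:
  assumes ok: "ok W n r' h'" and s: "s < depth" and j: "j < fanout s" and I: "flag_inv s r h v j r' h'"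
    and r: "r 2 = int b" and v: "v \<le> 2 ^ W" and tabs: "tables s (fanout s) h"
    and vt: "\<And>u. u \<le> v \<Longrightarrow> h (n + 31 + 2 * b + u) = of_bool (u \<in> accepted s)"
  shows "wp W n flag_step 3 r' h' (flag_inv s r h v (Suc j))"
proof -
  let ?q = "modulus (gip_bound s) j"
  let ?x = "v mod ?q"
  let ?f = "of_bool (\<forall>j'<Suc j. v mod modulus (gip_bound s) j' \<in> accepted s) :: int"
  let ?r1 = "r'(17 := int ?x)" let ?r2 = "?r1(18 := ?f)"
  have r': "r' 2 = int b" "r' 13 = int j" "r' 16 = int v" "h' = h" using I r by (auto simp: flag_inv_def)
  have "wp W n flag_step (1 + (1 + 1)) r' h' (flag_inv s r h v (Suc j))"
    unfolding flag_step_def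
  proof (rule wp_set_seq[OF ok])
    have "val (tab 1) (layout n r' h') = int (n + 32 + 2 * j)" using val_tab[OF ok, of j 1] r' by simp
    from val_Mem[OF this] have "val (Mem (tab 1)) (layout n r' h') = int ?q"
      using tabs j r' by (simp add: tables_def)
    then show "val (Mod (reg 16) (Mem (tab 1))) (layout n r' h') = int ?x"
      using r' ok by (simp add: val_reg zmod_int)
    have xv: "?x \<le> v" by simp
    show "\<bar>int ?x\<bar> \<le> 2 ^ W" by (rule abs_int_le[OF le_trans[OF xv v]])
    assume ok1: "ok W n ?r1 h'"
    show "wp W n (setr 18 (Mul (reg 18) (Mem (vtab (reg 17)))) ;; setr 13 (Add (reg 13) (Num 1)))
      (1 + 1) ?r1 h' (flag_inv s r h v (Suc j))"
    proof (rule wp_set_seq[OF ok1])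
      have "val (vtab (reg 17)) (layout n ?r1 h') = int (n + 31 + 2 * b + ?x)"
        by (rule val_vtab[OF ok1]) (use r' ok1 in \<open>auto simp: val_reg\<close>)
      from val_Mem[OF this] have "val (Mem (vtab (reg 17))) (layout n ?r1 h') = of_bool (?x \<in> accepted s)"
        using vt[OF xv] r' by simp
      moreover have "?f = r' 18 * of_bool (?x \<in> accepted s)"
        using I by (auto simp: flag_inv_def less_Suc_eq)
      ultimately show "val (Mul (reg 18) (Mem (vtab (reg 17)))) (layout n ?r1 h') = ?f"
        using ok1 by (simp add: val_reg)
      show "\<bar>?f\<bar> \<le> 2 ^ W" by simp
      assume ok2: "ok W n ?r2 h'"
      have e: "val (Add (reg 13) (Num 1)) (layout n ?r2 h') = int (Suc j)" using ok2 r' by (simp add: val_reg)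
      have jW: "\<bar>int (Suc j)\<bar> \<le> 2 ^ W" using j fanout_le[of s] b_le_W by (intro abs_int_le) linarith
      show "wp W n (setr 13 (Add (reg 13) (Num 1))) 1 ?r2 h' (flag_inv s r h v (Suc j))"
        by (rule wp_set[OF ok2 e _ jW]) (use I in \<open>auto simp: flag_inv_def\<close>)
    qed simp
  qed simp
  then show ?thesis by (rule wp_mono) simp_all
qed

lemma wp_flag_item:
  assumes ok: "ok W n r' h'" and s: "s < depth" and I: "flags_inv s r (Suc v) r' h'"
    and r: "r 2 = int b" "r 8 = int (fanout s)" and v: "v < gip_bound (Suc s)"
  shows "wp W n flag_item (4 * b + 5) r' h' (flags_inv s r v)"
proof -
  let ?r1 = "r'(16 := int v)" let ?r2 = "?r1(18 := 1)" let ?r3 = "?r2(13 := 0)"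
  have r': "r' 2 = int b" "r' 8 = int (fanout s)" "r' 16 = int (Suc v)" "tables s (fanout s) h'"
    using I r by (auto simp: flags_inv_def)
  have vW: "v \<le> 2 ^ W" using v gip_bound_le_W[of "Suc s"] s by simp
  have vt: "h' (n + 31 + 2 * b + u) = of_bool (u \<in> accepted s)" if "u \<le> v" for u
    using I that by (simp add: flags_inv_def vtable_def del: accepted.simps)
  define a where "a = n + 31 + 2 * b + v"
  have "wp W n flag_item (1 + (1 + (1 + ((fanout s * (3 + 1) + 1) + 1)))) r' h' (flags_inv s r v)"
    unfolding flag_item_def
  proof (rule wp_set_seq[OF ok])
    show "val (Sub (reg 16) (Num 1)) (layout n r' h') = int v" using r' ok by (simp add: val_reg)
    show "\<bar>int v\<bar> \<le> 2 ^ W" by (rule abs_int_le[OF vW])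
    assume ok1: "ok W n ?r1 h'"
    show "wp W n (setr 18 (Num 1) ;; setr 13 (Num 0) ;;
      While (Sub (reg 8) (reg 13)) flag_step ;; Store (vtab (reg 16)) (reg 18))
      (1 + (1 + ((fanout s * (3 + 1) + 1) + 1))) ?r1 h' (flags_inv s r v)"
    proof (rule wp_set_seq[OF ok1])
      assume ok2: "ok W n ?r2 h'"
      show "wp W n (setr 13 (Num 0) ;;
        While (Sub (reg 8) (reg 13)) flag_step ;; Store (vtab (reg 16)) (reg 18))
        (1 + ((fanout s * (3 + 1) + 1) + 1)) ?r2 h' (flags_inv s r v)"
      proof (rule wp_set_seq[OF ok2])
        assume ok3: "ok W n ?r3 h'"
        show "wp W n (While (Sub (reg 8) (reg 13)) flag_step ;; Store (vtab (reg 16)) (reg 18))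
          ((fanout s * (3 + 1) + 1) + 1) ?r3 h' (flags_inv s r v)"
        proof (rule wp_seq)
          show "wp W n (While (Sub (reg 8) (reg 13)) flag_step) (fanout s * (3 + 1) + 1) ?r3 h'
            (flag_inv s ?r3 h' v (fanout s))"
          proof (rule wp_for[where I = "flag_inv s ?r3 h' v", OF ok3])
            show "flag_inv s ?r3 h' v 0 ?r3 h'" by (simp add: flag_inv_def)
            fix j r'' h'' assume j: "j < fanout s" and ok': "ok W n r'' h''" and I': "flag_inv s ?r3 h' v j r'' h''"
            show "val (Sub (reg 8) (reg 13)) (layout n r'' h'') > 0"
              using I' ok' j r' by (simp add: val_reg flag_inv_def)
            show "wp W n flag_step 3 r'' h'' (flag_inv s ?r3 h' v (Suc j))"
              by (rule wp_flag_step[OF ok' s j I' _ vW r'(4) vt]) (use r' in auto)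
          next
            fix r'' h'' assume "ok W n r'' h''" "flag_inv s ?r3 h' v (fanout s) r'' h''"
            then show "val (Sub (reg 8) (reg 13)) (layout n r'' h'') \<le> 0"
              using r' by (simp add: val_reg flag_inv_def)
          qed
          fix r4 h4 assume ok4: "ok W n r4 h4" and I4: "flag_inv s ?r3 h' v (fanout s) r4 h4"
          have fr: "\<forall>c<10. r4 c = r c" "r4 2 = int b" "r4 16 = int v" "h4 = h'" 
            using I4 I r' by (auto simp: flag_inv_def flags_inv_def)
          have "r4 18 = of_bool (v \<in> accepted (Suc s))" using I4 v by (simp add: flag_inv_def)
          then have f: "val (reg 18) (layout n r4 h4) = of_bool (v \<in> accepted (Suc s))" using ok4 by (simp add: val_reg)
          show "wp W n (Store (vtab (reg 16)) (reg 18)) 1 r4 h4 (flags_inv s r v)"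
          proof (rule wp_store[OF ok4 _ _ _ f])
            show "val (vtab (reg 16)) (layout n r4 h4) = int a" unfolding a_def
              by (rule val_vtab[OF ok4]) (use fr ok4 in \<open>auto simp: val_reg\<close>)
            show "a \<le> n \<or> n + 30 < a" "a \<noteq> 0" by (auto simp: a_def)
            have "tables s (fanout s) (h4(a := of_bool (v \<in> accepted (Suc s))))"
              using r'(4) fr(4) fanout_le[of s] by (auto simp: tables_def a_def simp del: accepted.simps)
            moreover have "vtable (\<lambda>u. if u < v then u \<in> accepted s else u \<in> accepted (Suc s)) (h4(a := of_bool (v \<in> accepted (Suc s))))"
              using I fr(4) by (auto simp: flags_inv_def vtable_def a_def less_Suc_eq simp del: accepted.simps)
            ultimately show "flags_inv s r v r4 (h4(a := of_bool (v \<in> accepted (Suc s))))"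
              using fr by (simp add: flags_inv_def)
          qed simp
        qed
      qed simp_all
    qed simp_all
  qed simp_all
  then show ?thesis by (rule wp_mono) (use fanout_le[of s] in simp_all)
qed

lemma wp_flag_all:
  assumes ok: "ok W n r h" and s: "s < depth"
    and r: "r 2 = int b" "r 3 = int l" "r 5 = int (entry_bound (Suc s))" "r 8 = int (fanout s)"
    and tabs: "tables s (fanout s) h" and vt: "vtable (\<lambda>v. v \<in> accepted s) h"
  shows "wp W n (flag_all k) (gip_bound depth * (4 * b + 6) + 2) r h
    (\<lambda>r' h'. (\<forall>c<10. r' c = r c) \<and> vtable (\<lambda>v. v \<in> accepted (Suc s)) h')"
proof -
  let ?L = "gip_bound (Suc s)"
  let ?r1 = "r(16 := int ?L)"
  \<comment> \<open>The table is processed downwards: after i rounds the cells from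
    \<open>?L - i\<close> on belong to the next level.\<close>
  define I where "I = (\<lambda>i. flags_inv s ?r1 (?L - i))"
  have "wp W n (flag_all k) (1 + (?L * ((4 * b + 5) + 1) + 1)) r h (I ?L)"
    unfolding flag_all_def
  proof (rule wp_set_seq[OF ok])
    show "val (Mul (reg 3) (epow (reg 5) k)) (layout n r h) = int ?L"
      using r ok by (simp add: val_reg val_epow gip_bound_def)
    show "\<bar>int ?L\<bar> \<le> 2 ^ W" using s by (intro abs_int_le gip_bound_le_W) simp
    assume ok1: "ok W n ?r1 h"
    show "wp W n (While (reg 16) flag_item) (?L * ((4 * b + 5) + 1) + 1) ?r1 h (I ?L)"
    proof (rule wp_for[where I = I, OF ok1])
      \<comment> \<open>Beyond the next bound neither set has elements, so those cells are already
        correct.\<close>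
      have "u \<in> accepted s \<longleftrightarrow> u \<in> accepted (Suc s)" if "\<not> u < ?L" for u
        using that accepted_less[of u s] accepted_less[of u "Suc s"] gip_bound_mono[of s "Suc s"] by (auto simp del: accepted.simps)
      then have "vtable (\<lambda>u. if u < ?L then u \<in> accepted s else u \<in> accepted (Suc s)) h"
        using vt unfolding vtable_def by (simp del: accepted.simps)
      then show "I 0 ?r1 h" using tabs by (simp add: I_def flags_inv_def)
      fix i r' h' assume i: "i < ?L" and ok': "ok W n r' h'" and I: "I i r' h'"
      have e: "?L - i = Suc (?L - Suc i)" using i by simp
      show "val (reg 16) (layout n r' h') > 0" using I i ok' by (simp add: val_reg I_def flags_inv_def)
      show "wp W n flag_item (4 * b + 5) r' h' (I (Suc i))" unfolding I_def
        by (rule wp_flag_item[OF ok' s]) (use I e r i in \<open>auto simp: I_def\<close>)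
    next
      fix r' h' assume "ok W n r' h'" "I ?L r' h'"
      then show "val (reg 16) (layout n r' h') \<le> 0" by (simp add: val_reg I_def flags_inv_def)
    qed
  qed simp
  then show ?thesis
  proof (rule wp_mono)
    have "?L * (4 * b + 6) \<le> gip_bound depth * (4 * b + 6)" using s by (intro mult_le_mono1 gip_bound_mono) simp
    then show "1 + (?L * ((4 * b + 5) + 1) + 1) \<le> gip_bound depth * (4 * b + 6) + 2" by (simp add: algebra_simps)
  qed (simp add: I_def flags_inv_def del: accepted.simps)
qed

definition found :: "nat \<Rightarrow> nat list" where
  "found v = filter (\<lambda>u. u \<in> accepted depth) [0..<v]"

lemma length_found: "length (found v) \<le> v"
  using length_filter_le[of "\<lambda>u. u \<in> accepted depth" "[0..<v]"] by (simp add: found_def)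

lemma found_Suc: "found (Suc v) = (if v \<in> accepted depth then found v @ [v] else found v)"
  by (simp add: found_def)

definition emit_inv :: "nat \<Rightarrow> (nat \<Rightarrow> int) \<Rightarrow> mem \<Rightarrow> bool" where
  "emit_inv v r h \<longleftrightarrow> r 2 = int b \<and> r 9 = int (gip_bound depth) \<and> r 16 = int v \<and> r 19 = int (length (found v)) \<and>
    (\<forall>i<length (found v). h (Suc i) = int (found v ! i)) \<and> vtable (\<lambda>v. v \<in> accepted depth) h"

text \<open>The output overwrites the input cells 1 and 2, whose contents are in registers by then.
  At most one value is listed per scanned v, so \<open>gip_bound depth \<le> n\<close> keeps the
  output below the registers.\<close>

lemma wp_emit_step:
  assumes ok: "ok W n r h" and v: "v < gip_bound depth" and I: "emit_inv v r h" and n: "gip_bound depth \<le> n"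
  shows "wp W n emit_step 4 r h (emit_inv (Suc v))"
proof -
  have r: "r 2 = int b" "r 16 = int v" "r 19 = int (length (found v))" using I by (auto simp: emit_inv_def)
  have vW: "\<bar>int (Suc v)\<bar> \<le> 2 ^ W" using v W(1) by (intro abs_int_le) linarith
  have vW': "\<bar>int v\<bar> \<le> 2 ^ W" using v W(1) by (intro abs_int_le) linarith
  define J where "J r h \<longleftrightarrow> emit_inv (Suc v) (r(16 := int (Suc v))) h \<and> r 16 = int v" for r h
  have "wp W n emit_step ((1 + (1 + 1)) + 1) r h (emit_inv (Suc v))"
    unfolding emit_step_def
  proof (rule wp_seq)
    have "val (vtab (reg 16)) (layout n r h) = int (n + 31 + 2 * b + v)"
      by (rule val_vtab[OF ok]) (use r ok in \<open>auto simp: val_reg\<close>)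
    from val_Mem[OF this] have g: "val (Mem (vtab (reg 16))) (layout n r h) = of_bool (v \<in> accepted depth)"
      using I by (simp add: emit_inv_def vtable_def)
    show "wp W n (Cond (Mem (vtab (reg 16))) (setr 19 (Add (reg 19) (Num 1)) ;; Store (reg 19) (reg 16)) (Skip ;; Skip))
      (1 + (1 + 1)) r h J"
    proof (rule wp_cond[OF ok])
      assume "val (Mem (vtab (reg 16))) (layout n r h) > 0"
      then have mem: "v \<in> accepted depth" unfolding g by (cases "v \<in> accepted depth") simp_all
      let ?m = "Suc (length (found v))"
      have mv: "?m \<le> gip_bound depth" using length_found[of v] v by simp
      show "wp W n (setr 19 (Add (reg 19) (Num 1)) ;; Store (reg 19) (reg 16)) (1 + 1) r h J"
      proof (rule wp_set_seq[OF ok])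
        show "val (Add (reg 19) (Num 1)) (layout n r h) = int ?m" using r ok by (simp add: val_reg)
        show "\<bar>int ?m\<bar> \<le> 2 ^ W" by (rule abs_int_le[OF le_trans[OF mv W(1)]])
        assume ok1: "ok W n (r(19 := int ?m)) h"
        show "wp W n (Store (reg 19) (reg 16)) 1 (r(19 := int ?m)) h J"
        proof (rule wp_store[OF ok1 _ _ _ _ vW'])
          show "val (reg 19) (layout n (r(19 := int ?m)) h) = int ?m" using ok1 by (simp add: val_reg)
          show "?m \<le> n \<or> n + 30 < ?m" using mv n by simp
          show "val (reg 16) (layout n (r(19 := int ?m)) h) = int v" using r ok1 by (simp add: val_reg)
          have "vtable (\<lambda>v. v \<in> accepted depth) (h(?m := int v))" using I mv n by (simp add: emit_inv_def vtable_def)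
          then show "J (r(19 := int ?m)) (h(?m := int v))"
            using I mem by (auto simp: J_def emit_inv_def found_Suc nth_append less_Suc_eq)
        qed simp
      qed simp
    next
      assume "val (Mem (vtab (reg 16))) (layout n r h) \<le> 0"
      then have mem: "v \<notin> accepted depth" unfolding g by (cases "v \<in> accepted depth") simp_all
      then have "J r h" using I by (auto simp: J_def emit_inv_def found_Suc)
      then show "wp W n (Skip ;; Skip) (1 + 1) r h J"
        by (intro wp_seq[where R = J] wp_skip ok)
    qed
    fix r1 h1 assume ok1: "ok W n r1 h1" and J: "J r1 h1"
    have e: "val (Add (reg 16) (Num 1)) (layout n r1 h1) = int (Suc v)" using J ok1 by (simp add: val_reg J_def)
    show "wp W n (setr 16 (Add (reg 16) (Num 1))) 1 r1 h1 (emit_inv (Suc v))"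
      by (rule wp_set[OF ok1 e _ vW]) (use J in \<open>auto simp: J_def\<close>)
  qed
  then show ?thesis by (rule wp_mono) simp_all
qed

lemma wp_emit:
  assumes ok: "ok W n r h" and r: "r 2 = int b" "r 3 = int l" "r 5 = int (entry_bound depth)"
    and vt: "vtable (\<lambda>v. v \<in> accepted depth) h" and n: "gip_bound depth \<le> n"
  shows "wp W n (emit k) (gip_bound depth * 5 + 4) r h (emit_inv (gip_bound depth))"
proof -
  let ?r1 = "r(9 := int (gip_bound depth))" let ?r2 = "?r1(16 := 0)" let ?r3 = "?r2(19 := 0)"
  have "wp W n (emit k) (1 + (1 + (1 + (gip_bound depth * (4 + 1) + 1)))) r h (emit_inv (gip_bound depth))"
    unfolding emit_def
  proof (rule wp_set_seq[OF ok])
    show "val (Mul (reg 3) (epow (reg 5) k)) (layout n r h) = int (gip_bound depth)"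
      using r ok by (simp add: val_reg val_epow gip_bound_def)
    show "\<bar>int (gip_bound depth)\<bar> \<le> 2 ^ W" by (rule abs_int_le[OF W(1)])
    assume ok1: "ok W n ?r1 h"
    show "wp W n (setr 16 (Num 0) ;; setr 19 (Num 0) ;; While (Sub (reg 9) (reg 16)) emit_step)
      (1 + (1 + (gip_bound depth * (4 + 1) + 1))) ?r1 h (emit_inv (gip_bound depth))"
    proof (rule wp_set_seq[OF ok1])
      assume ok2: "ok W n ?r2 h"
      show "wp W n (setr 19 (Num 0) ;; While (Sub (reg 9) (reg 16)) emit_step)
        (1 + (gip_bound depth * (4 + 1) + 1)) ?r2 h (emit_inv (gip_bound depth))"
      proof (rule wp_set_seq[OF ok2])
        assume ok3: "ok W n ?r3 h"
        show "wp W n (While (Sub (reg 9) (reg 16)) emit_step) (gip_bound depth * (4 + 1) + 1) ?r3 h (emit_inv (gip_bound depth))"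
        proof (rule wp_for[where I = emit_inv, OF ok3])
          show "emit_inv 0 ?r3 h" using r vt by (simp add: emit_inv_def found_def)
          fix v r' h' assume v: "v < gip_bound depth" and ok': "ok W n r' h'" and I: "emit_inv v r' h'"
          show "val (Sub (reg 9) (reg 16)) (layout n r' h') > 0" using I v ok' by (simp add: val_reg emit_inv_def)
          show "wp W n emit_step 4 r' h' (emit_inv (Suc v))" by (rule wp_emit_step[OF ok' v I n])
        next
          fix r' h' assume "ok W n r' h'" "emit_inv (gip_bound depth) r' h'"
          then show "val (Sub (reg 9) (reg 16)) (layout n r' h') \<le> 0" by (simp add: val_reg emit_inv_def)
        qed
      qed simp_all
    qed simp_all
  qed simp
  then show ?thesis by (rule wp_mono) simp_all
qed

definition V_steps :: nat where
  "V_steps = depth * (b * (32 * b ^ 2 + 2 * W + 14) + (gip_bound depth * (4 * b + 6) + 2) + 13) + gip_bound depth * 5 + 10"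

text \<open>With all cells behind the registers equal to 0, storing a single 1 at offset 0 creates
  the table of \<open>accepted 0\<close>.\<close>

lemma wp_V_main:
  assumes ok: "ok W n (\<lambda>_. 0) h" and h: "h 1 = int b" "h 2 = int l" "\<And>a. a > n + 30 \<Longrightarrow> h a = 0"
    and n: "gip_bound depth \<le> n"
  shows "wp W n (V_main k) V_steps (\<lambda>_. 0) h (emit_inv (gip_bound depth))"
proof -
  let ?Q = "emit_inv (gip_bound depth)"
  let ?r1 = "(\<lambda>_. 0)(2 := int b)" let ?r2 = "?r1(3 := int l)" let ?r3 = "?r2(4 := 1)" let ?r4 = "?r3(5 := 2)"
  let ?N = "gip_bound depth * (4 * b + 6) + 2"
  let ?L = "depth * (b * (32 * b ^ 2 + 2 * W + 14) + ?N + 13) + 1"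
  let ?E = "gip_bound depth * 5 + 4"
  have W1: "(2::nat) ^ 1 \<le> 2 ^ W" using b_le b by (intro power_increasing) auto
  have n2: "2 \<le> n" using n gip_bound_ge_2[of depth] by simp
  have "wp W n (V_main k) (1 + (1 + (1 + (1 + (1 + (?L + ?E)))))) (\<lambda>_. 0) h ?Q"
    unfolding V_main_def
  proof (rule wp_set_seq[OF ok])
    show "val (Mem (Num 1)) (layout n (\<lambda>_. 0) h) = int b"
      using val_Mem[of "Num 1" n "\<lambda>_. 0" h 1] h n2 by simp
    show "\<bar>int b\<bar> \<le> 2 ^ W" by (rule abs_int_le[OF b_le_W])
    assume ok1: "ok W n ?r1 h"
    show "wp W n (setr 3 (Mem (Num 2)) ;; setr 4 (Num 1) ;; setr 5 (Num 2) ;; 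
      Store (vtab (Num 0)) (Num 1) ;; levels k (flag_all k) ;; emit k)
      (1 + (1 + (1 + (1 + (?L + ?E))))) ?r1 h ?Q"
    proof (rule wp_set_seq[OF ok1])
      show "val (Mem (Num 2)) (layout n ?r1 h) = int l" using val_Mem[of "Num 2" n ?r1 h 2] h n2 by simp
      show "\<bar>int l\<bar> \<le> 2 ^ W" by (rule abs_int_le[OF l_le_W])
      assume ok2: "ok W n ?r2 h"
      show "wp W n (setr 4 (Num 1) ;; setr 5 (Num 2) ;; Store (vtab (Num 0)) (Num 1) ;; levels k (flag_all k) ;; emit k)
        (1 + (1 + (1 + (?L + ?E)))) ?r2 h ?Q"
      proof (rule wp_set_seq[OF ok2])
        assume ok3: "ok W n ?r3 h"
        show "wp W n (setr 5 (Num 2) ;; Store (vtab (Num 0)) (Num 1) ;; levels k (flag_all k) ;; emit k)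
          (1 + (1 + (?L + ?E))) ?r3 h ?Q"
        proof (rule wp_set_seq[OF ok3])
          show "\<bar>2 :: int\<bar> \<le> 2 ^ W" using abs_int_le[of 2 W] W1 by simp
          assume ok4: "ok W n ?r4 h"
          let ?h5 = "h(n + 31 + 2 * b + 0 := 1)"
          show "wp W n (Store (vtab (Num 0)) (Num 1) ;; levels k (flag_all k) ;; emit k) (1 + (?L + ?E)) ?r4 h ?Q"
          proof (rule wp_store_seq[OF ok4])
            show "val (vtab (Num 0)) (layout n ?r4 h) = int (n + 31 + 2 * b + 0)"
              by (rule val_vtab[OF ok4]) auto
            assume ok5: "ok W n ?r4 ?h5"
            show "wp W n (levels k (flag_all k) ;; emit k) (?L + ?E) ?r4 ?h5 ?Q"
            proof (rule wp_seq)
              show "wp W n (levels k (flag_all k)) ?L ?r4 ?h5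
                (\<lambda>r' h'. r' 2 = int b \<and> r' 3 = int l \<and> r' 5 = int (entry_bound depth) \<and> vtable (\<lambda>v. v \<in> accepted depth) h')"
              proof (rule wp_levels[where J = "\<lambda>s. vtable (\<lambda>v. v \<in> accepted s)", OF ok5])
                show "vtable (\<lambda>v. v \<in> accepted 0) ?h5" using h(3) by (auto simp: vtable_def)
                fix s h h' assume "vtable (\<lambda>v. v \<in> accepted s) h" and "\<And>a. a \<le> n + 30 \<or> a \<ge> n + 31 + 2 * b \<Longrightarrow> h' a = h a"
                then show "vtable (\<lambda>v. v \<in> accepted s) h'" by (simp add: vtable_def)
              next
                fix s r h assume "s < depth" "ok W n r h" "r 2 = int b" "r 3 = int l" "r 5 = int (entry_bound (Suc s))"
                  "r 8 = int (fanout s)" "tables s (fanout s) h" "vtable (\<lambda>v. v \<in> accepted s) h"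
                then show "wp W n (flag_all k) ?N r h (\<lambda>r' h'. (\<forall>c<10. r' c = r c) \<and> vtable (\<lambda>v. v \<in> accepted (Suc s)) h')"
                  by (intro wp_flag_all)
              qed simp_all
              fix r6 h6 assume "ok W n r6 h6" "r6 2 = int b \<and> r6 3 = int l \<and> r6 5 = int (entry_bound depth) \<and> vtable (\<lambda>v. v \<in> accepted depth) h6"
              then show "wp W n (emit k) ?E r6 h6 ?Q" by (intro wp_emit n) auto
            qed
          qed simp_all
        qed simp_all
      qed simp_all
    qed simp_all
  qed simp_all
  then show ?thesis by (rule wp_mono) (simp_all add: V_steps_def)
qed

end

section \<open>The theorem\<close>

lemma layout_self: "(\<And>a. n < a \<Longrightarrow> a \<le> n + 30 \<Longrightarrow> s a = 0) \<Longrightarrow> layout n (\<lambda>_. 0) s = s"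
  by (rule ext) (auto simp: layout_def)

text \<open>Writing the output length to cell 0 destroys the register layout, so this last step is
  argued outside \<open>wp\<close>.\<close>

lemma wp_finish:
  assumes "wp W n c N r h Q" and Q: "\<And>r' h'. ok W n r' h' \<Longrightarrow> Q r' h' \<Longrightarrow> 
    r' c0 = int (length ys) \<and> (\<forall>i<length ys. h' (Suc i) = ys ! i)"
    and c0: "c0 < 30" and ys: "length ys \<le> n"
  shows "\<exists>m\<le>N + 1. \<exists>s'. sexec W (c ;; Store (Num 0) (reg c0)) (layout n r h) m s' \<and> unload s' = ys"
proof -
  obtain m r' h' where 1: "m \<le> N" "sexec W c (layout n r h) m (layout n r' h')" "ok W n r' h'" "Q r' h'"
    using assms(1) by (auto simp: wp_def)
  let ?s = "(layout n r' h')(0 := r' c0)"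
  have "sexec W (Store (Num 0) (reg c0)) (layout n r' h') 1 ?s"
    using sexec.Store[OF ok_bounded_mem[OF 1(3)], of "Num 0" "reg c0"] val_reg[OF 1(3) c0] by simp
  with 1(2) have "sexec W (c ;; Store (Num 0) (reg c0)) (layout n r h) (m + 1) ?s" by (rule sexec.Seq)
  moreover have "unload ?s = ys"
  proof (rule nth_equalityI)
    have y: "r' c0 = int (length ys)" "\<And>i. i < length ys \<Longrightarrow> h' (Suc i) = ys ! i" using Q 1 by auto
    then show "length (unload ?s) = length ys" by (simp add: unload_def)
    fix i assume "i < length (unload ?s)"
    then have i: "i < length ys" using y by (simp add: unload_def)
    then have "layout n r' h' (Suc i) = h' (Suc i)" using ys by (intro layout_out) simp
    then show "unload ?s ! i = ys ! i" using i y by (simp add: unload_def)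
  qed
  moreover have "m + 1 \<le> N + 1" using 1(1) by simp
  ultimately show ?thesis by blast
qed

lemma computes_within_sexec:
  assumes "sexec W c (load xs) m s'" "unload s' = ys" "W \<ge> 1" "m * (com_weight c * W) \<le> T"
  shows "computes_within c xs ys T"
proof -
  obtain t where "t \<le> m * (com_weight c * W)" "exec c (load xs) t s'" using sexec_exec[OF assms(1,3)] by blast
  then show ?thesis unfolding computes_within_def using assms(2,4) le_trans by blast
qed

definition P_prog :: "nat \<Rightarrow> com" where
  "P_prog k = psi_prog k ;; Store (Num 0) (reg 3)"

text \<open>
  The output may be much longer than the input, so cell \<open>0\<close> is first raised to a number above all
  output cells, which moves the registers out of their way.
\<close>
definition base_prog :: "nat \<Rightarrow> com" where
  "base_prog k = setr 0 (epow (Mem (Num 1)) (4 * k + 2)) ;; setr 1 (Num 1) ;;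
    While (reg 0) (setr 1 (Mul (reg 1) (Mem (Num 2))) ;; setr 0 (Sub (reg 0) (Num 1)))"

definition V_prog :: "nat \<Rightarrow> com" where
  "V_prog k = base_prog k ;; Store (Num 0) (reg 1) ;; V_main k ;; Store (Num 0) (reg 19)"

locale large_dimred = dimred + assumes bk: "b \<ge> 4 * k"
begin

definition kappa :: nat where "kappa = 4 * k + 2"

text \<open>Chosen so that \<open>l ^ (b ^ kappa) \<le> 2 ^ word\<close>. Estimating
  \<open>l\<close> by \<open>2 ^ l\<close> instead of taking a logarithm keeps the word length
  polynomial in \<open>b * l\<close>.\<close>

definition word :: nat where "word = l * b ^ kappa"

lemma W_ge: "b * l + 2 \<le> word" "b ^ 2 + b \<le> word" "1 \<le> word"
proof -
  have bk2: "b ^ 2 \<le> b ^ kappa" using b by (intro power_increasing) (auto simp: kappa_def)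
  have "3 * b \<le> b ^ 2" using b by (simp add: power2_eq_square)
  then have 1: "b * 3 \<le> b ^ kappa" using bk2 by simp
  have "l * (b * 3) \<le> word" unfolding word_def using 1 by (rule mult_le_mono2)
  moreover have "1 * 1 \<le> l * b" using l b by (intro mult_le_mono) auto
  moreover have "l * (b * 3) = b * l + 2 * (l * b)" by simp
  ultimately show "b * l + 2 \<le> word" by linarith
  then show "1 \<le> word" by simp
  have "2 * b ^ kappa \<le> word" unfolding word_def using l by (intro mult_le_mono1) simp
  then show "b ^ 2 + b \<le> word" using bk2 1 by linarith
qed

lemma base_le: "l ^ (b ^ kappa) \<le> 2 ^ word"
proof -
  have "l ^ (b ^ kappa) \<le> (2 ^ l) ^ (b ^ kappa)" by (rule power_mono) (simp_all add: less_imp_le)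
  then show ?thesis by (simp add: word_def power_mult)
qed

lemma gip_bound_le_base: "gip_bound depth \<le> l ^ (b ^ kappa)"
  unfolding kappa_def by (rule gip_bound_depth_le_poly[OF bk])

text \<open>\<open>n\<close> stays free because the two programs place their registers at different
  addresses.\<close>

sublocale machine k b l word n for n
  by unfold_locales (use gip_bound_le_base base_le W_ge in auto)

lemma small_le: "x \<le> b * l + 2 \<Longrightarrow> x \<le> 2 ^ word"
  using W_ge(1) less_exp[of word] by (meson le_trans less_imp_le)

lemma P_prog_steps:
  assumes x: "x \<in> cube (b * l)"
  shows "\<exists>m\<le>psi_steps + 1. \<exists>s'. sexec word (P_prog k) (load (int b # int l # x)) m s' \<and> unload s' = psi x"
proof -
  let ?n = "b * l + 2" and ?s = "load (int b # int l # x)"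
  have lx: "length x = b * l" using x by (simp add: cube_def)
  have s: "layout ?n (\<lambda>_. 0) ?s = ?s" by (rule layout_self) (simp add: load_def lx)
  have x1: "x ! i \<in> {0, 1}" if "i < b * l" for i using cube_nth[OF x that] .
  have sx: "?s (3 + i) = x ! i" if "i < b * l" for i using that by (simp add: load_def lx nth_Cons')
  have bl: "b \<le> b * l" "l \<le> b * l" using l b by auto
  have "\<bar>?s a\<bar> \<le> 2 ^ word" for a
  proof -
    consider "a = 0" | "a = 1" | "a = 2" | "3 \<le> a" "a \<le> ?n" | "a > ?n" by linarith
    then show ?thesis
    proof cases
      case 1
      then show ?thesis using abs_int_le[OF small_le[of ?n]] by (simp add: load_def lx)
    next
      case 2
      then show ?thesis using abs_int_le[OF small_le[of b]] bl by (simp add: load_def)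
    next
      case 3
      then show ?thesis using abs_int_le[OF small_le[of l]] bl by (simp add: load_def)
    next
      case 4
      then obtain i where "a = 3 + i" using le_Suc_ex by blast
      then show ?thesis using sx[of i] x1[of i] 4 by auto
    next
      case 5
      then show ?thesis by (simp add: load_def lx)
    qed
  qed
  then have ok: "ok word ?n (\<lambda>_. 0) ?s" by (simp add: ok_def load_def lx)
  have "wp word ?n (psi_prog k) psi_steps (\<lambda>_. 0) ?s
    (\<lambda>r' h'. r' 3 = int l \<and> (\<forall>i<l. h' (Suc i) = int (encode (block_bits x i) depth 0)))"
  proof (rule wp_psi_prog[OF ok])
    show "?s 1 = int b" "?s 2 = int l" by (simp_all add: load_def)
    fix i g assume ig: "i < l" "g < b"
    then have "i * b + g < b * l" by (rule index_less)
    then show "?s (3 + i * b + g) = int (block_bits x i g)"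
      using sx[of "i * b + g"] x1[of "i * b + g"] ig by (auto simp: block_bits_def add.assoc)
  qed (use block_bits_le[OF x] in auto)
  from wp_finish[OF this, of 3 "psi x"] show ?thesis
    unfolding P_prog_def s using bl by (auto simp: psi_def)
qed

lemma wp_base_prog:
  assumes ok: "ok word 2 (\<lambda>_. 0) h" and h: "h 1 = int b" "h 2 = int l"
  shows "wp word 2 (base_prog k) (3 * b ^ kappa + 3) (\<lambda>_. 0) h 
    (\<lambda>r' h'. h' = h \<and> r' 1 = int (l ^ (b ^ kappa)))"
proof -
  let ?e = "b ^ kappa"
  let ?r1 = "(\<lambda>_. 0)(0 := int ?e)" let ?r2 = "?r1(1 := 1)"
  define I where "I = (\<lambda>i (r' :: nat \<Rightarrow> int) h'. h' = h \<and> r' 0 = int (?e - i) \<and> r' 1 = int (l ^ i))"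
  have mem: "val (Mem (Num 1)) (layout 2 r h) = int b" "val (Mem (Num 2)) (layout 2 r h) = int l" for r
    using h layout_out[of 1 2 r h] layout_out[of 2 2 r h] by simp_all
  have eW: "i \<le> ?e \<Longrightarrow> i \<le> 2 ^ word" for i
  proof -
    assume "i \<le> ?e"
    also have "1 * ?e \<le> word" unfolding word_def using l by (intro mult_le_mono1) simp
    finally show ?thesis using less_exp[of word] by (metis le_trans less_imp_le mult_1)
  qed
  have "wp word 2 (base_prog k) (1 + (1 + (?e * ((1 + 1) + 1) + 1))) (\<lambda>_. 0) h (I ?e)"
    unfolding base_prog_def
  proof (rule wp_set_seq[OF ok])
    show "val (epow (Mem (Num 1)) (4 * k + 2)) (layout 2 (\<lambda>_. 0) h) = int ?e"
      unfolding val_epow mem by (simp add: kappa_def)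
    show "\<bar>int ?e\<bar> \<le> 2 ^ word" by (rule abs_int_le[OF eW[OF order_refl]])
    assume ok1: "ok word 2 ?r1 h"
    show "wp word 2 (setr 1 (Num 1) ;; While (reg 0) (setr 1 (Mul (reg 1) (Mem (Num 2))) ;; setr 0 (Sub (reg 0) (Num 1))))
      (1 + (?e * ((1 + 1) + 1) + 1)) ?r1 h (I ?e)"
    proof (rule wp_set_seq[OF ok1])
      assume ok2: "ok word 2 ?r2 h"
      show "wp word 2 (While (reg 0) (setr 1 (Mul (reg 1) (Mem (Num 2))) ;; setr 0 (Sub (reg 0) (Num 1))))
        (?e * ((1 + 1) + 1) + 1) ?r2 h (I ?e)"
      proof (rule wp_for[where I = I, OF ok2])
        show "I 0 ?r2 h" by (simp add: I_def)
        fix i r' h' assume i: "i < ?e" and ok': "ok word 2 r' h'" and I: "I i r' h'"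
        show "val (reg 0) (layout 2 r' h') > 0" using I i ok' by (simp add: val_reg I_def)
        let ?p = "l ^ Suc i"
        show "wp word 2 (setr 1 (Mul (reg 1) (Mem (Num 2))) ;; setr 0 (Sub (reg 0) (Num 1))) (1 + 1) r' h' (I (Suc i))"
        proof (rule wp_set_seq[OF ok'])
          have "val (Mem (Num 2)) (layout 2 r' h') = int l" using I mem by (simp add: I_def)
          then show "val (Mul (reg 1) (Mem (Num 2))) (layout 2 r' h') = int ?p"
            using I val_reg[OF ok', of 1] by (simp del: val.simps(2) add: I_def)
          have "?p \<le> l ^ ?e" using i l by (intro power_increasing) auto
          then show "\<bar>int ?p\<bar> \<le> 2 ^ word" using base_le by (intro abs_int_le) (rule le_trans)
          assume ok3: "ok word 2 (r'(1 := int ?p)) h'"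
          have e: "val (Sub (reg 0) (Num 1)) (layout 2 (r'(1 := int ?p)) h') = int (?e - Suc i)"
            using I i val_reg[OF ok3, of 0] by (simp add: I_def of_nat_diff)
          have "?e - Suc i \<le> ?e" by simp
          then show "wp word 2 (setr 0 (Sub (reg 0) (Num 1))) 1 (r'(1 := int ?p)) h' (I (Suc i))"
            by (intro wp_set[OF ok3 e _ abs_int_le[OF eW]]) (use I in \<open>auto simp: I_def\<close>)
        qed simp
      next
        fix r' h' assume "ok word 2 r' h'" "I ?e r' h'"
        then show "val (reg 0) (layout 2 r' h') \<le> 0" by (simp add: val_reg I_def)
      qed
    qed simp_all
  qed simp
  then show ?thesis by (rule wp_mono) (auto simp: I_def)
qed

lemma V_prog_steps:
  "\<exists>m\<le>3 * b ^ kappa + V_steps + 5. \<exists>s'. sexec word (V_prog k) (load [int b, int l]) m s' \<and>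
    unload s' = map int (found (gip_bound depth))"
proof -
  let ?s = "load [int b, int l]" and ?n = "l ^ (b ^ kappa)"
  have bl: "b \<le> b * l" "l \<le> b * l" using l b by auto
  have s: "layout 2 (\<lambda>_. 0) ?s = ?s" by (rule layout_self) (simp add: load_def)
  have s0: "?s 0 = 2" "?s 1 = int b" "?s 2 = int l" "\<And>a. a > 2 \<Longrightarrow> ?s a = 0"
    by (simp_all add: load_def)
  have "\<bar>?s a\<bar> \<le> 2 ^ word" for a
  proof -
    consider "a = 0" | "a = 1" | "a = 2" | "a > 2" by linarith
    then show ?thesis
      using s0 abs_int_le[OF small_le[of 2]] abs_int_le[OF small_le[of b]] abs_int_le[OF small_le[of l]] bl by cases auto
  qed
  then have ok: "ok word 2 (\<lambda>_. 0) ?s" using s0 by (simp add: ok_def)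
  obtain m1 r1 where 1: "m1 \<le> 3 * b ^ kappa + 3" "sexec word (base_prog k) ?s m1 (layout 2 r1 ?s)" "ok word 2 r1 ?s"
    "r1 1 = int ?n"
    using wp_base_prog[OF ok s0(2,3)] unfolding wp_def s by auto
  let ?t = "(layout 2 r1 ?s)(0 := int ?n)"
  have step2: "sexec word (Store (Num 0) (reg 1)) (layout 2 r1 ?s) 1 ?t"
    using sexec.Store[OF ok_bounded_mem[OF 1(3)], of "Num 0" "reg 1"] val_reg[OF 1(3), of 1] 1(4) by simp
  \<comment> \<open>The old registers occupy cells 3 to 32. They must lie below the new ones, so
    that the new registers and the table start out as 0.\<close>
  have n32: "?n \<ge> 32"
  proof -
    have "l ^ 1 \<le> ?n" using l b by (intro power_increasing) auto
    then show ?thesis using l by simp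
  qed
  have t0: "?t a = 0" if "a > 32" for a using that s0(4) by (simp add: layout_def)
  have t: "layout ?n (\<lambda>_. 0) ?t = ?t" by (rule layout_self) (use n32 t0 in auto)
  have "bounded_mem word (layout 2 r1 ?s)" using 1(3) by (rule ok_bounded_mem)
  then have ok2: "ok word ?n (\<lambda>_. 0) ?t" using abs_int_le[OF base_le] by (auto simp: ok_def bounded_mem_def)
  have "wp word ?n (V_main k) V_steps (\<lambda>_. 0) ?t (emit_inv ?n (gip_bound depth))"
    by (rule wp_V_main[OF ok2]) (use t0 n32 s0 gip_bound_le_base in \<open>auto simp: layout_def\<close>)
  from wp_finish[OF this, of 19 "map int (found (gip_bound depth))"] length_found[of "gip_bound depth"] gip_bound_le_base
  obtain m2 s' where 2: "m2 \<le> V_steps + 1" "sexec word (V_main k ;; Store (Num 0) (reg 19)) ?t m2 s'"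
    "unload s' = map int (found (gip_bound depth))"
    unfolding t by (auto simp: emit_inv_def)
  have "sexec word (V_prog k) ?s (m1 + (1 + m2)) s'"
    unfolding V_prog_def by (intro sexec.Seq[OF 1(2)] sexec.Seq[OF step2] 2(2))
  moreover have "m1 + (1 + m2) \<le> 3 * b ^ kappa + V_steps + 5" using 1(1) 2(1) by simp
  ultimately show ?thesis using 2(3) by blast
qed

lemma set_found: "set (map int (found (gip_bound depth))) = int ` accepted depth"
  using accepted_less[of _ depth] by (auto simp: found_def)

lemma distinct_found: "distinct (map int (found (gip_bound depth)))"
  by (simp add: found_def distinct_map inj_on_def)

section \<open>Polynomial bounds for the running times\<close>

lemma basic_le: "b \<le> word" "l \<le> word" "depth \<le> 2 * word" "b ^ kappa \<le> word" "word \<le> (b * l) ^ kappa"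
proof -
  have "b * 1 \<le> b * l" "1 * l \<le> b * l" using l b by (intro mult_le_mono; simp)+
  then show 1: "b \<le> word" "l \<le> word" using W_ge(1) by linarith+
  have "depth < 2 ^ depth" by (rule less_exp)
  then show "depth \<le> 2 * word" using power_depth 1 by linarith
  have "1 * b ^ kappa \<le> word" unfolding word_def using l by (intro mult_le_mono1) simp
  then show "b ^ kappa \<le> word" by simp
  have "l ^ 1 \<le> l ^ kappa" using l by (intro power_increasing) (auto simp: kappa_def)
  then have "l * b ^ kappa \<le> l ^ kappa * b ^ kappa" by (intro mult_le_mono1) simp
  then show "word \<le> (b * l) ^ kappa" by (simp add: word_def power_mult_distrib mult.commute)
qed

lemma gen_le: "b * (32 * b ^ 2 + 2 * word + 14) \<le> 48 * word ^ 3"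
proof -
  have w: "1 \<le> word ^ 2" using W_ge(3) by simp
  have "b ^ 2 \<le> word ^ 2" using basic_le(1) by (rule power_mono) simp
  moreover have "word \<le> word ^ 2" using W_ge(3) by (simp add: power2_eq_square)
  ultimately have "32 * b ^ 2 + 2 * word + 14 \<le> 48 * word ^ 2" using w by linarith
  then have "b * (32 * b ^ 2 + 2 * word + 14) \<le> word * (48 * word ^ 2)" by (rule mult_le_mono[OF basic_le(1)])
  then show ?thesis by (simp add: power2_eq_square power3_eq_cube)
qed

text \<open>Evaluates nested step bounds from the inside out: a loop adds one power of
  \<open>word\<close>, and its overhead is added to the coefficient.\<close>

lemma grow: "x \<le> c * word ^ i \<Longrightarrow> y \<le> word \<Longrightarrow> y * x + d \<le> (c + d) * word ^ Suc i"
proof -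
  assume x: "x \<le> c * word ^ i" and y: "y \<le> word"
  have "y * x \<le> word * (c * word ^ i)" using y x by (rule mult_le_mono)
  moreover have "d * 1 \<le> d * word ^ Suc i" using W_ge(3) by (intro mult_le_mono2) simp
  moreover have "word * (c * word ^ i) + d * word ^ Suc i = (c + d) * word ^ Suc i" by (simp add: algebra_simps)
  ultimately show ?thesis by linarith
qed

lemma word_powers: "word ^ 4 = word * word ^ 3" "word ^ 5 = word * word ^ 4" "word ^ 7 = word * word ^ 6" "word ^ 8 = word * word ^ 7"
  by (simp_all add: numeral_eq_Suc)

lemma psi_steps_le: "psi_steps + 1 \<le> 259 * word ^ 7"
proof -
  let ?w = "word"
  have "b ^ 2 \<le> ?w ^ 2" using basic_le(1) by (rule power_mono) simp
  moreover have "1 \<le> ?w ^ 2" using W_ge(3) by simp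
  ultimately have 1: "32 * b ^ 2 + 7 \<le> 39 * ?w ^ 2" by linarith
  have 2: "?w * (32 * b ^ 2 + 7) + 11 \<le> 50 * ?w ^ 3" using grow[OF 1, of ?w 11] by simp
  have 3: "b * (?w * (32 * b ^ 2 + 7) + 11) + 7 \<le> 57 * ?w ^ 4" 
    using grow[OF 2 basic_le(1), of 7] by simp
  have 4: "b * (b * (?w * (32 * b ^ 2 + 7) + 11) + 7) + 4 \<le> 61 * ?w ^ 5"
    using grow[OF 3 basic_le(1), of 4] by simp
  have 5: "l * (b * (b * (?w * (32 * b ^ 2 + 7) + 11) + 7) + 4) + 2 \<le> 63 * ?w ^ 6"
    using grow[OF 4 basic_le(2), of 2] by simp
  have "?w ^ 3 \<le> ?w ^ 6" "1 \<le> ?w ^ 6" "?w ^ 1 \<le> ?w ^ 7" "1 \<le> ?w ^ 7"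
    using W_ge(3) by (intro power_increasing one_le_power; simp)+
  then have 6: "b * (32 * b ^ 2 + 2 * ?w + 14) +
    (l * (b * (b * (?w * (32 * b ^ 2 + 7) + 11) + 7) + 4) + 2) + 13 \<le> 124 * ?w ^ 6"
    using gen_le 5 by linarith
  \<comment> \<open>One level costs 124 = 48 + 63 + 13 units, \<open>2 * word\<close> bounds the
    number of levels, and 259 = 2 * 124 + 3 + 7 + 1.\<close>
  have "psi_steps \<le> (2 * ?w) * (124 * ?w ^ 6) + 3 * l + 7"
    unfolding psi_steps_def using mult_le_mono[OF basic_le(3) 6] by simp
  also have "(2 * ?w) * (124 * ?w ^ 6) = 248 * ?w ^ 7" by (simp add: word_powers(3))
  finally show ?thesis using basic_le(2) \<open>?w ^ 1 \<le> ?w ^ 7\<close> \<open>1 \<le> ?w ^ 7\<close> by simp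
qed

lemma P_time: "(psi_steps + 1) * (c * word) \<le> 259 * c * (b * l) ^ (8 * kappa)"
proof -
  have "(psi_steps + 1) * (c * word) \<le> 259 * word ^ 7 * (c * word)" using psi_steps_le by (rule mult_le_mono1)
  also have "\<dots> = 259 * c * word ^ 8" by (simp add: word_powers(4))
  also have "\<dots> \<le> 259 * c * ((b * l) ^ kappa) ^ 8" using basic_le(5) by (intro mult_le_mono2 power_mono) auto
  also have "\<dots> = 259 * c * (b * l) ^ (8 * kappa)" by (simp only: power_mult[symmetric] mult.commute)
  finally show ?thesis .
qed

lemma V_steps_le: "3 * b ^ kappa + V_steps + 5 \<le> 169 * (gip_bound depth * word ^ 4)"
proof -
  let ?w = "word" and ?L = "gip_bound depth"
  have L1: "1 \<le> ?L" using gip_bound_ge_2[of depth] by simp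
  have le: "c * x \<le> c * (?L * ?w ^ j)" if "x \<le> ?w ^ j" for c x j
    using mult_le_mono[OF L1 that] by (intro mult_le_mono2) simp
  have p: "?w ^ 1 \<le> ?w ^ 3" "1 \<le> ?w ^ 3" "?w ^ 1 \<le> ?w ^ 4" "1 \<le> ?w ^ 4"
    using W_ge(3) by (intro power_increasing one_le_power; simp)+
  have "4 * b + 6 \<le> 10 * ?w ^ 3" using basic_le(1) p by simp
  then have a1: "?L * (4 * b + 6) \<le> ?L * (10 * ?w ^ 3)" by (rule mult_le_mono2)
  have a2: "48 * ?w ^ 3 \<le> 48 * (?L * ?w ^ 3)" by (rule le) simp
  have a3: "15 * 1 \<le> 15 * (?L * ?w ^ 3)" using p by (intro le)
  have 6: "b * (32 * b ^ 2 + 2 * ?w + 14) + (?L * (4 * b + 6) + 2) + 13 \<le> 73 * (?L * ?w ^ 3)"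
    using gen_le a1 a2 a3 by linarith
  have "depth * (b * (32 * b ^ 2 + 2 * ?w + 14) + (?L * (4 * b + 6) + 2) + 13) \<le> (2 * ?w) * (73 * (?L * ?w ^ 3))"
    by (rule mult_le_mono[OF basic_le(3) 6])
  also have "\<dots> = 146 * (?L * ?w ^ 4)" by (simp add: word_powers(1))
  finally have 7: "depth * (b * (32 * b ^ 2 + 2 * ?w + 14) + (?L * (4 * b + 6) + 2) + 13) \<le> 146 * (?L * ?w ^ 4)" .
  have "5 * (?L * 1) \<le> 5 * (?L * ?w ^ 4)" using p by (intro mult_le_mono2)
  moreover have "15 * 1 \<le> 15 * (?L * ?w ^ 4)" using p by (intro le)
  moreover have "3 * b ^ kappa \<le> 3 * (?L * ?w ^ 4)" using p basic_le(4) by (intro le) simp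
  \<comment> \<open>169 = 146 + 5 + 3 + 15, with 146 = 2 * 73 from the levels and 15 = 10 + 5 from
    the additive constants.\<close>
  ultimately show ?thesis unfolding V_steps_def using 7 by linarith
qed

lemma V_time: "(3 * b ^ kappa + V_steps + 5) * (c * word) \<le>
    169 * c * (l ^ (2 * k * ((3 * k) ^ log_star (real b) * b)) * (b * l) ^ (5 * kappa))"
proof -
  have "(3 * b ^ kappa + V_steps + 5) * (c * word) \<le> 169 * (gip_bound depth * word ^ 4) * (c * word)"
    using V_steps_le by (rule mult_le_mono1)
  also have "\<dots> = 169 * c * (gip_bound depth * word ^ 5)" by (simp add: word_powers(2))
  also have "\<dots> \<le> 169 * c * (l ^ (2 * k * ((3 * k) ^ log_star (real b) * b)) * ((b * l) ^ kappa) ^ 5)"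
    using basic_le(5) gip_bound_depth_le by (intro mult_le_mono2 mult_le_mono power_mono) auto
  also have "((b * l) ^ kappa) ^ 5 = (b * l) ^ (5 * kappa)" by (simp only: power_mult[symmetric] mult.commute)
  finally show ?thesis .
qed

end

theorem theoremA3:
  fixes k :: nat
  assumes "k \<ge> 2"
  shows "\<exists>(N :: nat) (\<psi> :: nat \<Rightarrow> nat \<Rightarrow> int list \<Rightarrow> int list) (V :: nat \<Rightarrow> nat \<Rightarrow> int set)
            (P :: com) (C :: nat) (d :: nat) (Q :: com) (C' :: nat) (c' :: nat) (d' :: nat).
    \<forall>b \<ge> N. \<forall>l \<ge> N.
      (\<forall>x \<in> cube (b * l). length (\<psi> b l x) = l) \<and>
      (\<forall>x :: nat \<Rightarrow> int list. (\<forall>t < k. x t \<in> cube (b * l)) \<longrightarrow>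
        (gip k (b * l) x = 0 \<longleftrightarrow> gip k l (\<lambda>t. \<psi> b l (x t)) \<in> V b l)) \<and>
      (\<forall>x \<in> cube (b * l). \<forall>i < l.
        0 \<le> \<psi> b l x ! i \<and>
        \<psi> b l x ! i < int l ^ ((3 * k) ^ log_star (real b) * b)) \<and>
      (\<forall>x \<in> cube (b * l).
        computes_within P (int b # int l # x) (\<psi> b l x) (C * (b * l) ^ d)) \<and>
      (\<exists>vs. distinct vs \<and> set vs = V b l \<and>
        computes_within Q [int b, int l] vs
          (C' * (l ^ (c' * ((3 * k) ^ log_star (real b) * b)) * (b * l) ^ d')))"
proof (intro exI allI impI)
  fix b l :: nat
  \<comment> \<open>The threshold \<open>4 * k + 72\<close> covers \<open>b \<ge> 4 * k\<close>,
    \<open>b \<ge> 3\<close> and \<open>l \<ge> 72\<close>.\<close>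
  assume bN: "4 * k + 72 \<le> b" and lN: "4 * k + 72 \<le> l"
  interpret large_dimred k b l by unfold_locales (use assms bN lN in auto)
  have P: "computes_within (P_prog k) (int b # int l # x) (psi x)
      (259 * com_weight (P_prog k) * (b * l) ^ (8 * (4 * k + 2)))" if x: "x \<in> cube (b * l)" for x
  proof -
    obtain m s' where m: "m \<le> psi_steps + 1" "sexec word (P_prog k) (load (int b # int l # x)) m s'" "unload s' = psi x"
      using P_prog_steps[OF x] by blast
    have "m * (com_weight (P_prog k) * word) \<le> (psi_steps + 1) * (com_weight (P_prog k) * word)" using m(1) by (rule mult_le_mono1)
    also note P_time
    finally show ?thesis using computes_within_sexec[OF m(2,3) W_ge(3)] by (simp only: kappa_def)
  qed
  have Q: "computes_within (V_prog k) [int b, int l] (map int (found (gip_bound depth)))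
      (169 * com_weight (V_prog k) * (l ^ (2 * k * ((3 * k) ^ log_star (real b) * b)) * (b * l) ^ (5 * (4 * k + 2))))"
  proof -
    obtain m s' where m: "m \<le> 3 * b ^ kappa + V_steps + 5" "sexec word (V_prog k) (load [int b, int l]) m s'"
      "unload s' = map int (found (gip_bound depth))"
      using V_prog_steps by blast
    have "m * (com_weight (V_prog k) * word) \<le> (3 * b ^ kappa + V_steps + 5) * (com_weight (V_prog k) * word)" using m(1) by (rule mult_le_mono1)
    also note V_time
    finally show ?thesis using computes_within_sexec[OF m(2,3) W_ge(3)] by (simp only: kappa_def)
  qed
  \<comment> \<open>The witnesses are fixed before \<open>b\<close> and \<open>l\<close>, so the
    locale constants appear with explicit parameters, while the programs and numerical constants
    depend on \<open>k\<close> only.\<close>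
  show "(\<forall>x \<in> cube (b * l). length (dimred.psi k b l x) = l) \<and>
      (\<forall>x :: nat \<Rightarrow> int list. (\<forall>t < k. x t \<in> cube (b * l)) \<longrightarrow>
        (gip k (b * l) x = 0 \<longleftrightarrow> gip k l (\<lambda>t. dimred.psi k b l (x t)) \<in> int ` dimred.accepted k b l (dimred.depth b))) \<and>
      (\<forall>x \<in> cube (b * l). \<forall>i < l.
        0 \<le> dimred.psi k b l x ! i \<and>
        dimred.psi k b l x ! i < int l ^ ((3 * k) ^ log_star (real b) * b)) \<and>
      (\<forall>x \<in> cube (b * l). computes_within (P_prog k) (int b # int l # x) (dimred.psi k b l x)
        (259 * com_weight (P_prog k) * (b * l) ^ (8 * (4 * k + 2)))) \<and>
      (\<exists>vs. distinct vs \<and> set vs = int ` dimred.accepted k b l (dimred.depth b) \<and>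
        computes_within (V_prog k) [int b, int l] vs
          (169 * com_weight (V_prog k) * (l ^ (2 * k * ((3 * k) ^ log_star (real b) * b)) * (b * l) ^ (5 * (4 * k + 2)))))"
    using psi_correct psi_bounds P Q set_found distinct_found by (auto simp: psi_def)
qed

end
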